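(* Let $W$ be a solution, for a fixed frequency $k$, of the linearized Euler equations $$\partial_t W=\frac{i f(y)}{k}\Phi,\qquad \Big(-1+\big(g(y)(\tfrac{\partial_y}{k}-it)\big)^2\Big)\Phi=W,\qquad \Phi|_{y=0,1}=0,\qquad W|_{t=0}=\omega_0,\qquad (t,y)\in\mathbb R\times[0,1],$$ where $f=U''(U^{-1}(\cdot))$ and $g=U'(U^{-1}(\cdot))$. Suppose that $f,g\in W^{2,\infty}([0,1])$ and that $(U')^2>c>0$ for some constant $c$. Suppose further that $f\omega_0|_{y=0,1}$ is non-trivial, i.e. $f(0)\omega_0(0)$ and $f(1)\omega_0(1)$ are not both zero. (1) Let $s>1$ and suppose that there is $C<\infty$ with $\|\partial_yW(t)\|_{H^s([0,1])}<C$ for all $t$. Then $\|\partial_yW(t)\|_{L^\infty([0,1])}\gtrsim\log|t|$ as $t\to\pm\infty$, i.e. there are $c'>0$ and $T_0>1$ with $\|\partial_y W(t)\|_{L^\infty([0,1])}\ge c'\log|t|$ for all $|t|\ge T_0$. (2) As a consequence (without assuming the bound in (1)), for any $s$ with $2\ge s>\frac32$, necessarily $\sup_{t>0}\|W(t)\|_{H^s([0,1])}=\infty$.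
   Context: Setting: $L>0$, and $U:[a,b]\to\mathbb R$ is a strictly monotone shear profile, normalized so that $U([a,b])=[0,1]$; $f$ and $g$ are functions on $[0,1]$. The displayed system is the linearized 2D Euler equation around $(U(y),0)$ in the periodic channel of period $L$ in $x$, in coordinates moving with the flow, after a Fourier transform in $x$ and the change of variables $y\mapsto U(y)$. The system decouples in the frequency $k\in\frac{2\pi}{L}(\mathbb Z\setminus\{0\})$; $k$ is fixed, and $W(t)=W(t,k,\cdot)$, $\omega_0=\omega_0(k,\cdot)$ are functions of $y\in[0,1]$. For $0<s<1$, $H^s([0,1])$ is the fractional Sobolev space with norm squared $\|u\|_{L^2}^2+\iint_{[0,1]^2}\frac{|u(x)-u(y)|^2}{|x-y|^{1+2s}}\,dx\,dy$; for non-integer $s>1$, $u\in H^s$ iff $u,\partial_yu\in H^{s-1}$ (recursively); for integer $s$ it is the usual Sobolev space. A norm is $\infty$ if the function is not in the space. *)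

theory Defs
  imports "HOL-Probability.Essential_Supremum"
begin

text \<open>
  Functions on the unit interval are total functions of which only the values on \<open>{0..1}\<close>
  matter; all function-space notions are invariant under modification on Lebesgue null sets.
\<close>

abbreviation leb01 :: "real measure" where
  "leb01 \<equiv> lebesgue_on {0..1}"

text \<open>Test functions in \<open>C\<^sub>c\<^sup>1\<close> of the open interval, as in Brezis' treatment of one-dimensional
  Sobolev spaces; the resulting weak derivative is the same as with \<open>C\<^sub>c\<^sup>\<infinity>\<close> test functions.\<close>

definition test_function :: "(real \<Rightarrow> real) \<Rightarrow> (real \<Rightarrow> real) \<Rightarrow> bool" where
  "test_function \<phi> \<phi>' \<longleftrightarrow>
     (\<forall>x. (\<phi> has_real_derivative \<phi>' x) (at x)) \<and> continuous_on UNIV \<phi>' \<and>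
     (\<exists>K. compact K \<and> K \<subseteq> {0<..<1} \<and> (\<forall>x. x \<notin> K \<longrightarrow> \<phi> x = 0))"

definition weak_deriv ::
  "(real \<Rightarrow> 'a::{banach, second_countable_topology}) \<Rightarrow> (real \<Rightarrow> 'a) \<Rightarrow> bool" where
  "weak_deriv u v \<longleftrightarrow>
     integrable leb01 u \<and> integrable leb01 v \<and>
     (\<forall>\<phi> \<phi>'. test_function \<phi> \<phi>' \<longrightarrow>
        (LINT y|leb01. \<phi>' y *\<^sub>R u y) = - (LINT y|leb01. \<phi> y *\<^sub>R v y))"

definition Linf_norm :: "(real \<Rightarrow> 'a::real_normed_vector) \<Rightarrow> ennreal" where
  "Linf_norm u = esssup leb01 (\<lambda>y. ennreal (norm (u y)))"

definition W2inf :: "(real \<Rightarrow> real) \<Rightarrow> bool" where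
  "W2inf h \<longleftrightarrow> (\<exists>h' h''. weak_deriv h h' \<and> weak_deriv h' h'' \<and>
     Linf_norm h < \<infinity> \<and> Linf_norm h' < \<infinity> \<and> Linf_norm h'' < \<infinity>)"

definition ennsqrt :: "ennreal \<Rightarrow> ennreal" where
  "ennsqrt x = (if x = \<infinity> then \<infinity> else ennreal (sqrt (enn2real x)))"

definition L2_sq :: "(real \<Rightarrow> complex) \<Rightarrow> ennreal" where
  "L2_sq u = (if u \<in> borel_measurable leb01
     then \<integral>\<^sup>+ y. ennreal ((norm (u y))\<^sup>2) \<partial>leb01 else \<infinity>)"

definition L2_norm :: "(real \<Rightarrow> complex) \<Rightarrow> ennreal" where
  "L2_norm u = ennsqrt (L2_sq u)"

definition gagliardo_sq :: "real \<Rightarrow> (real \<Rightarrow> complex) \<Rightarrow> ennreal" where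
  "gagliardo_sq \<sigma> u =
     (\<integral>\<^sup>+ x. (\<integral>\<^sup>+ y. ennreal ((norm (u x - u y))\<^sup>2 / \<bar>x - y\<bar> powr (1 + 2 * \<sigma>)) \<partial>leb01) \<partial>leb01)"

text \<open>
  Squared norm of \<open>H\<^sup>s\<close> for \<open>s = m + \<sigma>\<close> with \<open>0 \<le> \<sigma> < 1\<close>, by recursion on \<open>m\<close>.  Weak derivatives
  are unique almost everywhere, so the infimum is the common value over all representatives of
  the derivative, and it is \<open>\<infinity>\<close> if there is no weak derivative.  For \<open>\<sigma> = 0\<close> this is the classical
  space with an equivalent norm (the \<open>j\<close>-th derivative carries the weight \<open>m choose j\<close>).
\<close>

primrec Hs_sq :: "real \<Rightarrow> nat \<Rightarrow> (real \<Rightarrow> complex) \<Rightarrow> ennreal" where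
  "Hs_sq \<sigma> 0 u = L2_sq u + (if \<sigma> = 0 then 0 else gagliardo_sq \<sigma> u)"
| "Hs_sq \<sigma> (Suc m) u = (INF v\<in>{v. weak_deriv u v}. Hs_sq \<sigma> m u + Hs_sq \<sigma> m v)"

definition Hs_norm :: "real \<Rightarrow> (real \<Rightarrow> complex) \<Rightarrow> ennreal" where
  "Hs_norm s u = ennsqrt (Hs_sq (frac s) (nat \<lfloor>s\<rfloor>) u)"

text \<open>
  The Dirichlet problem \<open>(-1 + (g (\<partial>\<^sub>y/k - it))\<^sup>2) \<Phi> = w\<close>, \<open>\<Phi>(0) = \<Phi>(1) = 0\<close>, for
  \<open>\<Phi> \<in> H\<^sup>2\<close>: \<open>V\<close> is the result of the first application of \<open>g (\<partial>\<^sub>y/k - it)\<close>.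
  \<open>\<Phi>\<close> is its continuous representative, so that its boundary values make sense.
\<close>

definition stream_function ::
  "real \<Rightarrow> (real \<Rightarrow> real) \<Rightarrow> real \<Rightarrow> (real \<Rightarrow> complex) \<Rightarrow> (real \<Rightarrow> complex) \<Rightarrow> bool" where
  "stream_function k g t w \<Phi> \<longleftrightarrow>
     Hs_norm 2 \<Phi> < \<infinity> \<and> continuous_on {0..1} \<Phi> \<and> \<Phi> 0 = 0 \<and> \<Phi> 1 = 0 \<and>
     (\<exists>\<Phi>' V V'. weak_deriv \<Phi> \<Phi>' \<and>
        V = (\<lambda>y. of_real (g y) * (\<Phi>' y / of_real k - \<i> * of_real t * \<Phi> y)) \<and>
        weak_deriv V V' \<and>
        (AE y in leb01.
           - \<Phi> y + of_real (g y) * (V' y / of_real k - \<i> * of_real t * V y) = w y))"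

text \<open>Strong solutions in \<open>L\<^sup>2\<close>: the time derivative is the limit of difference quotients in the
  \<open>L\<^sup>2\<close> norm.\<close>

definition euler_solution ::
  "real \<Rightarrow> (real \<Rightarrow> real) \<Rightarrow> (real \<Rightarrow> real) \<Rightarrow> (real \<Rightarrow> complex) \<Rightarrow>
   (real \<Rightarrow> real \<Rightarrow> complex) \<Rightarrow> (real \<Rightarrow> real \<Rightarrow> complex) \<Rightarrow> bool" where
  "euler_solution k f g \<omega>0 W \<Phi> \<longleftrightarrow>
     (\<forall>t. L2_norm (W t) < \<infinity>) \<and>
     (\<forall>t. stream_function k g t (W t) (\<Phi> t)) \<and>
     (\<forall>t. ((\<lambda>h. L2_norm (\<lambda>y. (W (t + h) y - W t y) / of_real h
                                - \<i> * of_real (f y) / of_real k * \<Phi> t y)) \<longlongrightarrow> 0) (at 0)) \<and>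
     (AE y in leb01. W 0 y = \<omega>0 y)"

end

(* Both parts are proved by contradiction from one fact: if the y-derivative of W(t) were bounded in a
   Hoelder space uniformly in t > 0, then f omega_0 would vanish at both boundary points.  (In part (1)
   the hypothesis already bounds the derivative of W in H^1, hence uniformly in C^(1/2), so it is itself
   contradictory; in part (2) the Gagliardo seminorm of order s - 1 > 1/2 gives the Hoelder bound.)

   Since Phi vanishes at y = 0, W(t,0) = omega_0(0) for all t.  In the variable Z(y) = int_0^y 1/g the
   homogeneous equation is solved by exp(kZ) and exp(-kZ); testing with sinh expresses the normal derivative
   of Phi at y = 0 as an oscillatory integral of W, and one integration by parts shows that it is
   c omega_0(0) / t + o(1/t) with c nonzero, the remainder being small because the y-derivative of W is
   equicontinuous.  Hence d/dt of the y-derivative of W at 0 is c' f(0) omega_0(0) / t + o(1/t), which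
   makes this derivative grow like log t.  This last step is carried out on the moments of W over
   [0, eps], of order eps^2, because W is only known to be differentiable in time in L^2. *)

theory Submission
  imports Defs
begin

text \<open>Write \<open>\<beta>\<close> for f(0) \<omega>0(0) / g(0)^2. The uniform bound M on the
  derivative confines the moment over [0, \<epsilon>] to a disc of radius M \<epsilon>^2 about
  \<epsilon> \<omega>0(0), while between times T1 and T the equation moves it by about
  (\<epsilon>^2/2) |\<beta>| log(T/T1). Both sizes scale like \<epsilon>^2, so the contradiction is
  a matter of T alone. However, replacing Phi near the wall by its linear part means freezing the
  phase exp(ikty), at a relative cost of order |k| T \<epsilon>. Hence T is fixed first and
  \<epsilon> depends on T. Equicontinuity of the derivative, and not only its boundedness, is what
  makes the oscillatory remainder o(1/t): its amplitude changes with t, so the Riemann-Lebesgue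
  lemma for one fixed function would not be enough. The second obstacle is that W(t) is an L^2 class
  at each time, whereas f(0) \<omega>0(0) is pointwise. C^1 representatives are chosen for t > 0,
  time 0 enters through limits of moments, and f has to be shown continuous, not just equal almost
  everywhere to a continuous function.\<close>

section \<open>Weak derivatives on the unit interval\<close>

lemma integrable_leb_continuous_scaleR:
  fixes v :: "real \<Rightarrow> 'a::euclidean_space" and \<phi> :: "real \<Rightarrow> real"
  assumes "continuous_on {a..b} \<phi>" and "integrable (lebesgue_on {a..b}) v"
  shows "integrable (lebesgue_on {a..b}) (\<lambda>y. \<phi> y *\<^sub>R v y)"
proof -
  have "bounded (\<phi> ` {a..b})"
    using assms(1) compact_continuous_image compact_imp_bounded by blast
  then obtain K where K: "\<And>y. y \<in> {a..b} \<Longrightarrow> \<bar>\<phi> y\<bar> \<le> K"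
    by (force simp: bounded_iff)
  show ?thesis
  proof (rule Bochner_Integration.integrable_bound)
    show "integrable (lebesgue_on {a..b}) (\<lambda>y. K *\<^sub>R v y)"
      using assms(2) by simp
    show "(\<lambda>y. \<phi> y *\<^sub>R v y) \<in> borel_measurable (lebesgue_on {a..b})"
      by (intro borel_measurable_scaleR continuous_imp_measurable_on_sets_lebesgue assms(1)
            borel_measurable_integrable[OF assms(2)]) auto
    have "\<bar>\<phi> y\<bar> * norm (v y) \<le> \<bar>K\<bar> * norm (v y)" if "y \<in> {a..b}" for y
      using K[OF that] by (intro mult_right_mono) auto
    then show "AE y in lebesgue_on {a..b}. norm (\<phi> y *\<^sub>R v y) \<le> norm (K *\<^sub>R v y)"
      by (intro AE_I2) auto
  qed
qed

lemma integrable_leb_continuous: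
  fixes v :: "real \<Rightarrow> 'a::euclidean_space"
  assumes "continuous_on {a..b} v"
  shows "integrable (lebesgue_on {a..b}) v"
  by (rule absolutely_integrable_imp_integrable[OF absolutely_integrable_continuous_real[OF assms]]) simp

lemma integrable_on_subIcc:
  fixes h :: "real \<Rightarrow> 'a::banach"
  assumes "h integrable_on {a..b}" "a \<le> x" "y \<le> b"
  shows "h integrable_on {x..y}"
  using assms by (auto intro: integrable_on_subinterval)

lemma integral_diff_Icc:
  fixes h :: "real \<Rightarrow> 'a::banach"
  assumes "h integrable_on {a..b}" "a \<le> x" "x \<le> y" "y \<le> b"
  shows "integral {a..y} h - integral {a..x} h = integral {x..y} h"
  using Henstock_Kurzweil_Integration.integral_combine[of a x y h] assms integrable_on_subIcc[of h a b a y]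
  by (simp add: algebra_simps)

lemma integral_indefinite_integral_by_parts:
  fixes v :: "real \<Rightarrow> 'a::euclidean_space" and \<phi> \<phi>' :: "real \<Rightarrow> real"
  assumes \<phi>: "\<And>y. y \<in> {a..b} \<Longrightarrow> (\<phi> has_real_derivative \<phi>' y) (at y within {a..b})"
    and \<phi>': "continuous_on {a..b} \<phi>'"
    and v: "integrable (lebesgue_on {a..b}) v" and "a \<le> b"
  shows "integral {a..b} (\<lambda>y. \<phi>' y *\<^sub>R integral {a..y} v)
           = \<phi> b *\<^sub>R integral {a..b} v - integral {a..b} (\<lambda>y. \<phi> y *\<^sub>R v y)"
proof -
  define u where "u = (\<lambda>y. integral {a..y} v)"
  define N where "N = (\<lambda>y. integral {a..y} (\<lambda>y. norm (v y)))"
  define D where "D = (\<lambda>y. \<phi> y *\<^sub>R u y - integral {a..y} (\<lambda>y. \<phi>' y *\<^sub>R u y) - integral {a..y} (\<lambda>y. \<phi> y *\<^sub>R v y))"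
  have vi: "v integrable_on {a..b}" and nvi: "(\<lambda>y. norm (v y)) integrable_on {a..b}"
    using v by (auto intro!: integrable_on_lebesgue_on)
  have \<phi>c: "continuous_on {a..b} \<phi>"
    using \<phi> by (rule DERIV_continuous_on)
  have uc: "continuous_on {a..b} u"
    unfolding u_def by (rule indefinite_integral_continuous_1[OF vi])
  have Nc: "continuous_on {a..b} N"
    unfolding N_def by (rule indefinite_integral_continuous_1[OF nvi])
  have \<phi>ui: "(\<lambda>y. \<phi>' y *\<^sub>R u y) integrable_on {a..b}"
    by (intro integrable_continuous_real continuous_intros \<phi>' uc)
  have \<phi>vi: "(\<lambda>y. \<phi> y *\<^sub>R v y) integrable_on {a..b}"
    using integrable_leb_continuous_scaleR[OF \<phi>c v] by (auto intro!: integrable_on_lebesgue_on)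
  have "bounded (\<phi>' ` {a..b})"
    using \<phi>' compact_continuous_image compact_imp_bounded by blast
  then obtain K where K: "\<And>y. y \<in> {a..b} \<Longrightarrow> \<bar>\<phi>' y\<bar> \<le> K"
    by (force simp: bounded_iff)
  have K0: "K \<ge> 0" using K[of a] \<open>a \<le> b\<close> by auto
  have lip: "\<bar>\<phi> y - \<phi> x\<bar> \<le> K * (y - x)" if "a \<le> x" "x \<le> y" "y \<le> b" for x y
  proof -
    have "norm (\<phi> y - \<phi> x) \<le> K * norm (y - x)"
      by (rule field_differentiable_bound[where S="{a..b}" and f'=\<phi>']) (use \<phi> K that in auto)
    then show ?thesis using that by simp
  qed
  \<comment> \<open>\<open>D\<close> is constant: its increments are of smaller order than the length of the interval.\<close>
  have est: "norm (D y - D x) \<le> 2 * K * (y - x) * (N y - N x)" if xy: "a \<le> x" "x \<le> y" "y \<le> b" for x y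
  proof -
    have i1: "(\<lambda>s. \<phi>' s *\<^sub>R u x) integrable_on {x..y}"
      by (intro integrable_continuous_real continuous_intros continuous_on_subset[OF \<phi>']) (use xy in auto)
    have i2: "(\<lambda>s. \<phi> y *\<^sub>R v s) integrable_on {x..y}"
      using integrable_on_subIcc[OF vi] xy by (intro integrable_cmul) auto
    have ftc: "(\<phi>' has_integral (\<phi> y - \<phi> x)) {x..y}"
    proof (rule fundamental_theorem_of_calculus)
      fix s assume "s \<in> {x..y}"
      then have "(\<phi> has_real_derivative \<phi>' s) (at s within {x..y})"
        using xy by (intro DERIV_subset[OF \<phi>]) auto
      then show "(\<phi> has_vector_derivative \<phi>' s) (at s within {x..y})"
        by (simp add: has_real_derivative_iff_has_vector_derivative)
    qed (use xy in auto)
    have e1: "integral {x..y} (\<lambda>s. \<phi>' s *\<^sub>R u x) = (\<phi> y - \<phi> x) *\<^sub>R u x"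
      by (intro integral_unique has_integral_scaleR_left ftc)
    have e2: "integral {x..y} (\<lambda>s. \<phi> y *\<^sub>R v s) = \<phi> y *\<^sub>R (u y - u x)"
      using integral_diff_Icc[OF vi xy] by (simp add: u_def)
    \<comment> \<open>With \<open>u\<close> frozen at \<open>x\<close> and \<open>\<phi>\<close> at
      \<open>y\<close>, the integrals \<open>e1\<close> and \<open>e2\<close> add up to the
      increment of \<open>\<phi> y *\<^sub>R u y\<close>. The four integrands then combine to
      \<open>(\<phi> y - \<phi> s) *\<^sub>R v s - \<phi>' s *\<^sub>R (u s - u x)\<close>, where
      each summand has a small factor.\<close>
    have "D y - D x = integral {x..y} (\<lambda>s. \<phi>' s *\<^sub>R u x) + integral {x..y} (\<lambda>s. \<phi> y *\<^sub>R v s)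
              - integral {x..y} (\<lambda>y. \<phi>' y *\<^sub>R u y) - integral {x..y} (\<lambda>y. \<phi> y *\<^sub>R v y)"
      unfolding D_def e1 e2 integral_diff_Icc[OF \<phi>ui xy, symmetric] integral_diff_Icc[OF \<phi>vi xy, symmetric]
      by (simp add: algebra_simps)
    also have "\<dots> = integral {x..y} (\<lambda>s. \<phi>' s *\<^sub>R u x + \<phi> y *\<^sub>R v s - \<phi>' s *\<^sub>R u s - \<phi> s *\<^sub>R v s)"
      using i1 i2 integrable_on_subIcc[OF \<phi>ui] integrable_on_subIcc[OF \<phi>vi] xy
      by (simp add: Henstock_Kurzweil_Integration.integral_diff Henstock_Kurzweil_Integration.integral_add
            integrable_add integrable_diff)
    also have "norm \<dots> \<le> integral {x..y} (\<lambda>s. K * (y - x) * norm (v s) + K * (N y - N x))"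
    proof (rule integral_norm_bound_integral)
      show "(\<lambda>s. \<phi>' s *\<^sub>R u x + \<phi> y *\<^sub>R v s - \<phi>' s *\<^sub>R u s - \<phi> s *\<^sub>R v s) integrable_on {x..y}"
        using i1 i2 integrable_on_subIcc[OF \<phi>ui] integrable_on_subIcc[OF \<phi>vi] xy by (auto intro!: integrable_add integrable_diff)
      show "(\<lambda>s. K * (y - x) * norm (v s) + K * (N y - N x)) integrable_on {x..y}"
        using integrable_on_subIcc[OF nvi] xy by (intro integrable_add integrable_on_mult_right) auto
      fix s assume s: "s \<in> {x..y}"
      have us: "norm (u s - u x) \<le> N y - N x"
      proof -
        have "u s - u x = integral {x..s} v"
          using integral_diff_Icc[OF vi, of x s] s xy by (simp add: u_def)
        also have "norm \<dots> \<le> integral {x..s} (\<lambda>y. norm (v y))"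
          by (rule integral_norm_bound_integral) (use s xy integrable_on_subIcc[OF vi] integrable_on_subIcc[OF nvi] in auto)
        also have "\<dots> \<le> integral {x..y} (\<lambda>y. norm (v y))"
          by (rule integral_subset_le) (use s xy integrable_on_subIcc[OF nvi] in auto)
        also have "\<dots> = N y - N x" using integral_diff_Icc[OF nvi xy] by (simp add: N_def)
        finally show ?thesis .
      qed
      have l: "\<bar>\<phi> y - \<phi> s\<bar> \<le> K * (y - x)"
        using lip[of s y] s xy K0 mult_left_mono[of "y - s" "y - x" K] by auto
      have "norm (\<phi>' s *\<^sub>R u x + \<phi> y *\<^sub>R v s - \<phi>' s *\<^sub>R u s - \<phi> s *\<^sub>R v s)
          = norm ((\<phi> y - \<phi> s) *\<^sub>R v s - \<phi>' s *\<^sub>R (u s - u x))"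
        by (simp add: algebra_simps)
      also have "\<dots> \<le> \<bar>\<phi> y - \<phi> s\<bar> * norm (v s) + \<bar>\<phi>' s\<bar> * norm (u s - u x)"
        by (rule norm_triangle_le_diff) simp
      also have "\<dots> \<le> K * (y - x) * norm (v s) + K * (N y - N x)"
        by (intro add_mono mult_mono l us K) (use s xy K0 in auto)
      finally show "norm (\<phi>' s *\<^sub>R u x + \<phi> y *\<^sub>R v s - \<phi>' s *\<^sub>R u s - \<phi> s *\<^sub>R v s) \<le> K * (y - x) * norm (v s) + K * (N y - N x)" .
    qed
    also have "\<dots> = K * (y - x) * (N y - N x) + K * (N y - N x) * (y - x)"
      using integrable_on_subIcc[OF nvi] xy integral_diff_Icc[OF nvi xy]
      by (subst Henstock_Kurzweil_Integration.integral_add) (auto simp: N_def intro!: integrable_on_mult_right)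
    finally show ?thesis by (simp add: algebra_simps)
  qed
  have der: "(D has_vector_derivative 0) (at x within {a..b})" if x: "x \<in> {a..b}" for x
    unfolding has_vector_derivative_def has_derivative_within
  proof (intro conjI)
    show "bounded_linear (\<lambda>h. h *\<^sub>R (0::'a))" by simp
    have lim: "((\<lambda>y. 2 * K * \<bar>N y - N x\<bar>) \<longlongrightarrow> 2 * K * \<bar>N x - N x\<bar>) (at x within {a..b})"
      by (intro tendsto_intros) (use Nc x in \<open>auto simp: continuous_on_def\<close>)
    show "((\<lambda>y. (1 / norm (y - x)) *\<^sub>R (D y - (D x + (y - x) *\<^sub>R 0))) \<longlongrightarrow> 0) (at x within {a..b})"
    proof (rule Lim_null_comparison)
      have "norm ((1 / norm (y - x)) *\<^sub>R (D y - (D x + (y - x) *\<^sub>R 0))) \<le> 2 * K * \<bar>N y - N x\<bar>"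
        if y: "y \<in> {a..b}" "y \<noteq> x" for y
      proof -
        have "norm (D y - D x) \<le> 2 * K * \<bar>y - x\<bar> * \<bar>N y - N x\<bar>"
        proof (cases "x \<le> y")
          case True
          have "2 * K * (y - x) * (N y - N x) \<le> 2 * K * (y - x) * \<bar>N y - N x\<bar>"
            by (rule mult_left_mono) (use True K0 in auto)
          then show ?thesis using est[of x y] True y x by auto
        next
          case False
          have "2 * K * (x - y) * (N x - N y) \<le> 2 * K * (x - y) * \<bar>N y - N x\<bar>"
            by (rule mult_left_mono) (use False K0 in auto)
          then show ?thesis using est[of y x] False y x by (auto simp: norm_minus_commute)
        qed
        then have "norm (D y - D x) / \<bar>y - x\<bar> \<le> 2 * K * \<bar>N y - N x\<bar>"
          using y by (simp add: pos_divide_le_eq mult_ac)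
        then show ?thesis by simp
      qed
      then show "\<forall>\<^sub>F y in at x within {a..b}. norm ((1 / norm (y - x)) *\<^sub>R (D y - (D x + (y - x) *\<^sub>R 0))) \<le> 2 * K * \<bar>N y - N x\<bar>"
        by (auto simp: eventually_at_filter intro!: always_eventually)
    qed (use lim in simp)
  qed
  have "D b = D a"
    using has_vector_derivative_zero_constant[of "{a..b}" D] der \<open>a \<le> b\<close> by (metis atLeastAtMost_iff convex_real_interval(5) order_refl)
  then show ?thesis
    by (simp add: D_def u_def algebra_simps)
qed

section \<open>Functions orthogonal to all derivatives of test functions\<close>

lemma test_function_antiderivative:
  fixes \<psi> :: "real \<Rightarrow> real"
  assumes c: "continuous_on UNIV \<psi>" and K: "0 < p" "p \<le> q" "q < 1"
    and supp: "\<And>x. x \<notin> {p..q} \<Longrightarrow> \<psi> x = 0" and int0: "integral {0..1} \<psi> = 0"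
  obtains \<phi> where "test_function \<phi> \<psi>"
proof -
  have "\<exists>F. \<forall>x :: real. - \<infinity> < ereal x \<longrightarrow> ereal x < \<infinity> \<longrightarrow> (F has_vector_derivative \<psi> x) (at x)"
    by (rule einterval_antiderivative) (use c in \<open>auto simp: continuous_on_eq_continuous_at\<close>)
  then obtain F where F: "\<And>x. (F has_real_derivative \<psi> x) (at x)"
    by (auto simp: has_real_derivative_iff_has_vector_derivative)
  define \<phi> where "\<phi> = (\<lambda>x. F x - F 0)"
  have der: "(\<phi> has_real_derivative \<psi> x) (at x)" for x
    unfolding \<phi>_def using F by (auto intro!: derivative_eq_intros)
  have ftc: "\<phi> y - \<phi> x = integral {x..y} \<psi>" if "x \<le> y" for x y
    by (rule integral_unique[symmetric], rule fundamental_theorem_of_calculus[OF that])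
      (use der in \<open>auto simp: has_real_derivative_iff_has_vector_derivative[symmetric] intro: has_field_derivative_at_within\<close>)
  have z: "integral {x..y} \<psi> = 0" if "y < p \<or> q < x" for x y
    using that by (intro integral_unique has_integral_is_0 supp) auto
  have eq: "\<phi> x = \<phi> y" if "x \<le> y" "y < p \<or> q < x" for x y
    using ftc[OF that(1)] z[OF that(2)] by simp
  have \<phi>0: "\<phi> 0 = 0" by (simp add: \<phi>_def)
  have \<phi>1: "\<phi> 1 = 0" using ftc[of 0 1] int0 \<phi>0 by simp
  \<comment> \<open>A primitive of \<open>\<psi>\<close> is constant on each side of
    \<open>{p..q}\<close>. The left constant is 0 by normalization at 0, the right one because
    \<open>\<psi>\<close> has mean zero.\<close>
  have "\<phi> x = 0" if "x \<notin> {p..q}" for x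
  proof -
    consider "x \<le> 0" | "0 \<le> x" "x < p" | "q < x" "x \<le> 1" | "1 \<le> x" using \<open>x \<notin> {p..q}\<close> by fastforce
    then show ?thesis
    proof cases
      case 1 then show ?thesis using eq[of x 0] \<phi>0 K by simp
    next
      case 2 then show ?thesis using eq[of 0 x] \<phi>0 by simp
    next
      case 3 then show ?thesis using eq[of x 1] \<phi>1 by simp
    next
      case 4 then show ?thesis using eq[of 1 x] \<phi>1 K by simp
    qed
  qed
  then have "test_function \<phi> \<psi>"
    unfolding test_function_def using der c K by (auto intro!: exI[of _ "{p..q}"])
  then show ?thesis ..
qed

text \<open>Open intervals are stable under intersection and generate the Borel sets, and the sets
  over which \<open>w\<close> integrates to 0 are closed under complements and disjoint unions. So
  all Borel integrals vanish; Lebesgue sets differ from Borel sets by null sets, and a density with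
  vanishing integrals is zero almost everywhere.\<close>

lemma AE_zero_if_interval_integrals_zero:
  fixes w :: "real \<Rightarrow> 'a::euclidean_space"
  assumes w: "integrable (lebesgue_on {0..1}) w"
    and z: "\<And>x y. 0 < x \<Longrightarrow> x < y \<Longrightarrow> y < 1 \<Longrightarrow> integral {x..y} w = 0"
  shows "AE y in lebesgue_on {0..1}. w y = 0"
proof -
  have wi: "w integrable_on {0..1}" using w by (auto intro: integrable_on_lebesgue_on)
  define G where "G = (\<lambda>y. integral {0..y} w)"
  have Gc: "continuous_on {0..1} G"
    unfolding G_def by (rule indefinite_integral_continuous_1[OF wi])
  have Gi: "G y = G (1/2)" if "y \<in> {0<..<1}" for y
  proof (cases y "1/2::real" rule: linorder_cases)
    case less then show ?thesis
      using z[of y "1/2"] that integral_diff_Icc[OF wi, of y "1/2"] by (simp add: G_def)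
  next
    case greater then show ?thesis
      using z[of "1/2" y] that integral_diff_Icc[OF wi, of "1/2" y] by (simp add: G_def)
  next
    case equal then show ?thesis by (simp only:)
  qed
  \<comment> \<open>The hypothesis stays away from 0 and 1; continuity of the primitive carries its
    consequence to the endpoints.\<close>
  have Gconst: "G y = G (1/2)" if "y \<in> {0..1}" for y
  proof (rule continuous_constant_on_closure[where S="{0<..<1::real}" and f=G])
    show "continuous_on (closure {0<..<1::real}) G" using Gc by simp
    show "y \<in> closure {0<..<1::real}" using that by simp
  qed (fact Gi)
  have z': "integral {x..y} w = 0" if "0 \<le> x" "y \<le> 1" for x y
  proof (cases "x \<le> y")
    case True
    then have "G x = G y" using Gconst[of x] Gconst[of y] that by (metis atLeastAtMost_iff order_trans)
    then show ?thesis using integral_diff_Icc[OF wi, of x y] that True by (simp add: G_def)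
  qed simp
  define P where "P = (\<lambda>A. LINT x|leb01. indicator A x *\<^sub>R w x)"
  have sets[measurable]: "A \<inter> {0..1} \<in> sets leb01" if "A \<in> sets lebesgue" for A
    using that by (auto simp: sets_restrict_space)
  have ind: "integrable leb01 (\<lambda>x. indicator A x *\<^sub>R w x)" if "A \<in> sets lebesgue" for A
  proof -
    have "integrable leb01 (\<lambda>x. indicator (A \<inter> {0..1}) x *\<^sub>R w x)"
      by (intro integrable_mult_indicator sets w that)
    moreover have "integrable leb01 (\<lambda>x. indicator (A \<inter> {0..1}) x *\<^sub>R w x) \<longleftrightarrow> integrable leb01 (\<lambda>x. indicator A x *\<^sub>R w x)"
      by (rule Bochner_Integration.integrable_cong) (auto simp: indicator_def)
    ultimately show ?thesis by simp
  qed
  have total: "(LINT x|leb01. w x) = 0"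
    using z'[of 0 1] w by (simp add: lebesgue_integral_eq_integral)
  have sb: "sets borel = sigma_sets UNIV (range (\<lambda>(a, b). box a b :: real set))"
    by (subst borel_eq_box) (rule sets_measure_of, rule subset_Pow_Union[THEN order_trans], rule Pow_mono, rule subset_UNIV)
  have borel: "P A = 0" if "A \<in> sets borel" for A
  proof -
    have "Int_stable (range (\<lambda>(a, b). box a b :: real set))"
      by (auto simp: Int_stable_def box_Int_box)
    moreover have "(range (\<lambda>(a, b). box a b)) \<subseteq> Pow (UNIV :: real set)" by auto
    moreover have "A \<in> sigma_sets UNIV (range (\<lambda>(a, b). box a b))"
      using that unfolding sb .
    ultimately show ?thesis
    proof (induction rule: sigma_sets_induct_disjoint)
      case (basic A)
      then obtain a b where A: "A = {a<..<b}" by auto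
      have "P A = integral {0..1} (\<lambda>x. indicator A x *\<^sub>R w x)"
        unfolding P_def by (intro lebesgue_integral_eq_integral ind) (auto simp: A)
      also have "\<dots> = integral {0..1} (\<lambda>s. if s \<in> {max 0 a..min 1 b} then w s else 0)"
        by (rule integral_spike[of "{a,b}"]) (auto simp: indicator_def A)
      also have "\<dots> = integral {max 0 a..min 1 b} w"
        unfolding integral_restrict_Int by (rule arg_cong[where f="\<lambda>S. integral S w"]) auto
      also have "\<dots> = 0" by (rule z') auto
      finally show ?case .
    next
      case empty then show ?case by (simp add: P_def)
    next
      case (compl A)
      then have [measurable]: "A \<in> sets borel" unfolding sb by blast
      have "P (UNIV - A) = (LINT x|leb01. w x - indicator A x *\<^sub>R w x)"
        unfolding P_def by (intro Bochner_Integration.integral_cong) (auto simp: indicator_def)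
      also have "\<dots> = (LINT x|leb01. w x) - P A"
        unfolding P_def by (intro Bochner_Integration.integral_diff w ind) auto
      finally show ?case using compl total by simp
    next
      case (union F)
      then have F[measurable]: "F i \<in> sets borel" for i
        unfolding sb by blast
      have "(\<lambda>n. LINT x|leb01. indicator (\<Union>i<n. F i) x *\<^sub>R w x) \<longlonglongrightarrow> P (\<Union>i. F i)"
        unfolding P_def
      proof (rule integral_dominated_convergence[where w="\<lambda>x. norm (w x)"])
        have "(\<lambda>n. indicator (\<Union>i<n. F i) x :: real) \<longlonglongrightarrow> indicator (\<Union>i. F i) x" for x
          by (rule LIMSEQ_indicator_UN)
        then show "AE x in leb01. (\<lambda>n. indicator (\<Union>i<n. F i) x *\<^sub>R w x) \<longlonglongrightarrow> indicator (\<Union>i. F i) x *\<^sub>R w x"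
          by (intro AE_I2 tendsto_intros)
        show "(\<lambda>x. indicator (\<Union>i. F i) x *\<^sub>R w x) \<in> borel_measurable leb01"
          "(\<lambda>x. indicator (\<Union>i<n. F i) x *\<^sub>R w x) \<in> borel_measurable leb01" for n
          by (auto intro!: borel_measurable_integrable ind)
      qed (use w in \<open>auto simp: indicator_def\<close>)
      moreover have "(LINT x|leb01. indicator (\<Union>i<n. F i) x *\<^sub>R w x) = 0" for n
      proof (induction n)
        case (Suc n)
        have "(LINT x|leb01. indicator (\<Union>i<Suc n. F i) x *\<^sub>R w x)
          = (LINT x|leb01. indicator (\<Union>i<n. F i) x *\<^sub>R w x + indicator (F n) x *\<^sub>R w x)"
        proof (intro Bochner_Integration.integral_cong refl)
          fix x
          have "indicator (\<Union>i<Suc n. F i) x = (indicator (\<Union>i<n. F i) x + indicator (F n) x :: real)"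
          proof (cases "x \<in> F n")
            case True
            have "x \<notin> F i" if "i < n" for i
              using disjoint_family_onD[OF union(1), of i n] that True by auto
            then show ?thesis using True by (auto simp: indicator_def less_Suc_eq)
          qed (auto simp: indicator_def less_Suc_eq)
          then show "indicator (\<Union>i<Suc n. F i) x *\<^sub>R w x = indicator (\<Union>i<n. F i) x *\<^sub>R w x + indicator (F n) x *\<^sub>R w x"
            by (simp add: scaleR_left_distrib)
        qed
        also have "\<dots> = 0"
          using Suc union(3)[of n] by (subst Bochner_Integration.integral_add) (auto simp: P_def intro!: ind)
        finally show ?case .
      qed simp
      ultimately show ?case by (simp add: LIMSEQ_const_iff)
    qed
  qed
  interpret finite_measure leb01
    by (rule finite_measureI) (simp add: space_restrict_space emeasure_restrict_space)
  show ?thesis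
  proof (rule density_zero[OF w])
    fix A assume "A \<in> sets leb01"
    then obtain B where B: "B \<in> sets lebesgue" "A = B \<inter> {0..1}"
      by (auto simp: sets_restrict_space)
    obtain S N N' where N: "B = S \<union> N" "N \<subseteq> N'" "N' \<in> null_sets lborel" "S \<in> sets lborel"
      using sets_completionE[OF B(1)] by metis
    have "N' \<in> null_sets lebesgue" using N by (simp add: null_sets_completionI)
    then have "AE x in lebesgue. x \<notin> N'" by (rule AE_not_in)
    then have ae: "AE x in leb01. x \<notin> N'" by (subst AE_restrict_space_iff) auto
    have "set_lebesgue_integral leb01 A w = P S"
      unfolding P_def set_lebesgue_integral_def
    proof (rule integral_cong_AE)
      show "(\<lambda>x. indicator A x *\<^sub>R w x) \<in> borel_measurable leb01"
        using B by (intro borel_measurable_integrable ind) auto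
      show "(\<lambda>x. indicator S x *\<^sub>R w x) \<in> borel_measurable leb01"
        using N by (intro borel_measurable_integrable ind) auto
      show "AE x in leb01. indicator A x *\<^sub>R w x = indicator S x *\<^sub>R w x"
        using ae AE_space by eventually_elim (use B N in \<open>auto simp: indicator_def space_restrict_space\<close>)
    qed
    then show "set_lebesgue_integral leb01 A w = 0" using borel[of S] N by simp
  qed
qed

text \<open>For a fixed bump \<open>\<eta>\<close> of mass 1, every continuous \<open>\<psi>\<close>
  supported inside the open interval becomes the derivative of a test function after subtracting a
  multiple of \<open>\<eta>\<close>. The constant is therefore the \<open>\<eta>\<close>-average of
  \<open>w\<close>.\<close>

lemma du_Bois_Reymond:
  fixes w :: "real \<Rightarrow> 'a::euclidean_space"
  assumes w: "integrable (lebesgue_on {0..1}) w"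
    and orth: "\<And>\<phi> \<phi>'. test_function \<phi> \<phi>' \<Longrightarrow> integral {0..1} (\<lambda>y. \<phi>' y *\<^sub>R w y) = 0"
  obtains c where "AE y in lebesgue_on {0..1}. w y = c"
proof -
  \<comment> \<open>A parabolic cap: 48/16 = 3 makes it vanish at 1/4 and 3/4, and the height 3
    makes its integral 1. Continuity is enough, because \<open>\<eta>\<close> serves as the
    derivative of a C^1 function.\<close>
  define \<eta> where "\<eta> = (\<lambda>s::real. max 0 (3 - 48 * (s - 1/2)\<^sup>2))"
  have \<eta>c: "continuous_on S \<eta>" for S unfolding \<eta>_def by (intro continuous_intros)
  have \<eta>0: "\<eta> x = 0" if "x \<notin> {1/4..3/4}" for x
  proof -
    have "1/4 \<le> \<bar>x - 1/2\<bar>" using that by (auto simp: abs_if)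
    then have "(1/4)\<^sup>2 \<le> \<bar>x - 1/2\<bar>\<^sup>2" by (intro power_mono) auto
    then show ?thesis by (simp add: \<eta>_def power2_eq_square)
  qed
  have \<eta>pos: "\<eta> x = 3 - 48 * (x - 1/2)\<^sup>2" if "x \<in> {1/4..3/4}" for x
  proof -
    have "\<bar>x - 1/2\<bar> \<le> 1/4" using that by (auto simp: abs_if)
    then have "\<bar>x - 1/2\<bar>\<^sup>2 \<le> (1/4)\<^sup>2" by (intro power_mono) auto
    then show ?thesis by (simp add: \<eta>_def power2_eq_square)
  qed
  have \<eta>int: "(\<eta> has_integral 1) {0..1}"
  proof -
    define F where "F = (\<lambda>s::real. 3 * s - 16 * (s - 1/2)^3)"
    have "((\<lambda>x. 3 - 48 * (x - 1/2)\<^sup>2) has_integral F (3/4) - F (1/4)) {1/4..3/4::real}"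
    proof (rule fundamental_theorem_of_calculus)
      show "(F has_vector_derivative 3 - 48 * (x - 1/2)\<^sup>2) (at x within {1/4..3/4})" for x
        unfolding F_def has_real_derivative_iff_has_vector_derivative[symmetric]
        by (auto intro!: derivative_eq_intros)
    qed simp
    then have "(\<eta> has_integral F (3/4) - F (1/4)) {1/4..3/4}"
      using \<eta>pos by (subst has_integral_cong) auto
    moreover have "F (3/4) - F (1/4) = 1" by (simp add: F_def power3_eq_cube)
    ultimately have "(\<eta> has_integral 1) {1/4..3/4}" by simp
    then show ?thesis
      by (rule has_integral_on_superset) (auto intro: \<eta>0)
  qed
  define c where "c = integral {0..1} (\<lambda>y. \<eta> y *\<^sub>R w y)"
  have test: "integral {0..1} (\<lambda>y. \<psi> y *\<^sub>R w y) = integral {0..1} \<psi> *\<^sub>R c"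
    if A: "continuous_on UNIV \<psi>" "0 < p" "p \<le> q" "q < 1" "\<And>x. x \<notin> {p..q} \<Longrightarrow> \<psi> x = 0" for \<psi> p q
  proof -
    define I where "I = integral {0..1} \<psi>"
    have i0: "integral {0..1} (\<lambda>y. \<psi> y - I * \<eta> y) = 0"
      using \<eta>int A(1)
      by (subst Henstock_Kurzweil_Integration.integral_diff)
        (auto simp: I_def integral_unique intro!: integrable_continuous_real continuous_intros \<eta>c continuous_on_subset[OF A(1)])
    obtain \<phi> where t: "test_function \<phi> (\<lambda>y. \<psi> y - I * \<eta> y)"
    proof (rule test_function_antiderivative[where \<psi>="\<lambda>y. \<psi> y - I * \<eta> y" and p="min p (1/4)" and q="max q (3/4)"])
      show "\<psi> x - I * \<eta> x = 0" if x: "x \<notin> {min p (1 / 4)..max q (3 / 4)}" for x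
      proof -
        have "\<psi> x = 0" using x by (intro A(5)) auto
        moreover have "\<eta> x = 0" using x by (intro \<eta>0) auto
        ultimately show ?thesis by simp
      qed
    qed (use A i0 in \<open>auto intro!: continuous_intros \<eta>c\<close>)
    have "integral {0..1} (\<lambda>y. (\<psi> y - I * \<eta> y) *\<^sub>R w y) = 0" by (rule orth[OF t])
    moreover have "integral {0..1} (\<lambda>y. (\<psi> y - I * \<eta> y) *\<^sub>R w y)
       = integral {0..1} (\<lambda>y. \<psi> y *\<^sub>R w y) - integral {0..1} (\<lambda>y. I *\<^sub>R (\<eta> y *\<^sub>R w y))"
      unfolding scaleR_diff_left scaleR_scaleR[symmetric]
      by (intro Henstock_Kurzweil_Integration.integral_diff integrable_cmul integrable_on_lebesgue_on
            integrable_leb_continuous_scaleR w \<eta>c continuous_on_subset[OF A(1)]) auto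
    moreover have "integral {0..1} (\<lambda>y. I *\<^sub>R (\<eta> y *\<^sub>R w y)) = I *\<^sub>R c"
      by (simp only: integral_cmul c_def)
    ultimately show ?thesis by (simp only: I_def) simp
  qed
  have "integral {x..y} (\<lambda>s. w s - c) = 0" if xy: "0 < x" "x < y" "y < 1" for x y
  proof -
    \<comment> \<open>Trapezoids with flanks of slope n inside \<open>{x..y}\<close>; they converge
      pointwise to the indicator of the open interval and stay between 0 and 1.\<close>
    define \<psi> where "\<psi> = (\<lambda>n s. max 0 (min 1 (real n * min (s - x) (y - s))))"
    have \<psi>c: "continuous_on S (\<psi> n)" for n S unfolding \<psi>_def by (intro continuous_intros)
    have eq: "integral {0..1} (\<lambda>s. \<psi> n s *\<^sub>R (w s - c)) = 0" for n
    proof -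
      have "integral {0..1} (\<lambda>s. \<psi> n s *\<^sub>R w s) = integral {0..1} (\<psi> n) *\<^sub>R c"
      proof (rule test[OF \<psi>c xy(1) _ xy(3)])
        fix s assume "s \<notin> {x..y}"
        then have "real n * min (s - x) (y - s) \<le> 0"
          by (intro mult_nonneg_nonpos) (auto simp: min_def)
        then show "\<psi> n s = 0" by (auto simp: \<psi>_def)
      qed (use xy in auto)
      moreover have "integral {0..1} (\<lambda>s. \<psi> n s *\<^sub>R (w s - c))
          = integral {0..1} (\<lambda>s. \<psi> n s *\<^sub>R w s) - integral {0..1} (\<lambda>s. \<psi> n s *\<^sub>R c)"
        unfolding scaleR_diff_right
        by (intro Henstock_Kurzweil_Integration.integral_diff integrable_on_lebesgue_on
              integrable_leb_continuous_scaleR w \<psi>c) (auto intro!: integrable_leb_continuous)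
      moreover have "integral {0..1} (\<lambda>s. \<psi> n s *\<^sub>R c) = integral {0..1} (\<psi> n) *\<^sub>R c"
        by (intro integral_unique has_integral_scaleR_left integrable_integral integrable_continuous_real \<psi>c)
      ultimately show ?thesis by simp
    qed
    have wci: "integrable (lebesgue_on {0..1}) (\<lambda>s. w s - c)"
      by (intro Bochner_Integration.integrable_diff w integrable_leb_continuous continuous_intros)
    have "(\<lambda>n. integral {0..1} (\<lambda>s. \<psi> n s *\<^sub>R (w s - c))) \<longlonglongrightarrow> integral {0..1} (\<lambda>s. indicator {x<..<y} s *\<^sub>R (w s - c))"
    proof (rule dominated_convergence(2)[where h="\<lambda>s. norm (w s - c)"])
      show "(\<lambda>s. \<psi> n s *\<^sub>R (w s - c)) integrable_on {0..1}" for n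
        by (intro integrable_on_lebesgue_on integrable_leb_continuous_scaleR \<psi>c wci) auto
      show "(\<lambda>s. norm (w s - c)) integrable_on {0..1}"
        by (intro integrable_on_lebesgue_on integrable_norm wci) auto
      show "norm (\<psi> n s *\<^sub>R (w s - c)) \<le> norm (w s - c)" for n s
        using mult_right_mono[of "\<bar>\<psi> n s\<bar>" 1 "norm (w s - c)"] by (simp add: \<psi>_def)
      show "(\<lambda>n. \<psi> n s *\<^sub>R (w s - c)) \<longlonglongrightarrow> indicator {x<..<y} s *\<^sub>R (w s - c)" for s
      proof (rule tendsto_scaleR[OF _ tendsto_const])
        show "(\<lambda>n. \<psi> n s) \<longlonglongrightarrow> indicator {x<..<y} s"
        proof (cases "s \<in> {x<..<y}")
          case True
          then have d: "min (s - x) (y - s) > 0" by auto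
          have "\<forall>\<^sub>F n in sequentially. real n \<ge> 1 / min (s - x) (y - s)"
            by (rule eventually_sequentiallyI[of "nat \<lceil>1 / min (s - x) (y - s)\<rceil>"]) linarith
          then have "\<forall>\<^sub>F n in sequentially. \<psi> n s = 1"
          proof eventually_elim
            case (elim n)
            then have "1 \<le> real n * min (s - x) (y - s)" using d by (simp add: pos_divide_le_eq)
            then show ?case by (simp add: \<psi>_def)
          qed
          then show ?thesis using True by (simp add: tendsto_eventually)
        next
          case False
          have "\<psi> n s = 0" for n
          proof -
            have "real n * min (s - x) (y - s) \<le> 0"
              using False by (intro mult_nonneg_nonpos) (auto simp: min_def)
            then show ?thesis unfolding \<psi>_def by linarith
          qed
          then show ?thesis using False by simp
        qed
      qed
    qed
    then have "integral {0..1} (\<lambda>s. indicator {x<..<y} s *\<^sub>R (w s - c)) = 0"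
      by (simp add: eq LIMSEQ_const_iff)
    moreover have "integral {0..1} (\<lambda>s. indicator {x<..<y} s *\<^sub>R (w s - c)) = integral {x..y} (\<lambda>s. w s - c)"
    proof -
      have "integral {0..1} (\<lambda>s. indicator {x<..<y} s *\<^sub>R (w s - c)) = integral {0..1} (\<lambda>s. if s \<in> {x..y} then w s - c else 0)"
        by (rule integral_spike[of "{x,y}"]) (auto simp: indicator_def)
      also have "\<dots> = integral {x..y} (\<lambda>s. w s - c)"
        unfolding integral_restrict_Int by (rule arg_cong[where f="\<lambda>S. integral S (\<lambda>s. w s - c)"]) (use xy in auto)
      finally show ?thesis .
    qed
    ultimately show ?thesis by simp
  qed
  then have "AE y in lebesgue_on {0..1}. w y - c = 0"
    by (intro AE_zero_if_interval_integrals_zero Bochner_Integration.integrable_diff w integrable_leb_continuous continuous_intros) auto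
  then show ?thesis by (intro that[of c]) auto
qed

text \<open>By the integration by parts above, the primitive of \<open>v\<close> has weak derivative
  \<open>v\<close> as well, so \<open>u\<close> minus this primitive is orthogonal to all
  derivatives of test functions.\<close>

lemma weak_deriv_imp_indefinite_integral:
  fixes u v :: "real \<Rightarrow> 'a::euclidean_space"
  assumes "weak_deriv u v"
  obtains c where "AE y in lebesgue_on {0..1}. u y = c + integral {0..y} v"
proof -
  have u: "integrable leb01 u" and v: "integrable leb01 v"
    and wd: "\<And>\<phi> \<phi>'. test_function \<phi> \<phi>' \<Longrightarrow> (LINT y|leb01. \<phi>' y *\<^sub>R u y) = - (LINT y|leb01. \<phi> y *\<^sub>R v y)"
    using assms by (auto simp: weak_deriv_def)
  have Vc: "continuous_on {0..1} (\<lambda>y. integral {0..y} v)"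
    by (intro indefinite_integral_continuous_1 integrable_on_lebesgue_on v) auto
  obtain c where "AE y in leb01. u y - integral {0..y} v = c"
  proof (rule du_Bois_Reymond[where w="\<lambda>y. u y - integral {0..y} v"])
    show "integrable leb01 (\<lambda>y. u y - integral {0..y} v)"
      by (intro Bochner_Integration.integrable_diff u integrable_leb_continuous Vc)
    fix \<phi> \<phi>' :: "real \<Rightarrow> real" assume t: "test_function \<phi> \<phi>'"
    then have d: "\<And>x. (\<phi> has_real_derivative \<phi>' x) (at x)" and dc: "continuous_on UNIV \<phi>'"
      and \<phi>1: "\<phi> 1 = 0"
      by (auto simp: test_function_def subset_eq)
    have \<phi>c: "continuous_on {0..1} \<phi>" and \<phi>'c: "continuous_on {0..1} \<phi>'"
      using d dc by (auto intro: DERIV_isCont continuous_at_imp_continuous_on continuous_on_subset)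
    have "integral {0..1} (\<lambda>y. \<phi>' y *\<^sub>R (u y - integral {0..y} v))
      = integral {0..1} (\<lambda>y. \<phi>' y *\<^sub>R u y) - integral {0..1} (\<lambda>y. \<phi>' y *\<^sub>R integral {0..y} v)"
      unfolding scaleR_diff_right
      by (intro Henstock_Kurzweil_Integration.integral_diff integrable_on_lebesgue_on
          integrable_leb_continuous_scaleR u \<phi>'c integrable_leb_continuous Vc) auto
    also have "integral {0..1} (\<lambda>y. \<phi>' y *\<^sub>R integral {0..y} v) = - integral {0..1} (\<lambda>y. \<phi> y *\<^sub>R v y)"
      using integral_indefinite_integral_by_parts[of 0 1 \<phi> \<phi>' v] d \<phi>'c v \<phi>1
      by (auto intro: has_field_derivative_at_within)
    also have "integral {0..1} (\<lambda>y. \<phi> y *\<^sub>R v y) = (LINT y|leb01. \<phi> y *\<^sub>R v y)"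
      by (intro lebesgue_integral_eq_integral[symmetric] integrable_leb_continuous_scaleR \<phi>c v) auto
    also have "integral {0..1} (\<lambda>y. \<phi>' y *\<^sub>R u y) = (LINT y|leb01. \<phi>' y *\<^sub>R u y)"
      by (intro lebesgue_integral_eq_integral[symmetric] integrable_leb_continuous_scaleR \<phi>'c u) auto
    finally show "integral {0..1} (\<lambda>y. \<phi>' y *\<^sub>R (u y - integral {0..y} v)) = 0"
      using wd[OF t] by simp
  qed
  then show ?thesis by (intro that[of c]) (auto simp: algebra_simps)
qed

section \<open>Hoelder regularity from Gagliardo seminorms\<close>

lemma nn_integral_leb_subset:
  fixes a b p q :: real
  assumes "{p..q} \<subseteq> {a..b}"
  shows "(\<integral>\<^sup>+y. F y \<partial>lebesgue_on {p..q}) \<le> (\<integral>\<^sup>+y. F y \<partial>lebesgue_on {a..b})"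
proof -
  have "(\<integral>\<^sup>+y. F y * indicator {p..q} y \<partial>lebesgue) \<le> (\<integral>\<^sup>+y. F y * indicator {a..b} y \<partial>lebesgue)"
    using assms by (intro nn_integral_mono) (auto simp: indicator_def)
  moreover have "(\<integral>\<^sup>+y. F y \<partial>lebesgue_on {r..t}) = (\<integral>\<^sup>+y. F y * indicator {r..t} y \<partial>lebesgue)" for r t :: real
    by (rule nn_integral_restrict_space) simp
  ultimately show ?thesis by simp
qed

lemma nn_integral_L1_le_L2:
  fixes u :: "real \<Rightarrow> 'a::euclidean_space"
  assumes u: "u \<in> borel_measurable (lebesgue_on {p..q})"
  shows "(\<integral>\<^sup>+y. ennreal (norm (u y)) \<partial>lebesgue_on {p..q})\<^sup>2
     \<le> ennreal (q - p) * (\<integral>\<^sup>+y. ennreal ((norm (u y))\<^sup>2) \<partial>lebesgue_on {p..q})"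
proof -
  have "(\<integral>\<^sup>+y. ennreal (norm (u y)) * 1 \<partial>lebesgue_on {p..q})\<^sup>2
     \<le> (\<integral>\<^sup>+y. (ennreal (norm (u y)))\<^sup>2 \<partial>lebesgue_on {p..q}) * (\<integral>\<^sup>+y. 1\<^sup>2 \<partial>lebesgue_on {p..q})"
    using u by (intro Cauchy_Schwarz_nn_integral) auto
  moreover have "emeasure (lebesgue_on {p..q}) (space (lebesgue_on {p..q})) = ennreal (q - p)"
    by (cases "p \<le> q") (auto simp: emeasure_restrict_space ennreal_neg)
  ultimately show ?thesis
    by (simp add: ennreal_power mult.commute)
qed

lemma L2_imp_integrable:
  fixes u :: "real \<Rightarrow> 'a::euclidean_space"
  assumes u: "u \<in> borel_measurable (lebesgue_on {p..q})"
    and fin: "(\<integral>\<^sup>+y. ennreal ((norm (u y))\<^sup>2) \<partial>lebesgue_on {p..q}) < \<infinity>"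
  shows "integrable (lebesgue_on {p..q}) u"
proof (rule integrableI_bounded[OF u])
  have "(\<integral>\<^sup>+y. ennreal (norm (u y)) \<partial>lebesgue_on {p..q})\<^sup>2 < \<infinity>"
    by (rule order.strict_trans1[OF nn_integral_L1_le_L2[OF u]])
      (use fin in \<open>simp add: ennreal_mult_less_top\<close>)
  then show "(\<integral>\<^sup>+y. ennreal (norm (u y)) \<partial>lebesgue_on {p..q}) < \<infinity>"
    by (simp add: power_less_top_ennreal)
qed

lemma integral_norm_le_L2:
  fixes u :: "real \<Rightarrow> 'a::euclidean_space"
  assumes u: "u \<in> borel_measurable (lebesgue_on {p..q})" and "p \<le> q" "0 \<le> B"
    and B: "(\<integral>\<^sup>+y. ennreal ((norm (u y))\<^sup>2) \<partial>lebesgue_on {p..q}) \<le> ennreal B"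
  shows "integral {p..q} (\<lambda>y. norm (u y)) \<le> sqrt ((q - p) * B)"
proof -
  have ui: "integrable (lebesgue_on {p..q}) u"
    by (rule L2_imp_integrable[OF u]) (use B in \<open>auto intro: order.strict_trans1\<close>)
  have "ennreal (integral {p..q} (\<lambda>y. norm (u y))) = (\<integral>\<^sup>+y. ennreal (norm (u y)) \<partial>lebesgue_on {p..q})"
    using ui by (subst nn_integral_eq_integral) (auto simp: lebesgue_integral_eq_integral)
  then have "ennreal ((integral {p..q} (\<lambda>y. norm (u y)))\<^sup>2) = (\<integral>\<^sup>+y. ennreal (norm (u y)) \<partial>lebesgue_on {p..q})\<^sup>2"
    using ui by (subst ennreal_power[symmetric]) (auto intro!: Henstock_Kurzweil_Integration.integral_nonneg integrable_on_lebesgue_on)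
  also have "\<dots> \<le> ennreal (q - p) * ennreal B"
    using nn_integral_L1_le_L2[OF u] B by (meson mult_left_mono order_trans zero_le)
  also have "\<dots> = ennreal ((q - p) * B)"
    using assms by (simp add: ennreal_mult)
  finally have "(integral {p..q} (\<lambda>y. norm (u y)))\<^sup>2 \<le> (q - p) * B"
    using assms by (simp add: ennreal_le_iff)
  then show ?thesis by (rule real_le_rsqrt)
qed

text \<open>Cauchy-Schwarz for \<open>c - h y\<close>, whose integral is the length times the
  distance of \<open>c\<close> from the mean. It serves both for \<open>c\<close> a value of
  \<open>h\<close> and for \<open>c\<close> the mean over a smaller interval.\<close>

lemma mean_value_sq_le:
  fixes h :: "real \<Rightarrow> 'a::euclidean_space"
  assumes h: "integrable (lebesgue_on {p..q}) h" and "p < q"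
  shows "ennreal ((norm (c - integral {p..q} h /\<^sub>R (q - p)))\<^sup>2 * (q - p))
     \<le> (\<integral>\<^sup>+y. ennreal ((norm (c - h y))\<^sup>2) \<partial>lebesgue_on {p..q})"
proof -
  define D where "D = norm (c - integral {p..q} h /\<^sub>R (q - p))"
  define I where "I = (\<integral>\<^sup>+y. ennreal ((norm (c - h y))\<^sup>2) \<partial>lebesgue_on {p..q})"
  have ci: "integrable (lebesgue_on {p..q}) (\<lambda>y. c - h y)"
    by (intro Bochner_Integration.integrable_diff h integrable_leb_continuous continuous_intros)
  have "(LINT y|lebesgue_on {p..q}. c - h y) = integral {p..q} (\<lambda>y. c - h y)"
    by (intro lebesgue_integral_eq_integral ci) auto
  also have "\<dots> = (q - p) *\<^sub>R c - integral {p..q} h"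
    using h \<open>p < q\<close> by (subst Henstock_Kurzweil_Integration.integral_diff) (auto intro: integrable_on_lebesgue_on)
  also have "\<dots> = (q - p) *\<^sub>R (c - integral {p..q} h /\<^sub>R (q - p))"
    using \<open>p < q\<close> by (simp add: scaleR_diff_right)
  finally have "norm (LINT y|lebesgue_on {p..q}. c - h y) = (q - p) * D"
    using \<open>p < q\<close> by (simp add: D_def)
  then have "ennreal ((q - p) * D) \<le> (\<integral>\<^sup>+y. ennreal (norm (c - h y)) \<partial>lebesgue_on {p..q})"
    using integral_norm_bound_ennreal[OF ci] by simp
  then have "(ennreal ((q - p) * D))\<^sup>2 \<le> (\<integral>\<^sup>+y. ennreal (norm (c - h y)) \<partial>lebesgue_on {p..q})\<^sup>2"
    by (intro power_mono) auto
  also have "\<dots> \<le> ennreal (q - p) * I"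
    unfolding I_def by (rule nn_integral_L1_le_L2) (use ci in auto)
  finally have "ennreal (q - p) * ennreal (D\<^sup>2 * (q - p)) \<le> ennreal (q - p) * I"
    using \<open>p < q\<close> by (simp add: ennreal_power D_def flip: ennreal_mult) (simp add: power2_eq_square mult_ac)
  then show ?thesis
    unfolding I_def D_def using \<open>p < q\<close> by (subst (asm) ennreal_mult_le_mult_iff) auto
qed

section \<open>Campanato estimates from the Gagliardo seminorm\<close>

definition gagliardo_inner :: "real \<Rightarrow> (real \<Rightarrow> complex) \<Rightarrow> real \<Rightarrow> ennreal" where
  "gagliardo_inner \<sigma> h x = (\<integral>\<^sup>+ y. ennreal ((norm (h x - h y))\<^sup>2 / \<bar>x - y\<bar> powr (1 + 2 * \<sigma>)) \<partial>leb01)"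

lemma gagliardo_inner_measurable:
  assumes "h \<in> borel_measurable leb01"
  shows "gagliardo_inner \<sigma> h \<in> borel_measurable leb01"
proof -
  interpret finite_measure leb01
    by (rule finite_measureI) (simp add: space_restrict_space emeasure_restrict_space)
  note [measurable] = assms
  have [measurable]: "(\<lambda>x::real. x) \<in> borel_measurable leb01"
    by (intro continuous_imp_measurable_on_sets_lebesgue continuous_intros) auto
  show ?thesis
    unfolding gagliardo_inner_def[abs_def] by measurable
qed

text \<open>Two points of \<open>{p..q}\<close> are at distance at most \<open>q - p\<close>, so the
  singular weight can be inserted under the integral at the price of the factor
  \<open>(q - p) powr (1 + 2 * \<sigma>)\<close>.\<close>

lemma mean_dist_gagliardo_inner:
  assumes h: "integrable leb01 h" and \<sigma>: "\<sigma> > 0"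
    and x: "x \<in> {p..q}" and sub: "{p'..q'} \<subseteq> {p..q}" "{p..q} \<subseteq> {0..1}" "p' < q'"
  shows "ennreal ((norm (h x - integral {p'..q'} h /\<^sub>R (q' - p')))\<^sup>2 * (q' - p'))
     \<le> ennreal ((q - p) powr (1 + 2 * \<sigma>)) * gagliardo_inner \<sigma> h x"
proof -
  have h': "integrable (lebesgue_on {p'..q'}) h"
    by (rule integrable_subinterval[OF h]) (use sub in auto)
  have [measurable]: "h \<in> borel_measurable leb01" using h by auto
  have [measurable]: "(\<lambda>x::real. x) \<in> borel_measurable leb01"
    by (intro continuous_imp_measurable_on_sets_lebesgue continuous_intros) auto
  have "ennreal ((norm (h x - integral {p'..q'} h /\<^sub>R (q' - p')))\<^sup>2 * (q' - p'))
     \<le> (\<integral>\<^sup>+y. ennreal ((norm (h x - h y))\<^sup>2) \<partial>lebesgue_on {p'..q'})"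
    by (rule mean_value_sq_le[OF h' sub(3)])
  also have "\<dots> \<le> (\<integral>\<^sup>+y. ennreal ((q - p) powr (1 + 2 * \<sigma>)) * ennreal ((norm (h x - h y))\<^sup>2 / \<bar>x - y\<bar> powr (1 + 2 * \<sigma>)) \<partial>lebesgue_on {p'..q'})"
  proof (rule nn_integral_mono)
    fix y assume "y \<in> space (lebesgue_on {p'..q'})"
    then have y: "y \<in> {p..q}" using sub by (auto simp: space_restrict_space)
    show "ennreal ((norm (h x - h y))\<^sup>2) \<le> ennreal ((q - p) powr (1 + 2 * \<sigma>)) * ennreal ((norm (h x - h y))\<^sup>2 / \<bar>x - y\<bar> powr (1 + 2 * \<sigma>))"
    proof (cases "x = y")
      case False
      have "\<bar>x - y\<bar> powr (1 + 2 * \<sigma>) \<le> (q - p) powr (1 + 2 * \<sigma>)"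
        using x y \<sigma> by (intro powr_mono2) auto
      then have "(norm (h x - h y))\<^sup>2 * \<bar>x - y\<bar> powr (1 + 2 * \<sigma>) \<le> (norm (h x - h y))\<^sup>2 * (q - p) powr (1 + 2 * \<sigma>)"
        by (intro mult_left_mono) auto
      then have "(norm (h x - h y))\<^sup>2 \<le> (q - p) powr (1 + 2 * \<sigma>) * ((norm (h x - h y))\<^sup>2 / \<bar>x - y\<bar> powr (1 + 2 * \<sigma>))"
        using False by (simp add: field_simps)
      then show ?thesis by (subst ennreal_mult[symmetric]) (auto intro: ennreal_leI)
    qed simp
  qed
  also have "\<dots> \<le> (\<integral>\<^sup>+y. ennreal ((q - p) powr (1 + 2 * \<sigma>)) * ennreal ((norm (h x - h y))\<^sup>2 / \<bar>x - y\<bar> powr (1 + 2 * \<sigma>)) \<partial>leb01)"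
    by (rule nn_integral_leb_subset) (use sub in auto)
  also have "\<dots> = ennreal ((q - p) powr (1 + 2 * \<sigma>)) * gagliardo_inner \<sigma> h x"
    unfolding gagliardo_inner_def by (rule nn_integral_cmult) measurable
  finally show ?thesis .
qed

text \<open>The pointwise estimate is integrated over the larger interval: first the mean over
  \<open>{p..q}\<close> is compared with the fixed mean \<open>A\<close>, then each
  \<open>h y\<close> with \<open>A\<close>.\<close>

lemma mean_dist_gagliardo:
  assumes h: "integrable leb01 h" and \<sigma>: "\<sigma> > 0" and G: "gagliardo_sq \<sigma> h \<le> ennreal G" "G \<ge> 0"
    and sub: "{p'..q'} \<subseteq> {p..q}" "{p..q} \<subseteq> {0..1}" "p' < q'" "p < q"
  shows "(norm (integral {p'..q'} h /\<^sub>R (q' - p') - integral {p..q} h /\<^sub>R (q - p)))\<^sup>2 * (q - p) * (q' - p')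
     \<le> (q - p) powr (1 + 2 * \<sigma>) * G"
proof -
  define A where "A = integral {p'..q'} h /\<^sub>R (q' - p')"
  define D where "D = norm (A - integral {p..q} h /\<^sub>R (q - p))"
  have h': "integrable (lebesgue_on {p..q}) h"
    by (rule integrable_subinterval[OF h]) (use sub in auto)
  have hm: "h \<in> borel_measurable (lebesgue_on {p..q})" using h' by auto
  have "ennreal (D\<^sup>2 * (q - p)) * ennreal (q' - p')
     \<le> (\<integral>\<^sup>+y. ennreal ((norm (A - h y))\<^sup>2) \<partial>lebesgue_on {p..q}) * ennreal (q' - p')"
    unfolding D_def by (intro mult_right_mono mean_value_sq_le[OF h' sub(4)]) auto
  also have "\<dots> = (\<integral>\<^sup>+y. ennreal ((norm (A - h y))\<^sup>2) * ennreal (q' - p') \<partial>lebesgue_on {p..q})"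
    using hm by (intro nn_integral_multc[symmetric]) auto
  also have "\<dots> \<le> (\<integral>\<^sup>+y. ennreal ((q - p) powr (1 + 2 * \<sigma>)) * gagliardo_inner \<sigma> h y \<partial>lebesgue_on {p..q})"
  proof (rule nn_integral_mono)
    fix y assume "y \<in> space (lebesgue_on {p..q})"
    then have y: "y \<in> {p..q}" by (auto simp: space_restrict_space)
    have "ennreal ((norm (A - h y))\<^sup>2) * ennreal (q' - p') = ennreal ((norm (h y - A))\<^sup>2 * (q' - p'))"
      using sub by (simp add: ennreal_mult norm_minus_commute)
    then show "ennreal ((norm (A - h y))\<^sup>2) * ennreal (q' - p') \<le> ennreal ((q - p) powr (1 + 2 * \<sigma>)) * gagliardo_inner \<sigma> h y"
      using mean_dist_gagliardo_inner[OF h \<sigma> y sub(1-3)] by (simp add: A_def)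
  qed
  also have "\<dots> \<le> (\<integral>\<^sup>+y. ennreal ((q - p) powr (1 + 2 * \<sigma>)) * gagliardo_inner \<sigma> h y \<partial>leb01)"
    by (rule nn_integral_leb_subset) (use sub in auto)
  also have "\<dots> = ennreal ((q - p) powr (1 + 2 * \<sigma>)) * (\<integral>\<^sup>+y. gagliardo_inner \<sigma> h y \<partial>leb01)"
    using h by (intro nn_integral_cmult gagliardo_inner_measurable) auto
  also have "(\<integral>\<^sup>+y. gagliardo_inner \<sigma> h y \<partial>leb01) = gagliardo_sq \<sigma> h"
    by (simp add: gagliardo_sq_def gagliardo_inner_def)
  also have "ennreal ((q - p) powr (1 + 2 * \<sigma>)) * gagliardo_sq \<sigma> h \<le> ennreal ((q - p) powr (1 + 2 * \<sigma>)) * ennreal G"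
    by (intro mult_left_mono G) auto
  finally have "ennreal (D\<^sup>2 * (q - p) * (q' - p')) \<le> ennreal ((q - p) powr (1 + 2 * \<sigma>) * G)"
    using sub G by (simp add: ennreal_mult)
  then show ?thesis
    using G by (subst (asm) ennreal_le_iff) (auto simp: D_def A_def)
qed

text \<open>Campanato's argument along intervals shrinking to \<open>x\<close>.  Finiteness of the inner integral at \<open>x\<close>
  makes the means converge to \<open>h x\<close>, so Lebesgue's differentiation theorem is not needed.\<close>

lemma nested_means_dist:
  assumes h: "integrable leb01 h" and \<sigma>: "\<sigma> > 1/2" and G: "gagliardo_sq \<sigma> h \<le> ennreal G" "G \<ge> 0"
    and r: "0 < r" and len: "\<And>n. q n - p n = r / 2 ^ n"
    and nest: "\<And>n. p n \<le> p (Suc n)" "\<And>n. q (Suc n) \<le> q n" and J: "0 \<le> p 0" "q 0 \<le> 1"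
    and x: "\<And>n. x \<in> {p n..q n}" and fin: "gagliardo_inner \<sigma> h x < \<infinity>"
  shows "norm (h x - integral {p 0..q 0} h /\<^sub>R r)
     \<le> sqrt (2 * G) / (1 - 2 powr - (\<sigma> - 1/2)) * r powr (\<sigma> - 1/2)"
proof -
  define A where "A = (\<lambda>n. integral {p n..q n} h /\<^sub>R (q n - p n))"
  define \<beta> where "\<beta> = \<sigma> - 1/2"
  define \<theta> where "\<theta> = (2::real) powr - \<beta>"
  have \<beta>: "\<beta> > 0" using \<sigma> by (simp add: \<beta>_def)
  have "(2::real) powr - \<beta> < 2 powr 0" using \<beta> by (intro powr_less_mono) auto
  then have \<theta>: "0 < \<theta>" "\<theta> < 1" by (auto simp: \<theta>_def)
  have inc: "incseq p" and dec: "decseq q" using nest by (auto intro: incseq_SucI decseq_SucI)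
  have lt: "p n < q n" for n using len[of n] r by (smt (verit) divide_pos_pos zero_less_power)
  have in01: "{p n..q n} \<subseteq> {0..1}" for n
    using J incseqD[OF inc, of 0 n] decseqD[OF dec, of 0 n] by auto
  have sub: "{p (Suc n)..q (Suc n)} \<subseteq> {p n..q n}" for n using nest[of n] by auto
  \<comment> \<open>For lengths l and l/2 the comparison of means leaves l to the power 1 + 2
    \<sigma> - 2 = 2 \<beta>, and the factor 2 under the root comes from the half length. The
    differences thus form a geometric sequence with ratio \<open>\<theta> < 1\<close>; this uses
    \<open>\<sigma> > 1/2\<close>.\<close>
  have step: "norm (A (Suc n) - A n) \<le> sqrt (2 * G) * r powr \<beta> * \<theta> ^ n" for n
  proof -
    define l where "l = r / 2 ^ n"
    have l: "l > 0" using r by (simp add: l_def)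
    have "(norm (A (Suc n) - A n))\<^sup>2 * l * (l / 2) \<le> l powr (1 + 2 * \<sigma>) * G"
    proof -
      have ql: "q n - p n = l" "q (Suc n) - p (Suc n) = l / 2" using len[of n] len[of "Suc n"] by (simp_all add: l_def)
      show ?thesis
        using mean_dist_gagliardo[OF h _ G sub[of n] in01 lt lt] \<sigma> unfolding A_def ql by simp
    qed
    also have "l powr (1 + 2 * \<sigma>) = (l powr \<beta>)\<^sup>2 * (l * l)"
      using l by (simp add: \<beta>_def powr_add[symmetric] power2_eq_square powr_mult_base flip: powr_numeral)
        (simp add: powr_mult_base powr_add[symmetric] field_simps)
    finally have "(norm (A (Suc n) - A n))\<^sup>2 * (l * l) \<le> (2 * G * (l powr \<beta>)\<^sup>2) * (l * l)"
      by (simp add: field_simps)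
    then have "(norm (A (Suc n) - A n))\<^sup>2 \<le> 2 * G * (l powr \<beta>)\<^sup>2"
      using l by (simp add: mult_le_cancel_right)
    then have "norm (A (Suc n) - A n) \<le> sqrt (2 * G * (l powr \<beta>)\<^sup>2)"
      by (rule real_le_rsqrt)
    also have "\<dots> = sqrt (2 * G) * (l powr \<beta>)" by (simp add: real_sqrt_mult)
    also have "l powr \<beta> = r powr \<beta> * \<theta> ^ n"
    proof -
      have "((2::real) ^ n) powr \<beta> = (2 powr \<beta>) ^ n"
        by (simp add: powr_realpow[symmetric] powr_powr mult.commute)
      then show ?thesis
        using r unfolding l_def \<theta>_def powr_minus power_inverse by (simp add: powr_divide divide_inverse[symmetric])
    qed
    finally show ?thesis by (simp add: mult_ac)
  qed
  have bound: "norm (A n - A 0) \<le> sqrt (2 * G) * r powr \<beta> / (1 - \<theta>)" for n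
  proof -
    have "A n - A 0 = (\<Sum>i<n. A (Suc i) - A i)" by (simp add: sum_lessThan_telescope)
    also have "norm \<dots> \<le> (\<Sum>i<n. sqrt (2 * G) * r powr \<beta> * \<theta> ^ i)"
      by (rule sum_norm_le) (use step in auto)
    also have "\<dots> = sqrt (2 * G) * r powr \<beta> * (\<Sum>i<n. \<theta> ^ i)" by (simp add: sum_distrib_left)
    also have "\<dots> \<le> sqrt (2 * G) * r powr \<beta> * (1 / (1 - \<theta>))"
    proof (rule mult_left_mono)
      have "(\<Sum>i<n. \<theta> ^ i) = (1 - \<theta> ^ n) / (1 - \<theta>)" using \<theta> by (simp add: sum_gp_strict)
      also have "\<dots> \<le> 1 / (1 - \<theta>)" using \<theta> by (intro divide_right_mono) auto
      finally show "(\<Sum>i<n. \<theta> ^ i) \<le> 1 / (1 - \<theta>)" .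
    qed (use G in auto)
    finally show ?thesis by simp
  qed
  obtain g where g: "gagliardo_inner \<sigma> h x = ennreal g" "g \<ge> 0"
    using fin by (cases "gagliardo_inner \<sigma> h x") auto
  \<comment> \<open>Here the pointwise value g of the inner integral is used: the squared distance
    of \<open>A n\<close> from \<open>h x\<close> is at most g times the length to the power 2
    \<sigma>.\<close>
  have conv: "A \<longlonglongrightarrow> h x"
  proof (rule metric_LIMSEQ_I, goal_cases)
    case (1 e)
    have "(\<lambda>n. (r / 2 ^ n) powr (2 * \<sigma>) * g) \<longlonglongrightarrow> 0 powr (2 * \<sigma>) * g"
    proof (intro tendsto_intros tendsto_powr')
      have "(\<lambda>n. r * (1/2) ^ n) \<longlonglongrightarrow> r * 0"
        by (intro tendsto_intros LIMSEQ_power_zero) auto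
      then show "(\<lambda>n. r / 2 ^ n) \<longlonglongrightarrow> 0" by (simp add: power_divide)
    qed (use \<sigma> r in auto)
    then have "\<forall>\<^sub>F n in sequentially. (r / 2 ^ n) powr (2 * \<sigma>) * g < e\<^sup>2"
      using 1 by (intro order_tendstoD) auto
    then obtain N where N: "\<And>n. n \<ge> N \<Longrightarrow> (r / 2 ^ n) powr (2 * \<sigma>) * g < e\<^sup>2"
      by (auto simp: eventually_sequentially)
    have "dist (A n) (h x) < e" if "n \<ge> N" for n
    proof -
      define l where "l = r / 2 ^ n"
      have l: "l > 0" using r by (simp add: l_def)
      have "ennreal ((norm (h x - A n))\<^sup>2 * l) \<le> ennreal (l powr (1 + 2 * \<sigma>)) * ennreal g"
      proof -
        have ql: "q n - p n = l" using len[of n] by (simp add: l_def)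
        show ?thesis
          using mean_dist_gagliardo_inner[OF h _ x[of n] order_refl in01[of n] lt[of n], where \<sigma>=\<sigma>] \<sigma>
          unfolding A_def ql g(1) by simp
      qed
      then have "(norm (h x - A n))\<^sup>2 * l \<le> l powr (1 + 2 * \<sigma>) * g"
        using g by (simp add: ennreal_mult[symmetric])
      also have "l powr (1 + 2 * \<sigma>) = l * l powr (2 * \<sigma>)" using l by (simp add: powr_add)
      finally have "(norm (h x - A n))\<^sup>2 \<le> l powr (2 * \<sigma>) * g"
        using l by (simp add: mult.commute mult.left_commute)
      also have "\<dots> < e\<^sup>2" using N[OF that] by (simp add: l_def)
      finally have "norm (h x - A n) < e" using 1 by (simp add: power_less_imp_less_base)
      then show ?thesis by (simp add: dist_norm norm_minus_commute)
    qed
    then show ?case by blast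
  qed
  have "norm (h x - A 0) \<le> sqrt (2 * G) * r powr \<beta> / (1 - \<theta>)"
    by (rule Lim_bounded[OF tendsto_norm[OF tendsto_diff[OF conv tendsto_const]]]) (use bound in auto)
  then show ?thesis
    using len[of 0] by (simp add: A_def \<theta>_def \<beta>_def)
qed

text \<open>Start both nested sequences from the interval between the two points, one shrinking to
  its left end and one to its right end. They share the initial mean, through which the two values
  are compared.\<close>

lemma gagliardo_Hoelder:
  assumes h: "integrable leb01 h" and \<sigma>: "\<sigma> > 1/2" and G: "gagliardo_sq \<sigma> h \<le> ennreal G" "G \<ge> 0"
    and x: "x \<in> {0..1}" "gagliardo_inner \<sigma> h x < \<infinity>" and y: "y \<in> {0..1}" "gagliardo_inner \<sigma> h y < \<infinity>"
  shows "norm (h x - h y) \<le> 2 * sqrt (2 * G) / (1 - 2 powr - (\<sigma> - 1/2)) * \<bar>x - y\<bar> powr (\<sigma> - 1/2)"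
proof -
  have *: "norm (h x - h y) \<le> 2 * sqrt (2 * G) / (1 - 2 powr - (\<sigma> - 1/2)) * (y - x) powr (\<sigma> - 1/2)"
    if xy: "x < y" "x \<in> {0..1}" "gagliardo_inner \<sigma> h x < \<infinity>" "y \<in> {0..1}" "gagliardo_inner \<sigma> h y < \<infinity>" for x y
  proof -
    define r where "r = y - x"
    have r: "r > 0" using xy by (simp add: r_def)
    have rn: "r / 2 ^ n > 0" "r / 2 ^ Suc n \<le> r / 2 ^ n" for n
      using r by (auto simp: field_simps)
    have "norm (h x - integral {x..x + r / 2 ^ 0} h /\<^sub>R r) \<le> sqrt (2 * G) / (1 - 2 powr - (\<sigma> - 1/2)) * r powr (\<sigma> - 1/2)"
      by (rule nested_means_dist[OF h \<sigma> G r, where p="\<lambda>n. x" and q="\<lambda>n. x + r / 2 ^ n"])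
        (use rn xy in \<open>auto simp: r_def less_imp_le\<close>)
    moreover have "norm (h y - integral {y - r / 2 ^ 0..y} h /\<^sub>R r) \<le> sqrt (2 * G) / (1 - 2 powr - (\<sigma> - 1/2)) * r powr (\<sigma> - 1/2)"
      by (rule nested_means_dist[OF h \<sigma> G r, where q="\<lambda>n. y" and p="\<lambda>n. y - r / 2 ^ n"])
        (use rn xy in \<open>auto simp: r_def less_imp_le\<close>)
    ultimately have "norm ((h x - integral {x..y} h /\<^sub>R r) - (h y - integral {x..y} h /\<^sub>R r)) \<le> 2 * (sqrt (2 * G) / (1 - 2 powr - (\<sigma> - 1/2)) * r powr (\<sigma> - 1/2))"
      by (intro order_trans[OF norm_triangle_ineq4]) (auto simp: r_def)
    then show ?thesis by (simp add: r_def)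
  qed
  show ?thesis
    using *[of x y] *[of y x] x y by (cases x y rule: linorder_cases) (auto simp: norm_minus_commute abs_if)
qed

section \<open>Hoelder continuous representatives with explicit bounds\<close>

lemma AE_leb01_dense:
  assumes S: "S \<subseteq> {0..1}" and ae: "AE x in leb01. x \<in> S"
  shows "closure S = {0..1}"
proof
  show "closure S \<subseteq> {0..1}" using S by (intro closure_minimal) auto
  show "{0..1} \<subseteq> closure S"
  proof
    fix z :: real assume z: "z \<in> {0..1}"
    show "z \<in> closure S"
      unfolding closure_approachable
    proof (intro allI impI, rule ccontr)
      fix e :: real assume e: "e > 0" and no: "\<not> (\<exists>y\<in>S. dist y z < e)"
      define I where "I = {max 0 (z - e/2)..min 1 (z + e/2)}"
      have I: "I \<in> sets leb01" "I \<subseteq> {0..1}" by (auto simp: I_def sets_restrict_space intro!: image_eqI[where x=I])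
      have "AE x in leb01. x \<notin> I"
        using ae
      proof eventually_elim
        case (elim x)
        then have "\<not> dist x z < e" using no by auto
        then show ?case using e by (auto simp: I_def dist_real_def)
      qed
      then have "I \<in> null_sets leb01" using I by (subst AE_iff_null_sets) auto
      then have "emeasure leb01 I = 0" by auto
      moreover have "emeasure leb01 I = emeasure lebesgue I"
        using I by (intro emeasure_restrict_space) auto
      moreover have "emeasure lebesgue I = ennreal (min 1 (z + e/2) - max 0 (z - e/2))"
        using z e by (simp add: I_def)
      ultimately show False using z e by auto
    qed
  qed
qed

text \<open>A set of full measure is dense, and the Hoelder estimate makes \<open>h\<close>
  uniformly continuous on it. The inequality itself passes to the closure one variable at a
  time.\<close>

lemma Hoelder_extension:
  fixes h :: "real \<Rightarrow> 'a::euclidean_space"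
  assumes S: "S \<subseteq> {0..1}" "AE x in leb01. x \<in> S" and K: "K \<ge> 0" and \<beta>: "\<beta> > 0"
    and hol: "\<And>x y. x \<in> S \<Longrightarrow> y \<in> S \<Longrightarrow> norm (h x - h y) \<le> K * \<bar>x - y\<bar> powr \<beta>"
  obtains H where "AE x in leb01. h x = H x"
    "\<And>x y. x \<in> {0..1} \<Longrightarrow> y \<in> {0..1} \<Longrightarrow> norm (H x - H y) \<le> K * \<bar>x - y\<bar> powr \<beta>"
proof -
  have cl: "closure S = {0..1}" by (rule AE_leb01_dense[OF S])
  have "uniformly_continuous_on S h"
    unfolding uniformly_continuous_on_def
  proof (intro allI impI)
    fix e :: real assume e: "e > 0"
    define d where "d = (e / (K + 1)) powr (1 / \<beta>)"
    have "dist (h x') (h x) < e" if "x \<in> S" "x' \<in> S" "dist x' x < d" for x x'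
    proof -
      have "\<bar>x' - x\<bar> powr \<beta> \<le> d powr \<beta>"
        using that \<beta> by (intro powr_mono2) (auto simp: dist_real_def)
      also have "d powr \<beta> = e / (K + 1)"
        using \<beta> e K by (simp add: d_def powr_powr)
      finally have "K * \<bar>x' - x\<bar> powr \<beta> \<le> K * (e / (K + 1))" using K by (intro mult_left_mono)
      also have "\<dots> < e" using e K by (simp add: field_simps)
      finally show ?thesis using hol[of x' x] that by (simp add: dist_norm)
    qed
    moreover have "d > 0" using e K by (simp add: d_def)
    ultimately show "\<exists>d>0. \<forall>x\<in>S. \<forall>x'\<in>S. dist x' x < d \<longrightarrow> dist (h x') (h x) < e" by blast
  qed
  then obtain H where H: "uniformly_continuous_on (closure S) H" "\<And>x. x \<in> S \<Longrightarrow> h x = H x"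
    by (rule uniformly_continuous_on_extension_on_closure) blast
  have Hc: "continuous_on (closure S) H" using H(1) by (rule uniformly_continuous_imp_continuous)
  have pc: "continuous_on (closure S) (\<lambda>x. norm (H x - H y) - K * \<bar>x - y\<bar> powr \<beta>)" for y
    by (intro continuous_intros Hc continuous_on_powr') (use \<beta> in auto)
  have 1: "norm (H x - H y) - K * \<bar>x - y\<bar> powr \<beta> \<le> 0" if "x \<in> closure S" "y \<in> S" for x y
  proof (rule continuous_le_on_closure[OF pc that(1)])
    fix x assume "x \<in> S"
    then show "norm (H x - H y) - K * \<bar>x - y\<bar> powr \<beta> \<le> 0"
      using hol[of x y] H(2)[of x] H(2)[of y] that(2) by simp
  qed
  have 2: "norm (H x - H y) - K * \<bar>x - y\<bar> powr \<beta> \<le> 0" if "x \<in> closure S" "y \<in> closure S" for x y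
  proof (rule continuous_le_on_closure[OF pc that(1)])
    fix x assume "x \<in> S"
    then show "norm (H x - H y) - K * \<bar>x - y\<bar> powr \<beta> \<le> 0"
      using 1[OF that(2), of x] by (metis norm_minus_commute abs_minus_commute)
  qed
  show ?thesis
  proof (rule that[of H])
    show "AE x in leb01. h x = H x" using S(2) by eventually_elim (rule H(2))
  qed (use 2 in \<open>auto simp: cl\<close>)
qed

text \<open>\<open>L2_sq\<close> has the value infinity on nonmeasurable functions, so a finite
  bound also carries measurability.\<close>

lemma L2_sq_boundD:
  assumes "L2_sq h \<le> ennreal B"
  shows "h \<in> borel_measurable leb01" "(\<integral>\<^sup>+y. ennreal ((norm (h y))\<^sup>2) \<partial>leb01) \<le> ennreal B" "integrable leb01 h"
proof -
  show hm: "h \<in> borel_measurable leb01"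
  proof (rule ccontr)
    assume "h \<notin> borel_measurable leb01"
    then have "top \<le> ennreal B" using assms by (simp add: L2_sq_def)
    then show False by (simp add: top_unique)
  qed
  show nn: "(\<integral>\<^sup>+y. ennreal ((norm (h y))\<^sup>2) \<partial>leb01) \<le> ennreal B" using assms hm by (simp add: L2_sq_def)
  show "integrable leb01 h"
    by (rule L2_imp_integrable[OF hm]) (use nn in \<open>auto intro: order.strict_trans1\<close>)
qed

text \<open>On an interval of length 1 the oscillation of \<open>H\<close> is at most
  \<open>K\<close>; averaging \<open>norm (H x) \<le> norm (h y) + K\<close> over \<open>y\<close>
  brings in the L^1 norm, hence the L^2 norm.\<close>

lemma Hoelder_sup_bound:
  fixes h :: "real \<Rightarrow> complex"
  assumes L2: "L2_sq h \<le> ennreal B" "B \<ge> 0" and ae: "AE x in leb01. h x = H x" and K: "K \<ge> 0" and \<beta>: "\<beta> > 0"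
    and hol: "\<And>x y. x \<in> {0..1} \<Longrightarrow> y \<in> {0..1} \<Longrightarrow> norm (H x - H y) \<le> K * \<bar>x - y\<bar> powr \<beta>"
    and x: "x \<in> {0..1}"
  shows "norm (H x) \<le> sqrt B + K"
proof -
  note hm = L2_sq_boundD(1)[OF L2(1)] and nn = L2_sq_boundD(2)[OF L2(1)] and hi = L2_sq_boundD(3)[OF L2(1)]
  have "(LINT y|leb01. norm (H x)) \<le> (LINT y|leb01. norm (h y) + K)"
  proof (rule integral_mono_AE)
    show "AE y in leb01. norm (H x) \<le> norm (h y) + K"
      using ae AE_space
    proof eventually_elim
      case (elim y)
      then have y: "y \<in> {0..1}" by (simp add: space_restrict_space)
      have "\<bar>x - y\<bar> powr \<beta> \<le> 1 powr \<beta>" using x y \<beta> by (intro powr_mono2) auto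
      then have "K * \<bar>x - y\<bar> powr \<beta> \<le> K * 1" using K by (intro mult_left_mono) auto
      then have "norm (H x - H y) \<le> K" using hol[OF x y] by simp
      then show ?case using elim norm_triangle_sub[of "H x" "H y"] by simp
    qed
    show "integrable leb01 (\<lambda>y. norm (h y) + K)"
      by (intro Bochner_Integration.integrable_add integrable_norm hi integrable_leb_continuous continuous_on_const)
  qed (auto intro!: integrable_leb_continuous)
  also have "\<dots> = integral {0..1} (\<lambda>y. norm (h y)) + K"
    using hi by (subst Bochner_Integration.integral_add)
      (auto intro!: integrable_leb_continuous simp: lebesgue_integral_eq_integral measure_restrict_space)
  also have "integral {0..1} (\<lambda>y. norm (h y)) \<le> sqrt ((1 - 0) * B)"
    by (rule integral_norm_le_L2[OF hm _ L2(2) nn]) simp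
  finally show ?thesis by (simp add: measure_restrict_space)
qed

text \<open>The Sobolev embedding of order \<sigma> > 1/2. A finite double integral has a finite
  inner integral off a null set, and there \<open>gagliardo_Hoelder\<close> applies. The constants
  depend on \<open>B\<close>, \<open>G\<close> and \<open>\<sigma>\<close> only, as uniformity in
  time requires.\<close>

lemma gagliardo_regular:
  fixes h :: "real \<Rightarrow> complex"
  assumes L2: "L2_sq h \<le> ennreal B" "B \<ge> 0" and G: "gagliardo_sq \<sigma> h \<le> ennreal G" "G \<ge> 0" and \<sigma>: "\<sigma> > 1/2"
  defines "K \<equiv> 2 * sqrt (2 * G) / (1 - 2 powr - (\<sigma> - 1/2))"
  obtains H where "AE x in leb01. h x = H x" "\<And>x. x \<in> {0..1} \<Longrightarrow> norm (H x) \<le> sqrt B + K"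
    "\<And>x y. x \<in> {0..1} \<Longrightarrow> y \<in> {0..1} \<Longrightarrow> norm (H x - H y) \<le> K * \<bar>x - y\<bar> powr (\<sigma> - 1/2)"
proof -
  note hm = L2_sq_boundD(1)[OF L2(1)] and nn = L2_sq_boundD(2)[OF L2(1)] and hi = L2_sq_boundD(3)[OF L2(1)]
  have "(2::real) powr - (\<sigma> - 1/2) < 2 powr 0" using \<sigma> by (intro powr_less_mono) auto
  then have K: "K \<ge> 0" using G by (simp add: K_def)
  define S where "S = {x \<in> {0..1}. gagliardo_inner \<sigma> h x < \<infinity>}"
  have "AE x in leb01. gagliardo_inner \<sigma> h x \<noteq> \<infinity>"
  proof (rule nn_integral_noteq_infinite)
    show "gagliardo_inner \<sigma> h \<in> borel_measurable leb01" by (rule gagliardo_inner_measurable[OF hm])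
    have "(\<integral>\<^sup>+x. gagliardo_inner \<sigma> h x \<partial>leb01) = gagliardo_sq \<sigma> h"
      by (simp add: gagliardo_sq_def gagliardo_inner_def)
    then show "(\<integral>\<^sup>+x. gagliardo_inner \<sigma> h x \<partial>leb01) \<noteq> \<infinity>" using G by (auto simp: top_unique)
  qed
  then have aeS: "AE x in leb01. x \<in> S"
    using AE_space by eventually_elim (auto simp: S_def space_restrict_space less_top)
  obtain H where H: "AE x in leb01. h x = H x"
    "\<And>x y. x \<in> {0..1} \<Longrightarrow> y \<in> {0..1} \<Longrightarrow> norm (H x - H y) \<le> K * \<bar>x - y\<bar> powr (\<sigma> - 1/2)"
  proof (rule Hoelder_extension[of S K "\<sigma> - 1/2" h])
    show "norm (h x - h y) \<le> K * \<bar>x - y\<bar> powr (\<sigma> - 1/2)" if "x \<in> S" "y \<in> S" for x y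
      unfolding K_def using that by (intro gagliardo_Hoelder hi \<sigma> G) (auto simp: S_def)
    fix H assume "AE x in leb01. h x = H x"
      "\<And>x y. x \<in> {0..1} \<Longrightarrow> y \<in> {0..1} \<Longrightarrow> norm (H x - H y) \<le> K * \<bar>x - y\<bar> powr (\<sigma> - 1/2)"
    then show thesis by (rule that)
  qed (use \<sigma> K aeS in \<open>auto simp: S_def\<close>)
  show ?thesis
    by (rule that[OF H(1) _ H(2)]) (use Hoelder_sup_bound[OF L2 H(1) K _ H(2)] \<sigma> in auto)
qed

text \<open>The integer counterpart of \<open>gagliardo_regular\<close>: Cauchy-Schwarz for the
  integral of \<open>v\<close> between two points gives the exponent 1/2.\<close>

lemma H1_regular:
  fixes h :: "real \<Rightarrow> complex"
  assumes L2: "L2_sq h \<le> ennreal B" "B \<ge> 0" and wd: "weak_deriv h v" and v: "L2_sq v \<le> ennreal G" "G \<ge> 0"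
  obtains H where "AE x in leb01. h x = H x" "\<And>x. x \<in> {0..1} \<Longrightarrow> norm (H x) \<le> sqrt B + sqrt G"
    "\<And>x y. x \<in> {0..1} \<Longrightarrow> y \<in> {0..1} \<Longrightarrow> norm (H x - H y) \<le> sqrt G * \<bar>x - y\<bar> powr (1/2)"
proof -
  obtain c where c: "AE y in leb01. h y = c + integral {0..y} v"
    by (rule weak_deriv_imp_indefinite_integral[OF wd])
  define H where "H = (\<lambda>y. c + integral {0..y} v)"
  note nn = L2_sq_boundD(2)[OF v(1)] and vi = L2_sq_boundD(3)[OF v(1)]
  have vHK: "v integrable_on {0..1}" using vi by (auto intro: integrable_on_lebesgue_on)
  have *: "norm (H y - H x) \<le> sqrt G * (y - x) powr (1/2)" if xy: "0 \<le> x" "x \<le> y" "y \<le> 1" for x y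
  proof -
    have vi': "integrable (lebesgue_on {x..y}) v" by (rule integrable_subinterval[OF vi]) (use xy in auto)
    have "norm (H y - H x) = norm (integral {x..y} v)"
      using integral_diff_Icc[OF vHK xy] by (simp add: H_def)
    also have "\<dots> \<le> integral {x..y} (\<lambda>s. norm (v s))"
      using vi' by (intro integral_norm_bound_integral) (auto intro: integrable_on_lebesgue_on)
    also have "\<dots> \<le> sqrt ((y - x) * G)"
    proof (rule integral_norm_le_L2)
      have "(\<integral>\<^sup>+s. ennreal ((norm (v s))\<^sup>2) \<partial>lebesgue_on {x..y}) \<le> (\<integral>\<^sup>+s. ennreal ((norm (v s))\<^sup>2) \<partial>leb01)"
        by (rule nn_integral_leb_subset) (use xy in auto)
      then show "(\<integral>\<^sup>+s. ennreal ((norm (v s))\<^sup>2) \<partial>lebesgue_on {x..y}) \<le> ennreal G" using nn by simp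
    qed (use vi' v xy in auto)
    also have "\<dots> = sqrt G * (y - x) powr (1/2)" using xy by (simp add: real_sqrt_mult powr_half_sqrt mult.commute)
    finally show ?thesis .
  qed
  have hol: "norm (H x - H y) \<le> sqrt G * \<bar>x - y\<bar> powr (1/2)" if "x \<in> {0..1}" "y \<in> {0..1}" for x y
    using *[of x y] *[of y x] that by (cases "x \<le> y") (auto simp: norm_minus_commute abs_if)
  have ae: "AE x in leb01. h x = H x" using c by (simp add: H_def)
  show ?thesis
    by (rule that[OF ae _ hol]) (use Hoelder_sup_bound[OF L2 ae _ _ hol] v in auto)
qed

section \<open>The boundary singularity for classical solutions\<close>

text \<open>With \<mu> = -kt, multiplication by this phase conjugates the operator \<partial>_y/k -
  it into \<partial>_y/k.\<close>

definition osc :: "real \<Rightarrow> real \<Rightarrow> complex" where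
  "osc \<mu> x = exp (\<i> * of_real (\<mu> * x))"

lemma osc_has_vector_derivative:
  "(osc \<mu> has_vector_derivative \<i> * of_real \<mu> * osc \<mu> x) (at x within S)"
proof -
  have "((\<lambda>z. exp (\<i> * of_real \<mu> * z)) has_field_derivative \<i> * of_real \<mu> * exp (\<i> * of_real \<mu> * of_real x)) (at (of_real x))"
    by (auto intro!: derivative_eq_intros)
  from has_vector_derivative_real_field[OF this, of S] show ?thesis
    by (simp add: osc_def[abs_def] mult.assoc)
qed

lemma continuous_on_osc [continuous_intros]: "continuous_on S (osc \<mu>)"
  unfolding osc_def[abs_def] by (intro continuous_intros)

lemma osc_simps [simp]: "norm (osc \<mu> x) = 1" "osc \<mu> 0 = 1" "osc \<mu> x \<noteq> 0"
  by (auto simp: osc_def)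

lemma norm_osc_minus_1_le: "norm (osc \<mu> x - 1) \<le> \<bar>\<mu> * x\<bar>"
proof -
  have "norm (osc \<mu> x - 1) = 2 * \<bar>sin (\<mu> * x / 2)\<bar>"
    unfolding osc_def using dist_exp_i_1[of "\<mu> * x"] by simp
  also have "\<dots> \<le> 2 * \<bar>\<mu> * x / 2\<bar>" by (intro mult_left_mono abs_sin_x_le_abs_x) auto
  finally show ?thesis by simp
qed

text \<open>A quantitative Riemann-Lebesgue lemma. The phase integrates to 0 over each period
  \<open>d\<close>, so on a full period \<open>h\<close> may be replaced by its deviation from one
  of its values. The bound sees \<open>h\<close> only through its supremum and its oscillation over
  one period, so it applies to amplitudes that vary with \<mu>.\<close>

lemma oscillatory_integral_bound:
  fixes h :: "real \<Rightarrow> complex"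
  assumes h: "continuous_on {0..1} h" and B: "\<And>x. x \<in> {0..1} \<Longrightarrow> norm (h x) \<le> B"
    and \<mu>: "\<mu> \<noteq> 0" and d: "d = 2 * pi / \<bar>\<mu>\<bar>"
    and mod: "\<And>x y. x \<in> {0..1} \<Longrightarrow> y \<in> {0..1} \<Longrightarrow> \<bar>x - y\<bar> \<le> d \<Longrightarrow> norm (h x - h y) \<le> \<eta>"
  shows "norm (integral {0..1} (\<lambda>x. osc \<mu> x * h x)) \<le> \<eta> + B * d"
proof -
  define F where "F = (\<lambda>x. osc \<mu> x * h x)"
  have d0: "d > 0" using \<mu> d by simp
  have Fc: "continuous_on {0..1} F" unfolding F_def by (intro continuous_intros h)
  have Fi: "F integrable_on {0..1}" by (rule integrable_continuous_real[OF Fc])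
  have \<eta>0: "\<eta> \<ge> 0" using mod[of 0 0] d0 by simp
  have B0: "B \<ge> 0" using order_trans[OF norm_ge_zero B[of 0]] by simp
  have per: "osc \<mu> (a + d) = osc \<mu> a" for a
  proof -
    have "\<mu> * d = 2 * pi \<or> \<mu> * d = - (2 * pi)" using \<mu> by (auto simp: d abs_if)
    then have "exp (\<i> * of_real (\<mu> * d)) = 1"
    proof
      assume "\<mu> * d = - (2 * pi)"
      then have "exp (\<i> * of_real (\<mu> * d)) = inverse (exp (\<i> * of_real (2 * pi)))"
        by (simp add: exp_minus)
      also have "exp (\<i> * complex_of_real (2 * pi)) = 1"
        by (metis exp_two_pi_i' mult.commute of_real_mult of_real_numeral)
      finally show ?thesis by simp
    next
      assume "\<mu> * d = 2 * pi"
      then show ?thesis by (metis exp_two_pi_i' mult.commute of_real_mult of_real_numeral)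
    qed
    then show ?thesis by (simp add: osc_def distrib_left exp_add)
  qed
  have int0: "(osc \<mu> has_integral 0) {a..a + d}" for a
  proof -
    have "((\<lambda>x. \<i> * of_real \<mu> * osc \<mu> x) has_integral osc \<mu> (a + d) - osc \<mu> a) {a..a+d}"
      by (rule fundamental_theorem_of_calculus) (use d0 osc_has_vector_derivative in auto)
    from has_integral_mult_right[OF this, of "inverse (\<i> * of_real \<mu>)"]
    have "((\<lambda>x. inverse (\<i> * of_real \<mu>) * (\<i> * of_real \<mu> * osc \<mu> x)) has_integral 0) {a..a+d}"
      unfolding per by simp
    moreover have "(\<lambda>x. inverse (\<i> * of_real \<mu>) * (\<i> * of_real \<mu> * osc \<mu> x)) = osc \<mu>"
      using \<mu> by (simp add: fun_eq_iff field_simps)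
    ultimately show ?thesis by simp
  qed
  have step: "norm (integral {a..a + d} F) \<le> d * \<eta>" if a: "0 \<le> a" "a + d \<le> 1" for a
  proof -
    have i1: "((\<lambda>x. osc \<mu> x * h a) has_integral 0 * h a) {a..a + d}"
      by (rule has_integral_mult_left[OF int0])
    have i2: "(F has_integral integral {a..a+d} F) {a..a + d}"
      using integrable_on_subIcc[OF Fi a] by (rule integrable_integral)
    have "((\<lambda>x. F x - osc \<mu> x * h a) has_integral integral {a..a+d} F) {a..a + d}"
      using has_integral_diff[OF i2 i1] by simp
    then have "integral {a..a+d} F = integral {a..a+d} (\<lambda>x. F x - osc \<mu> x * h a)"
      by (simp add: integral_unique)
    also have "norm \<dots> \<le> \<eta> * (a + d - a)"
    proof (rule integral_bound)
      show "continuous_on {a..a+d} (\<lambda>x. F x - osc \<mu> x * h a)"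
        by (intro continuous_intros continuous_on_subset[OF Fc]) (use a in auto)
      fix x assume "x \<in> {a..a+d}"
      then have "norm (h x - h a) \<le> \<eta>" using a d0 by (intro mod) auto
      then show "norm (F x - osc \<mu> x * h a) \<le> \<eta>"
        by (simp add: F_def right_diff_distrib[symmetric] norm_mult)
    qed (use d0 in simp)
    finally show ?thesis by (simp add: mult.commute)
  qed
  have iter: "norm (integral {0..real n * d} F) \<le> real n * d * \<eta>" if "real n * d \<le> 1" for n
    using that
  proof (induction n)
    case (Suc n)
    have le: "real n * d + d \<le> 1" using Suc.prems by (simp add: algebra_simps)
    have IH: "norm (integral {0..real n * d} F) \<le> real n * d * \<eta>" using Suc.IH le d0 by simp
    have "integral {0..real n * d + d} F = integral {0..real n * d} F + integral {real n * d..real n * d + d} F"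
      using integral_diff_Icc[OF Fi, of "real n * d" "real n * d + d"] le d0 by (simp add: algebra_simps)
    also have "norm \<dots> \<le> real n * d * \<eta> + d * \<eta>"
      using step[OF _ le] d0 IH by (intro norm_triangle_mono) auto
    finally show ?case by (simp add: algebra_simps)
  qed simp
  \<comment> \<open>The number of full periods in the unit interval; the leftover piece is no longer
    than \<open>d\<close> and is estimated by the supremum.\<close>
  define n where "n = nat \<lfloor>1 / d\<rfloor>"
  have n: "real n \<le> 1 / d" "1 / d < real n + 1" using d0 by (auto simp: n_def)
  then have nd: "real n * d \<le> 1" "1 - real n * d \<le> d" using d0 by (auto simp: field_simps)
  have "integral {0..1} F = integral {0..real n * d} F + integral {real n * d..1} F"
    using integral_diff_Icc[OF Fi, of "real n * d" 1] nd d0 by (simp add: algebra_simps)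
  also have "norm \<dots> \<le> real n * d * \<eta> + B * (1 - real n * d)"
  proof (rule norm_triangle_mono[OF iter[OF nd(1)]])
    show "norm (integral {real n * d..1} F) \<le> B * (1 - real n * d)"
    proof (rule integral_bound[OF nd(1)])
      have "0 \<le> real n * d" using d0 by simp
      then show "continuous_on {real n * d..1} F" by (intro continuous_on_subset[OF Fc]) auto
      fix x assume "x \<in> {real n * d..1}"
      then have "x \<in> {0..1}" using \<open>0 \<le> real n * d\<close> by auto
      then show "norm (F x) \<le> B" using B by (simp add: F_def norm_mult)
    qed
  qed
  also have "\<dots> \<le> 1 * \<eta> + B * d" by (intro add_mono mult_right_mono mult_left_mono nd \<eta>0 B0)
  finally show ?thesis by (simp add: F_def)
qed

lemma vector_derivative_bound:
  fixes F :: "real \<Rightarrow> 'a::real_normed_vector"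
  assumes "convex X" "\<And>x. x \<in> X \<Longrightarrow> (F has_vector_derivative F' x) (at x within X)"
    and "\<And>x. x \<in> X \<Longrightarrow> norm (F' x) \<le> B" and "x \<in> X" "y \<in> X"
  shows "norm (F x - F y) \<le> B * norm (x - y)"
proof (rule differentiable_bound[OF assms(1)])
  show "(F has_derivative (\<lambda>h. h *\<^sub>R F' z)) (at z within X)" if "z \<in> X" for z
    using assms(2)[OF that] by (simp add: has_vector_derivative_def)
  show "onorm (\<lambda>h. h *\<^sub>R F' z) \<le> B" if "z \<in> X" for z
  proof (rule onorm_le)
    fix h :: real
    show "norm (h *\<^sub>R F' z) \<le> B * norm h"
      using mult_left_mono[OF assms(3)[OF that], of "\<bar>h\<bar>"] by (simp add: mult.commute)
  qed
qed (use assms in auto)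

text \<open>The classical form at positive times: \<open>H\<close> is the y-derivative of
  \<open>W\<close>, and \<open>V\<close> stands for g (\<partial>_y/k - it) \<Phi>, which turns the
  Dirichlet problem into a first-order system. The bounds \<open>M\<close> and
  \<open>\<alpha>\<close> are uniform in t. The evolution in time is left to the extension, so that
  the reflection of the interval can be applied to this locale alone.\<close>

locale shear_flow =
  fixes k :: real and f g :: "real \<Rightarrow> real" and W H \<Phi> V :: "real \<Rightarrow> real \<Rightarrow> complex" and M \<alpha> :: real
  assumes k0: "k \<noteq> 0" and fc: "continuous_on {0..1} f"
    and g': "\<And>y. y \<in> {0..1} \<Longrightarrow> (g has_real_derivative f y / g y) (at y within {0..1})"
    and g0: "\<And>y. y \<in> {0..1} \<Longrightarrow> g y \<noteq> 0"
    and W': "\<And>t y. t > 0 \<Longrightarrow> y \<in> {0..1} \<Longrightarrow> (W t has_vector_derivative H t y) (at y within {0..1})"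
    and H_bound: "\<And>t y. t > 0 \<Longrightarrow> y \<in> {0..1} \<Longrightarrow> norm (H t y) \<le> M"
    and H_Hoelder: "\<And>t x y. t > 0 \<Longrightarrow> x \<in> {0..1} \<Longrightarrow> y \<in> {0..1} \<Longrightarrow> norm (H t x - H t y) \<le> M * \<bar>x - y\<bar> powr \<alpha>"
    and \<alpha>: "\<alpha> > 0"
    and \<Phi>': "\<And>t y. t > 0 \<Longrightarrow> y \<in> {0..1} \<Longrightarrow> (\<Phi> t has_vector_derivative
      of_real k * (V t y / of_real (g y) + \<i> * of_real t * \<Phi> t y)) (at y within {0..1})"
    and V': "\<And>t y. t > 0 \<Longrightarrow> y \<in> {0..1} \<Longrightarrow> (V t has_vector_derivative
      of_real k * ((W t y + \<Phi> t y) / of_real (g y) + \<i> * of_real t * V t y)) (at y within {0..1})"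
    and \<Phi>_bdry: "\<And>t. t > 0 \<Longrightarrow> \<Phi> t 0 = 0" "\<And>t. t > 0 \<Longrightarrow> \<Phi> t 1 = 0"

text \<open>The L^2 time derivative does not act on point values, so the evolution is recorded for
  moments over \<open>{0..\<epsilon>}\<close>. The initial data enter through the limits
  \<open>m0\<close> and \<open>w0\<close>, because a C^1 representative is provided only for t >
  0.\<close>

locale endpoint_flow = shear_flow +
  fixes m0 :: "real \<Rightarrow> complex" and w0 :: complex
  assumes moment': "\<And>t \<epsilon>. t > 0 \<Longrightarrow> 0 < \<epsilon> \<Longrightarrow> \<epsilon> \<le> 1 \<Longrightarrow>
      ((\<lambda>t. integral {0..\<epsilon>} (W t)) has_vector_derivative
        \<i> / of_real k * integral {0..\<epsilon>} (\<lambda>y. of_real (f y) * \<Phi> t y)) (at t)"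
    and moment_initial: "\<And>\<epsilon>. 0 < \<epsilon> \<Longrightarrow> \<epsilon> \<le> 1 \<Longrightarrow> ((\<lambda>t. integral {0..\<epsilon>} (W t)) \<longlongrightarrow> m0 \<epsilon>) (at_right 0)"
    and initial_trace: "((\<lambda>\<epsilon>. m0 \<epsilon> / of_real \<epsilon>) \<longlongrightarrow> w0) (at_right 0)"
begin

lemma gc: "continuous_on {0..1} g"
  using g' by (rule DERIV_continuous_on)

lemma Wc: "t > 0 \<Longrightarrow> continuous_on {0..1} (W t)"
  by (rule continuous_on_vector_derivative) (rule W')

lemma \<Phi>c: "t > 0 \<Longrightarrow> continuous_on {0..1} (\<Phi> t)"
  by (rule continuous_on_vector_derivative) (rule \<Phi>')

lemma M0: "M \<ge> 0"
  using order_trans[OF norm_ge_zero H_bound[of 1 0]] by simp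

lemma g_lower: obtains \<gamma> where "\<gamma> > 0" "\<And>y. y \<in> {0..1} \<Longrightarrow> \<gamma> \<le> \<bar>g y\<bar>"
proof -
  have "continuous_on {0..1} (\<lambda>y. \<bar>g y\<bar>)" by (intro continuous_intros gc)
  then obtain x where x: "x \<in> {0..1}" "\<And>y. y \<in> {0..1} \<Longrightarrow> \<bar>g x\<bar> \<le> \<bar>g y\<bar>"
    using continuous_attains_inf[of "{0..1::real}" "\<lambda>y. \<bar>g y\<bar>"] by auto
  show ?thesis by (rule that[of "\<bar>g x\<bar>"]) (use x g0 in auto)
qed

lemma f_bound: obtains F where "F \<ge> 0" "\<And>y. y \<in> {0..1} \<Longrightarrow> \<bar>f y\<bar> \<le> F"
proof -
  have "continuous_on {0..1} (\<lambda>y. \<bar>f y\<bar>)" by (intro continuous_intros fc)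
  then obtain x where x: "x \<in> {0..1}" "\<And>y. y \<in> {0..1} \<Longrightarrow> \<bar>f y\<bar> \<le> \<bar>f x\<bar>"
    using continuous_attains_sup[of "{0..1::real}" "\<lambda>y. \<bar>f y\<bar>"] by auto
  show ?thesis by (rule that[of "\<bar>f x\<bar>"]) (use x in auto)
qed

section \<open>Variation of constants for the stream function\<close>

definition Z :: "real \<Rightarrow> real" where "Z y = integral {0..y} (\<lambda>x. 1 / g x)"

definition S :: "real \<Rightarrow> real \<Rightarrow> real" where "S y x = sinh (k * (Z y - Z x))"

definition C :: "real \<Rightarrow> real \<Rightarrow> real" where "C y x = cosh (k * (Z y - Z x))"

lemma Z': "y \<in> {0..1} \<Longrightarrow> (Z has_real_derivative 1 / g y) (at y within {0..1})"
  unfolding Z_def[abs_def] has_real_derivative_iff_has_vector_derivative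
  by (rule integral_has_vector_derivative) (auto intro!: continuous_intros gc g0)

lemma Zc: "continuous_on {0..1} Z"
  using Z' by (rule DERIV_continuous_on)

lemma Z0 [simp]: "Z 0 = 0" by (simp add: Z_def)

text \<open>By the mean value theorem, as the derivative 1/g never vanishes. This makes
  \<open>S 1 0\<close> nonzero, so that the condition at y = 1 determines
  \<open>V t 0\<close>.\<close>

lemma Z1: "Z 1 \<noteq> 0"
proof -
  have "\<exists>x\<in>{0<..<1}. Z 1 - Z 0 = (*) (1 / g x) (1 - 0)"
  proof (rule mvt_simple)
    fix x :: real assume "0 \<le> x" "x \<le> 1"
    then show "(Z has_derivative (*) (1 / g x)) (at x within {0..1})"
      using Z'[of x] by (simp only: has_field_derivative_def atLeastAtMost_iff)
  qed simp
  then show ?thesis using g0 by fastforce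
qed

lemma S': "x \<in> {0..1} \<Longrightarrow> (S y has_real_derivative - k * C y x / g x) (at x within {0..1})"
  unfolding S_def[abs_def] C_def by (auto intro!: derivative_eq_intros Z')

lemma C': "x \<in> {0..1} \<Longrightarrow> (C y has_real_derivative - k * S y x / g x) (at x within {0..1})"
  unfolding S_def C_def[abs_def] by (auto intro!: derivative_eq_intros Z')

lemma Sc: "continuous_on {0..1} (S y)" and Cc: "continuous_on {0..1} (C y)"
  unfolding S_def[abs_def] C_def[abs_def] by (intro continuous_intros Zc)+

lemma SC_diag [simp]: "S y y = 0" "C y y = 1"
  by (auto simp: S_def C_def)

lemma S10: "S 1 0 \<noteq> 0" using Z1 k0 by (simp add: S_def)

lemma S_lipschitz:
  obtains K where "K \<ge> 0" "\<And>x y. x \<in> {0..1} \<Longrightarrow> y \<in> {0..1} \<Longrightarrow> \<bar>S y x\<bar> \<le> K * \<bar>y - x\<bar>"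
proof -
  obtain \<gamma> where \<gamma>: "\<gamma> > 0" "\<And>y. y \<in> {0..1} \<Longrightarrow> \<gamma> \<le> \<bar>g y\<bar>" using g_lower by metis
  have Zl: "\<bar>Z y - Z x\<bar> \<le> 1 / \<gamma>" if "x \<in> {0..1}" "y \<in> {0..1}" for x y
  proof -
    have "norm (Z y - Z x) \<le> 1 / \<gamma> * norm (y - x)"
      by (rule field_differentiable_bound[where S="{0..1}" and f'="\<lambda>y. 1 / g y"])
        (use Z' that \<gamma> g0 in \<open>auto simp: abs_divide intro!: divide_left_mono mult_pos_pos\<close>)
    also have "\<dots> \<le> 1 / \<gamma> * 1" using that \<gamma> by (intro mult_left_mono) auto
    finally show ?thesis by simp
  qed
  define K where "K = \<bar>k\<bar> * cosh (\<bar>k\<bar> * (1 / \<gamma>)) / \<gamma>"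
  show ?thesis
  proof (rule that[of K])
    show "K \<ge> 0" using \<gamma> by (simp add: K_def cosh_real_nonneg)
    fix x y :: real assume xy: "x \<in> {0..1}" "y \<in> {0..1}"
    have "norm (S y x - S y y) \<le> K * norm (x - y)"
    proof (rule field_differentiable_bound[where S="{0..1}" and f'="\<lambda>x. - k * C y x / g x"])
      fix s :: real assume s: "s \<in> {0..1}"
      show "(S y has_field_derivative - k * C y s / g s) (at s within {0..1})" by (rule S'[OF s])
      have "C y s = cosh \<bar>k * (Z y - Z s)\<bar>" by (simp add: C_def)
      also have "\<dots> \<le> cosh (\<bar>k\<bar> * (1 / \<gamma>))"
        using mult_left_mono[OF Zl[OF s xy(2)], of "\<bar>k\<bar>"] \<gamma>
        by (subst cosh_real_nonneg_le_iff) (auto simp: abs_mult)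
      finally have "\<bar>k\<bar> * C y s / \<bar>g s\<bar> \<le> \<bar>k\<bar> * cosh (\<bar>k\<bar> * (1 / \<gamma>)) / \<gamma>"
        using \<gamma> s by (intro frac_le mult_left_mono mult_nonneg_nonneg) (auto simp: C_def cosh_real_nonneg)
      then show "norm (- k * C y s / g s) \<le> K"
        by (simp add: K_def abs_mult abs_divide C_def)
    qed (use xy in auto)
    then show "\<bar>S y x\<bar> \<le> K * \<bar>y - x\<bar>" by (simp add: abs_minus_commute)
  qed
qed

text \<open>The combination \<open>P\<close> of \<open>V\<close> and \<open>\<Phi>\<close> with
  coefficients sinh and cosh has the source alone as its derivative: all homogeneous terms cancel.
  At x = y the sinh term drops out and leaves the stream function; at x = 0 the boundary condition
  leaves \<open>V t 0\<close>.\<close>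

lemma Green:
  assumes t: "t > 0" and y: "y \<in> {0..1}"
  shows "osc (- (k * t)) y * \<Phi> t y
     = V t 0 * of_real (S y 0) + of_real k * integral {0..y} (\<lambda>x. osc (- (k * t)) x * W t x * of_real (S y x / g x))"
proof -
  define e where "e = osc (- (k * t))"
  define P where "P = (\<lambda>x. S y x *\<^sub>R (e x * V t x) + C y x *\<^sub>R (e x * \<Phi> t x))"
  have e': "(e has_vector_derivative - (\<i> * of_real (k * t) * e x)) (at x within T)" for x T
    unfolding e_def using osc_has_vector_derivative[of "- (k * t)" x T] by simp
  have "((\<lambda>x. of_real k * (e x * W t x * of_real (S y x / g x))) has_integral (P y - P 0)) {0..y}"
  proof (rule fundamental_theorem_of_calculus)
    fix x assume "x \<in> {0..y}"
    then have x: "x \<in> {0..1}" using y by auto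
    note d = has_vector_derivative_add[OF
        has_vector_derivative_scaleR[OF S'[OF x, of y] has_vector_derivative_mult[OF e' V'[OF t x]]]
        has_vector_derivative_scaleR[OF C'[OF x, of y] has_vector_derivative_mult[OF e' \<Phi>'[OF t x]]]]
    have "(P has_vector_derivative of_real k * (e x * W t x * of_real (S y x / g x))) (at x within {0..1})"
      unfolding P_def
      by (rule has_vector_derivative_eq_rhs[OF d]) (use g0[OF x] in \<open>simp add: scaleR_conv_of_real field_simps\<close>)
    then show "(P has_vector_derivative of_real k * (e x * W t x * of_real (S y x / g x))) (at x within {0..y})"
      by (rule has_vector_derivative_within_subset) (use y in auto)
  qed (use y in auto)
  then have "integral {0..y} (\<lambda>x. of_real k * (e x * W t x * of_real (S y x / g x))) = P y - P 0"
    by (rule integral_unique)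
  moreover have "P y = e y * \<Phi> t y" "P 0 = V t 0 * of_real (S y 0)"
    by (simp_all add: P_def e_def \<Phi>_bdry[OF t] scaleR_conv_of_real)
  ultimately show ?thesis
    by (simp only: Henstock_Kurzweil_Integration.integral_mult_right e_def) (metis add.commute diff_add_cancel)
qed

text \<open>The constant does not depend on t because the phase has modulus 1. The kernel
  \<open>S y x\<close> is of order \<open>\<bar>y - x\<bar>\<close>, so the integral in
  \<open>Green\<close> is of order y^2. At y = 1, where \<open>\<Phi>\<close> vanishes, this bounds
  \<open>V t 0\<close>, and then \<open>\<Phi>\<close> itself.\<close>

lemma flow_bounds:
  obtains K where "K \<ge> 0"
    "\<And>t B. t > 0 \<Longrightarrow> (\<And>y. y \<in> {0..1} \<Longrightarrow> norm (W t y) \<le> B) \<Longrightarrow> norm (V t 0) \<le> K * B"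
    "\<And>t B y. t > 0 \<Longrightarrow> (\<And>y. y \<in> {0..1} \<Longrightarrow> norm (W t y) \<le> B) \<Longrightarrow> y \<in> {0..1} \<Longrightarrow> norm (\<Phi> t y) \<le> K * B * y"
    "\<And>t B y. t > 0 \<Longrightarrow> (\<And>y. y \<in> {0..1} \<Longrightarrow> norm (W t y) \<le> B) \<Longrightarrow> y \<in> {0..1} \<Longrightarrow>
      norm (osc (- (k * t)) y * \<Phi> t y - V t 0 * of_real (S y 0)) \<le> K * B * y\<^sup>2"
proof -
  obtain \<gamma> where \<gamma>: "\<gamma> > 0" "\<And>y. y \<in> {0..1} \<Longrightarrow> \<gamma> \<le> \<bar>g y\<bar>" using g_lower by metis
  obtain L where L: "L \<ge> 0" "\<And>x y. x \<in> {0..1} \<Longrightarrow> y \<in> {0..1} \<Longrightarrow> \<bar>S y x\<bar> \<le> L * \<bar>y - x\<bar>"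
    using S_lipschitz by metis
  define K1 where "K1 = \<bar>k\<bar> * L / \<gamma>"
  define K2 where "K2 = K1 / \<bar>S 1 0\<bar>"
  define K3 where "K3 = K2 * L + K1"
  have K: "K1 \<ge> 0" "K2 \<ge> 0" "K3 \<ge> 0" using L \<gamma> by (auto simp: K1_def K2_def K3_def)
  have int: "norm (osc (- (k * t)) y * \<Phi> t y - V t 0 * of_real (S y 0)) \<le> K1 * B * y\<^sup>2"
    if t: "t > 0" and B: "\<And>y. y \<in> {0..1} \<Longrightarrow> norm (W t y) \<le> B" and y: "y \<in> {0..1}" for t B y
  proof -
    have B0: "B \<ge> 0" using order_trans[OF norm_ge_zero B[of 0]] by simp
    have "norm (integral {0..y} (\<lambda>x. osc (- (k * t)) x * W t x * of_real (S y x / g x))) \<le> (B * (L * y / \<gamma>)) * (y - 0)"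
    proof (rule integral_bound)
      show "continuous_on {0..y} (\<lambda>x. osc (- (k * t)) x * W t x * of_real (S y x / g x))"
        by (rule continuous_on_subset[where s="{0..1}"])
          (use y g0 t in \<open>auto intro!: continuous_intros Wc Sc gc\<close>)
      fix x assume "x \<in> {0..y}"
      then have x: "x \<in> {0..1}" "x \<le> y" using y by auto
      have "\<bar>S y x\<bar> \<le> L * y"
        using L(2)[OF x(1) y] x L(1) mult_left_mono[of "y - x" y L] by auto
      then have "\<bar>S y x\<bar> / \<bar>g x\<bar> \<le> L * y / \<gamma>"
        using \<gamma>(1) \<gamma>(2)[OF x(1)] L y by (intro frac_le) auto
      then have "norm (W t x) * (\<bar>S y x\<bar> / \<bar>g x\<bar>) \<le> B * (L * y / \<gamma>)"
        using B[OF x(1)] B0 by (intro mult_mono) auto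
      then show "norm (osc (- (k * t)) x * W t x * of_real (S y x / g x)) \<le> B * (L * y / \<gamma>)"
        by (simp add: norm_mult norm_divide)
    qed (use y in auto)
    then have "\<bar>k\<bar> * norm (integral {0..y} (\<lambda>x. osc (- (k * t)) x * W t x * of_real (S y x / g x))) \<le> \<bar>k\<bar> * ((B * (L * y / \<gamma>)) * (y - 0))"
      by (rule mult_left_mono) simp
    also have "\<dots> = K1 * B * y\<^sup>2" by (simp add: K1_def power2_eq_square)
    finally show ?thesis unfolding Green[OF t y] by (simp add: norm_mult)
  qed
  have V: "norm (V t 0) \<le> K2 * B" if t: "t > 0" and B: "\<And>y. y \<in> {0..1} \<Longrightarrow> norm (W t y) \<le> B" for t B
  proof -
    have "norm (V t 0) * \<bar>S 1 0\<bar> \<le> K1 * B"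
      using int[OF t B, of 1] \<Phi>_bdry(2)[OF t] by (simp add: norm_mult)
    then show ?thesis using S10 by (simp add: K2_def pos_le_divide_eq)
  qed
  have P: "norm (\<Phi> t y) \<le> K3 * B * y"
    if t: "t > 0" and B: "\<And>y. y \<in> {0..1} \<Longrightarrow> norm (W t y) \<le> B" and y: "y \<in> {0..1}" for t B y
  proof -
    have B0: "B \<ge> 0" using order_trans[OF norm_ge_zero B[of 0]] by simp
    have "norm (\<Phi> t y) = norm (osc (- (k * t)) y * \<Phi> t y)" by (simp add: norm_mult)
    also have "\<dots> \<le> norm (V t 0 * of_real (S y 0)) + K1 * B * y\<^sup>2"
      using int[OF t B y] norm_triangle_sub order_trans add_left_mono by meson
    also have "norm (V t 0 * of_real (S y 0)) \<le> (K2 * B) * (L * y)"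
      using V[OF t B] L(2)[of 0 y] y K B0 by (simp add: norm_mult mult_mono)
    finally have "norm (\<Phi> t y) \<le> K2 * B * (L * y) + K1 * B * y\<^sup>2" by simp
    moreover have "K1 * B * y\<^sup>2 \<le> K1 * B * y"
      using y K B0 by (intro mult_left_mono) (auto simp: power2_eq_square mult_left_le_one_le)
    moreover have "K3 * B * y = K2 * B * (L * y) + K1 * B * y" by (simp add: K3_def algebra_simps)
    ultimately show ?thesis by linarith
  qed
  define K where "K = K1 + K2 + K3"
  have KK: "K1 \<le> K" "K2 \<le> K" "K3 \<le> K" "K \<ge> 0" using K by (auto simp: K_def)
  have up: "K' * B * z \<le> K * B * z" if "K' \<le> K" "B \<ge> 0" "z \<ge> 0" for K' B z
    using that by (intro mult_right_mono) auto
  have B0: "B \<ge> 0" if "\<And>y. y \<in> {0..1} \<Longrightarrow> norm (W t y) \<le> B" for t B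
    using order_trans[OF norm_ge_zero that[of 0]] by simp
  show ?thesis
  proof (rule that[OF KK(4)])
    fix t B assume t: "t > (0::real)" and B: "\<And>y. y \<in> {0..1} \<Longrightarrow> norm (W t y) \<le> B"
    show "norm (V t 0) \<le> K * B" using V[OF t B] up[OF KK(2) B0[OF B], of 1] by simp
    fix y :: real assume y: "y \<in> {0..1}"
    show "norm (\<Phi> t y) \<le> K * B * y" using P[OF t B y] up[OF KK(3) B0[OF B], of y] y by simp
    show "norm (osc (- (k * t)) y * \<Phi> t y - V t 0 * of_real (S y 0)) \<le> K * B * y\<^sup>2"
      using int[OF t B y] up[OF KK(1) B0[OF B], of "y\<^sup>2"] y by simp
  qed
qed

section \<open>Moments near the wall and the boundary value of the vorticity\<close>

lemma W_lipschitz: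
  assumes "t > 0" "x \<in> {0..1}" "y \<in> {0..1}"
  shows "norm (W t x - W t y) \<le> M * \<bar>x - y\<bar>"
proof -
  have "norm (W t x - W t y) \<le> M * norm (x - y)"
    by (rule vector_derivative_bound[where X="{0..1}" and F="W t" and F'="H t"])
      (use W' H_bound assms in auto)
  then show ?thesis by simp
qed

lemma moment_trace:
  assumes t: "t > 0" and \<epsilon>: "0 < \<epsilon>" "\<epsilon> \<le> 1"
  shows "norm (integral {0..\<epsilon>} (W t) - of_real \<epsilon> * W t 0) \<le> M * \<epsilon>\<^sup>2"
proof -
  have Wi: "W t integrable_on {0..\<epsilon>}"
    by (intro integrable_continuous_real continuous_on_subset[OF Wc[OF t]]) (use \<epsilon> in auto)
  have "norm (integral {0..\<epsilon>} (\<lambda>y. W t y - W t 0)) \<le> (M * \<epsilon>) * (\<epsilon> - 0)"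
  proof (rule integral_bound)
    show "continuous_on {0..\<epsilon>} (\<lambda>y. W t y - W t 0)"
      by (intro continuous_intros continuous_on_subset[OF Wc[OF t]]) (use \<epsilon> in auto)
    fix y assume y: "y \<in> {0..\<epsilon>}"
    have "norm (W t y - W t 0) \<le> M * \<bar>y - 0\<bar>" using y \<epsilon> by (intro W_lipschitz t) auto
    also have "\<dots> \<le> M * \<epsilon>" using y M0 by (intro mult_left_mono) auto
    finally show "norm (W t y - W t 0) \<le> M * \<epsilon>" .
  qed (use \<epsilon> in auto)
  moreover have "integral {0..\<epsilon>} (\<lambda>y. W t y - W t 0) = integral {0..\<epsilon>} (W t) - of_real \<epsilon> * W t 0"
    using \<epsilon> by (subst Henstock_Kurzweil_Integration.integral_diff[OF Wi]) (auto simp: scaleR_conv_of_real)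
  ultimately show ?thesis by (simp add: power2_eq_square mult.assoc)
qed

text \<open>The stream function vanishes at the boundary, so the vorticity is transported trivially there.\<close>

lemma boundary_conservation:
  assumes T: "T > 0"
  shows "W T 0 = w0"
proof -
  \<comment> \<open>The uniform bounds concern the derivative of \<open>W\<close> only, so a bound
    on \<open>W\<close> itself over finite times has to come from elsewhere: the moment over the
    whole interval, completed by its limit at t = 0, is continuous on \<open>{0..T}\<close>.\<close>
  define n where "n = (\<lambda>t. if t \<le> 0 then m0 1 else integral {0..1} (W t))"
  have "continuous_on {0..T} n"
    unfolding continuous_on_def
  proof
    fix t assume t: "t \<in> {0..T}"
    show "(n \<longlongrightarrow> n t) (at t within {0..T})"
    proof (cases "t = 0")
      case True
      have "((\<lambda>t. integral {0..1} (W t)) \<longlongrightarrow> m0 1) (at 0 within {0..T})"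
        by (rule tendsto_mono[OF _ moment_initial[of 1]]) (auto simp: at_within_def intro!: inf_mono le_infI2)
      moreover have "\<forall>\<^sub>F t in at 0 within {0..T}. integral {0..1} (W t) = n t"
        by (auto simp: eventually_at_filter n_def)
      ultimately show ?thesis using True by (auto simp: n_def intro: Lim_transform_eventually)
    next
      case False
      then have t0: "t > 0" using t by auto
      have "isCont (\<lambda>t. integral {0..1} (W t)) t"
        using moment'[OF t0, of 1] by (intro has_vector_derivative_continuous) auto
      then have "((\<lambda>t. integral {0..1} (W t)) \<longlongrightarrow> integral {0..1} (W t)) (at t)"
        by (simp add: isCont_def)
      then have "((\<lambda>t. integral {0..1} (W t)) \<longlongrightarrow> n t) (at t)" using t0 by (simp add: n_def)
      moreover have "\<forall>\<^sub>F s in at t. integral {0..1} (W s) = n s"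
      proof -
        have "\<forall>\<^sub>F s in nhds t. s > 0" using t0 by (rule order_tendstoD(1)[OF filterlim_ident])
        then have "\<forall>\<^sub>F s in at t. s > 0" by (simp add: eventually_at_filter eventually_mono)
        then show ?thesis by eventually_elim (simp add: n_def)
      qed
      ultimately have "(n \<longlongrightarrow> n t) (at t)" by (rule Lim_transform_eventually)
      then show ?thesis by (rule tendsto_within_subset) simp
    qed
  qed
  then have "bounded (n ` {0..T})" using compact_continuous_image compact_imp_bounded by blast
  then obtain N where N: "\<And>t. t \<in> {0..T} \<Longrightarrow> norm (n t) \<le> N" by (force simp: bounded_iff)
  \<comment> \<open>One \<open>M\<close> to pass from the moment over the unit interval to
    \<open>W t 0\<close>, another from there to \<open>W t y\<close>.\<close>
  define B where "B = N + 2 * M"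
  have B: "norm (W t y) \<le> B" if t: "0 < t" "t \<le> T" and y: "y \<in> {0..1}" for t y
  proof -
    have "norm (integral {0..1} (W t) - W t 0) \<le> M" using moment_trace[OF t(1), of 1] by simp
    moreover have "norm (integral {0..1} (W t)) \<le> N" using N[of t] t by (simp add: n_def)
    ultimately have "norm (W t 0) \<le> N + M" using norm_triangle_ineq3[of "integral {0..1} (W t)" "W t 0"] by linarith
    moreover have "norm (W t y - W t 0) \<le> M"
      using W_lipschitz[OF t(1) y, of 0] y M0 mult_left_le[of "\<bar>y\<bar>" M] by auto
    ultimately show ?thesis using norm_triangle_ineq2[of "W t y" "W t 0"] by (simp add: B_def)
  qed
  have B0: "B \<ge> 0" using order_trans[OF norm_ge_zero B[OF T, of 0]] by simp
  obtain K where K: "K \<ge> 0" "\<And>t B y. t > 0 \<Longrightarrow> (\<And>y. y \<in> {0..1} \<Longrightarrow> norm (W t y) \<le> B) \<Longrightarrow> y \<in> {0..1} \<Longrightarrow> norm (\<Phi> t y) \<le> K * B * y"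
    using flow_bounds by metis
  obtain F where F: "F \<ge> 0" "\<And>y. y \<in> {0..1} \<Longrightarrow> \<bar>f y\<bar> \<le> F" using f_bound by metis
  define D where "D = F * (K * B) / \<bar>k\<bar>"
  have D0: "D \<ge> 0" using F K B0 by (simp add: D_def)
  \<comment> \<open>Since \<open>\<Phi>\<close> is of order y at the wall, the moment moves at speed
    of order \<epsilon>^2. Divided by \<epsilon>, its change over a fixed time tends to 0, which is
    why the trace cannot move.\<close>
  have drift: "norm (integral {0..\<epsilon>} (W T) - m0 \<epsilon>) \<le> D * \<epsilon>\<^sup>2 * T" if \<epsilon>: "0 < \<epsilon>" "\<epsilon> \<le> 1" for \<epsilon>
  proof -
    have der: "norm (\<i> / of_real k * integral {0..\<epsilon>} (\<lambda>y. of_real (f y) * \<Phi> t y)) \<le> D * \<epsilon>\<^sup>2"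
      if t: "0 < t" "t \<le> T" for t
    proof -
      have "norm (integral {0..\<epsilon>} (\<lambda>y. of_real (f y) * \<Phi> t y)) \<le> (F * (K * B * \<epsilon>)) * (\<epsilon> - 0)"
      proof (rule integral_bound)
        show "continuous_on {0..\<epsilon>} (\<lambda>y. of_real (f y) * \<Phi> t y)"
          by (intro continuous_intros continuous_on_subset[OF \<Phi>c[OF t(1)]] continuous_on_subset[OF fc]) (use \<epsilon> in auto)
        fix y assume y: "y \<in> {0..\<epsilon>}"
        have "norm (\<Phi> t y) \<le> K * B * y" using y \<epsilon> by (intro K(2) t B) auto
        also have "\<dots> \<le> K * B * \<epsilon>" using y K B0 by (intro mult_left_mono) auto
        finally show "norm (of_real (f y) * \<Phi> t y) \<le> F * (K * B * \<epsilon>)"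
          using F y \<epsilon> by (auto simp: norm_mult intro!: mult_mono)
      qed (use \<epsilon> in auto)
      then have "norm (integral {0..\<epsilon>} (\<lambda>y. of_real (f y) * \<Phi> t y)) / \<bar>k\<bar> \<le> (F * (K * B * \<epsilon>)) * (\<epsilon> - 0) / \<bar>k\<bar>"
        by (rule divide_right_mono) simp
      then show ?thesis by (simp add: norm_mult norm_divide D_def power2_eq_square mult_ac)
    qed
    have incr: "norm (integral {0..\<epsilon>} (W T) - integral {0..\<epsilon>} (W s)) \<le> D * \<epsilon>\<^sup>2 * T" if s: "0 < s" "s < T" for s
    proof -
      have "norm (integral {0..\<epsilon>} (W T) - integral {0..\<epsilon>} (W s)) \<le> D * \<epsilon>\<^sup>2 * norm (T - s)"
      proof (rule vector_derivative_bound[where X="{s..T}" and x=T and y=s and F="\<lambda>t. integral {0..\<epsilon>} (W t)"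
              and F'="\<lambda>t. \<i> / of_real k * integral {0..\<epsilon>} (\<lambda>y. of_real (f y) * \<Phi> t y)"])
        fix t assume t: "t \<in> {s..T}"
        show "((\<lambda>t. integral {0..\<epsilon>} (W t)) has_vector_derivative
            \<i> / of_real k * integral {0..\<epsilon>} (\<lambda>y. of_real (f y) * \<Phi> t y)) (at t within {s..T})"
          by (rule has_vector_derivative_at_within, rule moment') (use t s \<epsilon> in auto)
        show "norm (\<i> / of_real k * integral {0..\<epsilon>} (\<lambda>y. of_real (f y) * \<Phi> t y)) \<le> D * \<epsilon>\<^sup>2"
          using t s by (intro der) auto
      qed (use s in auto)
      also have "\<dots> \<le> D * \<epsilon>\<^sup>2 * T" using s D0 by (intro mult_left_mono) auto
      finally show ?thesis .
    qed
    have "((\<lambda>s. norm (integral {0..\<epsilon>} (W T) - integral {0..\<epsilon>} (W s))) \<longlongrightarrow> norm (integral {0..\<epsilon>} (W T) - m0 \<epsilon>)) (at_right 0)"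
      by (intro tendsto_intros moment_initial \<epsilon>)
    then show ?thesis
    proof (rule tendsto_upperbound)
      show "\<forall>\<^sub>F s in at_right 0. norm (integral {0..\<epsilon>} (W T) - integral {0..\<epsilon>} (W s)) \<le> D * \<epsilon>\<^sup>2 * T"
        using eventually_at_right_real[OF T]
        by eventually_elim (use incr in auto)
    qed simp
  qed
  have "((\<lambda>\<epsilon>. m0 \<epsilon> / of_real \<epsilon> - W T 0) \<longlongrightarrow> 0) (at_right 0)"
  proof (rule Lim_null_comparison)
    show "((\<lambda>\<epsilon>. (D * T + M) * \<epsilon>) \<longlongrightarrow> 0) (at_right 0)"
      by (rule tendsto_eq_intros refl tendsto_ident_at | simp)+
    show "\<forall>\<^sub>F \<epsilon> in at_right 0. norm (m0 \<epsilon> / of_real \<epsilon> - W T 0) \<le> (D * T + M) * \<epsilon>"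
      using eventually_at_right_real[OF zero_less_one]
    proof eventually_elim
      case (elim \<epsilon>)
      have "norm (m0 \<epsilon> - of_real \<epsilon> * W T 0) \<le> D * \<epsilon>\<^sup>2 * T + M * \<epsilon>\<^sup>2"
        using drift[of \<epsilon>] moment_trace[OF T, of \<epsilon>] elim
          norm_triangle_ineq[of "m0 \<epsilon> - integral {0..\<epsilon>} (W T)" "integral {0..\<epsilon>} (W T) - of_real \<epsilon> * W T 0"]
        by (simp add: norm_minus_commute)
      then have "norm ((m0 \<epsilon> - of_real \<epsilon> * W T 0) / of_real \<epsilon>) \<le> (D * \<epsilon>\<^sup>2 * T + M * \<epsilon>\<^sup>2) / \<epsilon>"
        using elim by (simp add: norm_divide divide_right_mono)
      also have "(D * \<epsilon>\<^sup>2 * T + M * \<epsilon>\<^sup>2) / \<epsilon> = (D * T + M) * \<epsilon>"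
        using elim by (simp add: power2_eq_square field_simps)
      finally show ?case using elim by (simp add: diff_divide_distrib)
    qed
  qed
  then have "((\<lambda>\<epsilon>. m0 \<epsilon> / of_real \<epsilon>) \<longlongrightarrow> W T 0) (at_right 0)" by (simp add: LIM_zero_iff)
  then show ?thesis using initial_trace by (intro tendsto_unique[of "at_right (0::real)"]) auto
qed

text \<open>Now that the trace is known to be constant, the bound holds for all positive times,
  unlike the provisional one obtained up to a fixed \<open>T\<close>.\<close>

lemma W_bound:
  assumes "t > 0" "y \<in> {0..1}"
  shows "norm (W t y) \<le> norm w0 + M"
proof -
  have "norm (W t y - W t 0) \<le> M * \<bar>y - 0\<bar>" using assms by (intro W_lipschitz) auto
  also have "\<dots> \<le> M" using assms M0 by (simp add: mult_left_le)
  finally show ?thesis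
    using norm_triangle_ineq2[of "W t y" "W t 0"] boundary_conservation[OF assms(1)] by simp
qed

section \<open>Equicontinuity uniform in time\<close>

lemma W_equi:
  assumes "\<eta> > 0"
  obtains \<delta> where "\<delta> > 0" "\<And>t x y. t > 0 \<Longrightarrow> x \<in> {0..1} \<Longrightarrow> y \<in> {0..1} \<Longrightarrow> \<bar>x - y\<bar> < \<delta> \<Longrightarrow> norm (W t x - W t y) \<le> \<eta>"
proof (rule that[of "\<eta> / (M + 1)"])
  show "\<eta> / (M + 1) > 0" using assms M0 by simp
  fix t x y :: real assume *: "t > 0" "x \<in> {0..1}" "y \<in> {0..1}" "\<bar>x - y\<bar> < \<eta> / (M + 1)"
  have "norm (W t x - W t y) \<le> M * \<bar>x - y\<bar>" by (intro W_lipschitz *)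
  also have "\<dots> \<le> M * (\<eta> / (M + 1))" using * M0 by (intro mult_left_mono) auto
  also have "\<dots> \<le> \<eta>" using assms M0 by (simp add: field_simps)
  finally show "norm (W t x - W t y) \<le> \<eta>" .
qed

lemma H_equi:
  assumes "\<eta> > 0"
  obtains \<delta> where "\<delta> > 0" "\<And>t x y. t > 0 \<Longrightarrow> x \<in> {0..1} \<Longrightarrow> y \<in> {0..1} \<Longrightarrow> \<bar>x - y\<bar> < \<delta> \<Longrightarrow> norm (H t x - H t y) \<le> \<eta>"
proof (rule that[of "(\<eta> / (M + 1)) powr (1 / \<alpha>)"])
  show "(\<eta> / (M + 1)) powr (1 / \<alpha>) > 0" using assms M0 by simp
  fix t x y :: real assume *: "t > 0" "x \<in> {0..1}" "y \<in> {0..1}" "\<bar>x - y\<bar> < (\<eta> / (M + 1)) powr (1 / \<alpha>)"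
  have "\<bar>x - y\<bar> powr \<alpha> \<le> ((\<eta> / (M + 1)) powr (1 / \<alpha>)) powr \<alpha>"
    using * \<alpha> by (intro powr_mono2) auto
  also have "\<dots> = \<eta> / (M + 1)" using \<alpha> assms M0 by (simp add: powr_powr)
  finally have "M * \<bar>x - y\<bar> powr \<alpha> \<le> M * (\<eta> / (M + 1))" using M0 by (intro mult_left_mono)
  also have "\<dots> \<le> \<eta>" using assms M0 by (simp add: field_simps)
  finally show "norm (H t x - H t y) \<le> \<eta>" using H_Hoelder[OF *(1-3)] by simp
qed

lemma Hc:
  assumes "t > 0"
  shows "continuous_on {0..1} (H t)"
  unfolding continuous_on_iff
proof (intro ballI allI impI)
  fix x e :: real assume x: "x \<in> {0..1}" and e: "e > 0"
  obtain \<delta> where "\<delta> > 0" "\<And>t x y. t > 0 \<Longrightarrow> x \<in> {0..1} \<Longrightarrow> y \<in> {0..1} \<Longrightarrow> \<bar>x - y\<bar> < \<delta> \<Longrightarrow> norm (H t x - H t y) \<le> e / 2"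
    using H_equi[of "e / 2"] e by (metis half_gt_zero)
  then show "\<exists>d>0. \<forall>x'\<in>{0..1}. dist x' x < d \<longrightarrow> dist (H t x') (H t x) < e"
    using x e assms by (intro exI[of _ \<delta>]) (force simp: dist_norm)
qed

text \<open>The modulus of continuity must be independent of t, because it is later evaluated at the
  period of the phase, which shrinks as t grows.\<close>

lemma product_equi:
  fixes G :: "real \<Rightarrow> real \<Rightarrow> complex" and r :: "real \<Rightarrow> real"
  assumes G: "\<And>\<eta>. \<eta> > 0 \<Longrightarrow> \<exists>\<delta>>0. \<forall>t>0. \<forall>x\<in>{0..1}. \<forall>y\<in>{0..1}. \<bar>x - y\<bar> < \<delta> \<longrightarrow> norm (G t x - G t y) \<le> \<eta>"
    and B: "\<And>t x. t > 0 \<Longrightarrow> x \<in> {0..1} \<Longrightarrow> norm (G t x) \<le> B"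
    and r: "continuous_on {0..1} r" and \<eta>: "\<eta> > 0"
  shows "\<exists>\<delta>>0. \<forall>t>0. \<forall>x\<in>{0..1}. \<forall>y\<in>{0..1}. \<bar>x - y\<bar> < \<delta> \<longrightarrow> norm (G t x * of_real (r x) - G t y * of_real (r y)) \<le> \<eta>"
proof -
  have B0: "B \<ge> 0" using order_trans[OF norm_ge_zero B[of 1 0]] by simp
  have "bounded (r ` {0..1})" using r compact_continuous_image compact_imp_bounded by blast
  then obtain R where R: "R > 0" "\<And>x. x \<in> {0..1} \<Longrightarrow> \<bar>r x\<bar> \<le> R" by (force simp: bounded_pos)
  obtain d1 where d1: "d1 > 0" "\<And>t x y. t > 0 \<Longrightarrow> x \<in> {0..1} \<Longrightarrow> y \<in> {0..1} \<Longrightarrow> \<bar>x - y\<bar> < d1 \<Longrightarrow> norm (G t x - G t y) \<le> \<eta> / (2 * R)"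
    using G[of "\<eta> / (2 * R)"] \<eta> R by auto
  have "uniformly_continuous_on {0..1} r" by (rule compact_uniformly_continuous[OF r]) simp
  then obtain d2 where d2: "d2 > 0" "\<And>x y. x \<in> {0..1} \<Longrightarrow> y \<in> {0..1} \<Longrightarrow> dist y x < d2 \<Longrightarrow> dist (r y) (r x) < \<eta> / (2 * (B + 1))"
    unfolding uniformly_continuous_on_def using \<eta> B0 by (metis add_nonneg_pos divide_pos_pos mult_pos_pos zero_less_numeral zero_less_one)
  show ?thesis
  proof (intro exI[of _ "min d1 d2"] conjI allI ballI impI)
    fix t x y :: real assume *: "t > 0" "x \<in> {0..1}" "y \<in> {0..1}" "\<bar>x - y\<bar> < min d1 d2"
    have "G t x * of_real (r x) - G t y * of_real (r y) = (G t x - G t y) * of_real (r x) + G t y * of_real (r x - r y)"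
      by (simp add: algebra_simps)
    also have "norm \<dots> \<le> \<eta> / (2 * R) * R + B * (\<eta> / (2 * (B + 1)))"
    proof (rule norm_triangle_mono)
      show "norm ((G t x - G t y) * of_real (r x)) \<le> \<eta> / (2 * R) * R"
        unfolding norm_mult using * \<eta> R by (intro mult_mono d1) auto
      have "dist (r x) (r y) < \<eta> / (2 * (B + 1))" using * by (intro d2) (auto simp: dist_real_def)
      then show "norm (G t y * of_real (r x - r y)) \<le> B * (\<eta> / (2 * (B + 1)))"
        unfolding norm_mult norm_of_real using * B0 by (intro mult_mono B) (auto simp: dist_real_def)
    qed
    also have "\<dots> \<le> \<eta> / 2 + \<eta> / 2"
      using R B0 \<eta> by (intro add_mono) (auto simp: field_simps)
    finally show "norm (G t x * of_real (r x) - G t y * of_real (r y)) \<le> \<eta>" by simp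
  qed (use d1 d2 in simp)
qed

text \<open>The amplitude that multiplies the oscillating vorticity in \<open>Green\<close> at y =
  1. It vanishes at x = 1.\<close>

definition R :: "real \<Rightarrow> real" where "R x = S 1 x / g x"

definition R' :: "real \<Rightarrow> real" where "R' x = - (k * C 1 x + S 1 x * f x / g x) / (g x)\<^sup>2"

lemma R_deriv: "x \<in> {0..1} \<Longrightarrow> (R has_real_derivative R' x) (at x within {0..1})"
  unfolding R_def[abs_def] R'_def using g0[of x]
  by (auto intro!: derivative_eq_intros S' g' simp: field_simps power2_eq_square)

lemma Rc: "continuous_on {0..1} R" and R'c: "continuous_on {0..1} R'"
  unfolding R_def[abs_def] R'_def[abs_def] using g0 by (auto intro!: continuous_intros Sc Cc gc fc)

text \<open>What the integration by parts leaves inside the integral: the phase times the derivative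
  of the product of \<open>W t\<close> and \<open>R\<close>.\<close>

definition remainder :: "real \<Rightarrow> complex" where
  "remainder t = integral {0..1} (\<lambda>x. osc (- (k * t)) x * (H t x * of_real (R x) + W t x * of_real (R' x)))"

text \<open>The period of the phase is \<open>2 * pi / \<bar>k * t\<bar>\<close>. Once it is below
  the common moduli of continuity of the two products, \<open>oscillatory_integral_bound\<close>
  gives \<eta>/4 + \<eta>/4 for the oscillation and \<eta>/2 for the incomplete period.\<close>

lemma remainder_small:
  assumes \<eta>: "\<eta> > 0"
  shows "\<forall>\<^sub>F t in at_top. norm (remainder t) \<le> \<eta>"
proof -
  define h where "h = (\<lambda>t x. H t x * of_real (R x) + W t x * of_real (R' x))"
  have "bounded (R ` {0..1})" "bounded (R' ` {0..1})" using Rc R'c compact_continuous_image compact_imp_bounded by blast+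
  then obtain r r' where r: "r > 0" "\<And>x. x \<in> {0..1} \<Longrightarrow> \<bar>R x\<bar> \<le> r" and r': "r' > 0" "\<And>x. x \<in> {0..1} \<Longrightarrow> \<bar>R' x\<bar> \<le> r'"
    by (force simp: bounded_pos)
  define B where "B = M * r + (norm w0 + M) * r'"
  have B: "norm (h t x) \<le> B" if "t > 0" "x \<in> {0..1}" for t x
    unfolding h_def B_def
  proof (rule norm_triangle_mono)
    show "norm (H t x * of_real (R x)) \<le> M * r"
      unfolding norm_mult norm_of_real using that M0 r by (intro mult_mono H_bound) auto
    show "norm (W t x * of_real (R' x)) \<le> (norm w0 + M) * r'"
      unfolding norm_mult norm_of_real using that M0 r' by (intro mult_mono W_bound) auto
  qed
  have B0: "B \<ge> 0" using order_trans[OF norm_ge_zero B[of 1 0]] by simp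
  have "\<exists>\<delta>>0. \<forall>t>0. \<forall>x\<in>{0..1}. \<forall>y\<in>{0..1}. \<bar>x - y\<bar> < \<delta> \<longrightarrow> norm (H t x * of_real (R x) - H t y * of_real (R y)) \<le> \<eta> / 4"
    by (rule product_equi[OF _ H_bound Rc]) (use H_equi \<eta> in \<open>metis, auto\<close>)
  then obtain d1 where d1: "d1 > 0" "\<And>t x y. t > 0 \<Longrightarrow> x \<in> {0..1} \<Longrightarrow> y \<in> {0..1} \<Longrightarrow> \<bar>x - y\<bar> < d1 \<Longrightarrow> norm (H t x * of_real (R x) - H t y * of_real (R y)) \<le> \<eta> / 4"
    by metis
  have "\<exists>\<delta>>0. \<forall>t>0. \<forall>x\<in>{0..1}. \<forall>y\<in>{0..1}. \<bar>x - y\<bar> < \<delta> \<longrightarrow> norm (W t x * of_real (R' x) - W t y * of_real (R' y)) \<le> \<eta> / 4"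
    by (rule product_equi[OF _ W_bound R'c]) (use W_equi \<eta> in \<open>metis, auto\<close>)
  then obtain d2 where d2: "d2 > 0" "\<And>t x y. t > 0 \<Longrightarrow> x \<in> {0..1} \<Longrightarrow> y \<in> {0..1} \<Longrightarrow> \<bar>x - y\<bar> < d2 \<Longrightarrow> norm (W t x * of_real (R' x) - W t y * of_real (R' y)) \<le> \<eta> / 4"
    by metis
  have lim: "((\<lambda>t. (2 * pi / \<bar>k\<bar>) * inverse t) \<longlongrightarrow> (2 * pi / \<bar>k\<bar>) * 0) at_top"
    by (intro tendsto_intros tendsto_inverse_0_at_top filterlim_ident)
  have "\<forall>\<^sub>F t in at_top. (2 * pi / \<bar>k\<bar>) * inverse t = 2 * pi / \<bar>- (k * t)\<bar>"
    using eventually_gt_at_top[of 0] by eventually_elim (simp add: abs_mult field_simps)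
  from Lim_transform_eventually[OF lim this] have lim': "((\<lambda>t. 2 * pi / \<bar>- (k * t)\<bar>) \<longlongrightarrow> 0) at_top"
    by simp
  have "\<forall>\<^sub>F t in at_top. 2 * pi / \<bar>- (k * t)\<bar> < min (min d1 d2) (\<eta> / (2 * (B + 1)))"
    by (rule order_tendstoD(2)[OF lim']) (use d1 d2 \<eta> B0 in auto)
  with eventually_gt_at_top[of 0] show ?thesis
  proof eventually_elim
    case (elim t)
    then have t: "t > 0" by simp
    define d where "d = 2 * pi / \<bar>- (k * t)\<bar>"
    have d: "d < d1" "d < d2" "d < \<eta> / (2 * (B + 1))" "d > 0" using elim k0 by (auto simp: d_def)
    have "norm (integral {0..1} (\<lambda>x. osc (- (k * t)) x * h t x)) \<le> (\<eta> / 4 + \<eta> / 4) + B * d"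
    proof (rule oscillatory_integral_bound[OF _ _ _ d_def])
      show "continuous_on {0..1} (h t)"
        unfolding h_def by (intro continuous_intros Hc Wc t Rc R'c)
      show "norm (h t x) \<le> B" if "x \<in> {0..1}" for x by (rule B[OF t that])
      show "- (k * t) \<noteq> 0" using t k0 by simp
      fix x y :: real assume xy: "x \<in> {0..1}" "y \<in> {0..1}" "\<bar>x - y\<bar> \<le> d"
      have "h t x - h t y = (H t x * of_real (R x) - H t y * of_real (R y)) + (W t x * of_real (R' x) - W t y * of_real (R' y))"
        by (simp add: h_def)
      also have "norm \<dots> \<le> \<eta> / 4 + \<eta> / 4"
        using xy d by (intro norm_triangle_mono d1 d2 t) auto
      finally show "norm (h t x - h t y) \<le> \<eta> / 4 + \<eta> / 4" .
    qed
    also have "B * d \<le> B * (\<eta> / (2 * (B + 1)))" using d B0 by (intro mult_left_mono) auto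
    also have "\<dots> \<le> \<eta> / 2" using B0 \<eta> by (simp add: field_simps)
    finally show ?case by (simp add: remainder_def h_def)
  qed
qed

text \<open>The main term of the normal derivative comes from the boundary contribution of a single
  integration by parts against the oscillating factor.\<close>

lemma V_asymptotics:
  assumes t: "t > 0"
  shows "V t 0 = \<i> / of_real t * (w0 / of_real (g 0) + remainder t / of_real (S 1 0))"
proof -
  define c where "c = - (\<i> * of_real (k * t))"
  define e where "e = osc (- (k * t))"
  have c0: "c \<noteq> 0" using k0 t by (simp add: c_def)
  define J where "J = integral {0..1} (\<lambda>x. e x * W t x * of_real (R x))"
  have e': "(e has_vector_derivative c * e x) (at x within T)" for x T
    unfolding e_def c_def using osc_has_vector_derivative[of "- (k * t)" x T] by simp
  define P where "P = (\<lambda>x. R x *\<^sub>R (e x * W t x))"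
  have ec: "continuous_on {0..1} e" unfolding e_def by (intro continuous_intros)
  have i1: "(\<lambda>x. c * (e x * W t x * of_real (R x))) integrable_on {0..1}"
    by (intro integrable_continuous_real continuous_intros ec Wc[OF t] Rc)
  have i2: "(\<lambda>x. e x * (H t x * of_real (R x) + W t x * of_real (R' x))) integrable_on {0..1}"
    by (intro integrable_continuous_real continuous_intros ec Wc[OF t] Hc[OF t] Rc R'c)
  have "((\<lambda>x. c * (e x * W t x * of_real (R x)) + e x * (H t x * of_real (R x) + W t x * of_real (R' x)))
      has_integral P 1 - P 0) {0..1}"
  proof (rule fundamental_theorem_of_calculus)
    fix x :: real assume x: "x \<in> {0..1}"
    note d = has_vector_derivative_scaleR[OF R_deriv[OF x] has_vector_derivative_mult[OF e' W'[OF t x]]]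
    show "(P has_vector_derivative c * (e x * W t x * of_real (R x)) + e x * (H t x * of_real (R x) + W t x * of_real (R' x))) (at x within {0..1})"
      unfolding P_def by (rule has_vector_derivative_eq_rhs[OF d]) (simp add: scaleR_conv_of_real algebra_simps)
  qed simp
  then have "P 1 - P 0 = integral {0..1} (\<lambda>x. c * (e x * W t x * of_real (R x)) + e x * (H t x * of_real (R x) + W t x * of_real (R' x)))"
    by (simp add: integral_unique)
  also have "\<dots> = integral {0..1} (\<lambda>x. c * (e x * W t x * of_real (R x))) + remainder t"
    unfolding remainder_def using i1 i2 by (subst Henstock_Kurzweil_Integration.integral_add) (auto simp: e_def)
  also have "integral {0..1} (\<lambda>x. c * (e x * W t x * of_real (R x))) = c * J"
    unfolding J_def by (rule Henstock_Kurzweil_Integration.integral_mult_right)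
  \<comment> \<open>The boundary term at x = 1 vanishes with \<open>R\<close>; the one at x = 0
    contains \<open>W t 0\<close>, which boundary conservation replaces by \<open>w0\<close> for
    every t.\<close>
  finally have "c * J = - (w0 * of_real (R 0)) - remainder t"
    using boundary_conservation[OF t] by (simp add: P_def R_def e_def scaleR_conv_of_real algebra_simps)
  moreover have "V t 0 * of_real (S 1 0) + of_real k * J = 0"
    using Green[OF t, of 1] \<Phi>_bdry(2)[OF t] by (simp add: J_def R_def e_def)
  ultimately have "c * (V t 0 * of_real (S 1 0)) = of_real k * (w0 * of_real (R 0) + remainder t)"
    by (metis (no_types, opaque_lifting) add.commute add_diff_cancel_left' diff_0 minus_add_distrib minus_minus mult.left_commute mult_minus_right uminus_add_conv_diff)
  then have "of_real k * (- \<i> * of_real t * (V t 0 * of_real (S 1 0))) = of_real k * (w0 * of_real (R 0) + remainder t)"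
    by (simp add: c_def mult_ac)
  then have "- \<i> * of_real t * (V t 0 * of_real (S 1 0)) = w0 * of_real (R 0) + remainder t"
    using k0 by (subst (asm) mult_cancel_left) auto
  from arg_cong[OF this, of "\<lambda>z. \<i> * z"]
  have "of_real t * (V t 0 * of_real (S 1 0)) = \<i> * (w0 * of_real (R 0) + remainder t)"
    by (simp add: mult.assoc[symmetric])
  then show ?thesis
    using S10 t g0[of 0] by (simp add: R_def field_simps)
qed

text \<open>If the product were nonzero, the 1/t drift of a moment near the wall would accumulate
  logarithmically in t, beyond the fixed distance of order \<epsilon>^2 that the derivative bound
  permits.\<close>

lemma boundary_product_zero: "f 0 = 0 \<or> w0 = 0"
proof (rule ccontr)
  assume "\<not> (f 0 = 0 \<or> w0 = 0)"
  then have nz: "f 0 \<noteq> 0" "w0 \<noteq> 0" by auto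
  \<comment> \<open>Inserting the leading term i w0 / (g(0) t) of \<open>V t 0\<close> into (i/k)
    f(0) (k/g(0)) \<open>V t 0\<close> gives -\<beta>/t, the predicted speed of the derivative of
    \<open>W\<close> at the wall.\<close>
  define \<beta> where "\<beta> = of_real (f 0) * w0 / (of_real (g 0))\<^sup>2"
  define b where "b = norm \<beta>"
  have b: "b > 0" using nz g0[of 0] by (simp add: b_def \<beta>_def)
  \<comment> \<open>The factor with which \<open>remainder\<close> enters the speed of the moment,
    in units of \<epsilon>^2/2 and 1/t. The threshold \<open>b / (4 * q)\<close> makes that
    contribution at most a quarter of the predicted speed.\<close>
  define q where "q = \<bar>f 0 / g 0\<bar> / \<bar>S 1 0\<bar>"
  have q: "q > 0" using nz g0[of 0] S10 by (simp add: q_def)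
  have "\<forall>\<^sub>F t in at_top. norm (remainder t) \<le> b / (4 * q) \<and> t \<ge> 1"
    using q b by (intro eventually_conj remainder_small eventually_ge_at_top) auto
  then obtain T1 where "\<And>t. t \<ge> T1 \<Longrightarrow> norm (remainder t) \<le> b / (4 * q) \<and> t \<ge> 1"
    by (auto simp: eventually_at_top_linorder)
  then have T1: "T1 \<ge> 1" "\<And>t. t \<ge> T1 \<Longrightarrow> norm (remainder t) \<le> b / (4 * q)" by auto
  obtain K where K: "K \<ge> 0"
    "\<And>t B. t > 0 \<Longrightarrow> (\<And>y. y \<in> {0..1} \<Longrightarrow> norm (W t y) \<le> B) \<Longrightarrow> norm (V t 0) \<le> K * B"
    "\<And>t B y. t > 0 \<Longrightarrow> (\<And>y. y \<in> {0..1} \<Longrightarrow> norm (W t y) \<le> B) \<Longrightarrow> y \<in> {0..1} \<Longrightarrow> norm (\<Phi> t y) \<le> K * B * y"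
    "\<And>t B y. t > 0 \<Longrightarrow> (\<And>y. y \<in> {0..1} \<Longrightarrow> norm (W t y) \<le> B) \<Longrightarrow> y \<in> {0..1} \<Longrightarrow>
      norm (osc (- (k * t)) y * \<Phi> t y - V t 0 * of_real (S y 0)) \<le> K * B * y\<^sup>2"
    using flow_bounds by metis
  define B where "B = norm w0 + M"
  have Bt: "norm (W t y) \<le> B" if "t > 0" "y \<in> {0..1}" for t y unfolding B_def by (rule W_bound[OF that])
  have B0: "B \<ge> 0" using M0 by (simp add: B_def)
  note V_le = K(2)[OF _ Bt] and \<Phi>_le = K(3)[OF _ Bt] and exp_le = K(4)[OF _ Bt]
  obtain F where F: "F \<ge> 0" "\<And>y. y \<in> {0..1} \<Longrightarrow> \<bar>f y\<bar> \<le> F" using f_bound by metis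
  \<comment> \<open>The final comparison forces \<open>L * b \<le> 8 * M\<close> for L = ln (T/T1);
    the exponent is chosen to violate this. \<open>T\<close> is fixed before \<epsilon> because
    \<open>err\<close> depends on it.\<close>
  define T where "T = T1 * exp (8 * M / b + 1)"
  have "8 * M / b + 1 > 0" using M0 b by (simp add: add_nonneg_pos)
  then have T: "T > T1" "T > 0" using T1 by (auto simp: T_def)
  define L where "L = ln T - ln T1"
  have L: "L = 8 * M / b + 1" using T1 by (simp add: L_def T_def ln_mult)
  define \<sigma> where "\<sigma> = (\<lambda>y. S y 0 / y - k / g 0)"
  \<comment> \<open>Errors of the linear approximation relative to y, in this order: freezing the
    phase up to time \<open>T\<close>, the integral term of \<open>Green\<close>, the deviation
    \<open>\<sigma>\<close> of sinh from its linear part, and the variation of \<open>f\<close>. For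
    fixed \<open>T\<close> all tend to 0 with y.\<close>
  define err where "err = (\<lambda>y. F * (\<bar>k\<bar> * T * (K * B) * y + K * B * y + K * B * \<bar>\<sigma> y\<bar>) + \<bar>f y - f 0\<bar> * (K * B * \<bar>k / g 0\<bar>))"
  have err: "norm (of_real (f y) * \<Phi> t y - of_real (f 0) * V t 0 * of_real (k / g 0 * y)) \<le> err y * y"
    if t: "0 < t" "t \<le> T" and y: "0 < y" "y \<le> 1" for t y
  proof -
    have y': "y \<in> {0..1}" using y by auto
    have "of_real (f y) * \<Phi> t y - of_real (f 0) * V t 0 * of_real (k / g 0 * y)
      = of_real (f y) * ((1 - osc (- (k * t)) y) * \<Phi> t y + (osc (- (k * t)) y * \<Phi> t y - V t 0 * of_real (S y 0)) + V t 0 * of_real (S y 0 - k / g 0 * y))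
        + of_real (f y - f 0) * (V t 0 * of_real (k / g 0 * y))"
      by (simp only: of_real_diff) algebra
    also have "norm \<dots> \<le> F * (\<bar>k\<bar> * T * y * (K * B * y) + K * B * y\<^sup>2 + K * B * (\<bar>\<sigma> y\<bar> * y)) + \<bar>f y - f 0\<bar> * (K * B * (\<bar>k / g 0\<bar> * y))"
    proof (rule norm_triangle_mono)
      have 1: "norm ((1 - osc (- (k * t)) y) * \<Phi> t y) \<le> \<bar>k\<bar> * T * y * (K * B * y)"
      proof -
        have "norm (1 - osc (- (k * t)) y) \<le> \<bar>k\<bar> * t * y"
          using norm_osc_minus_1_le[of "- (k * t)" y] t y by (simp add: norm_minus_commute abs_mult)
        also have "\<dots> \<le> \<bar>k\<bar> * T * y" using t y by (intro mult_right_mono mult_left_mono) auto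
        finally show ?thesis
          unfolding norm_mult using \<Phi>_le[OF t(1) t(1) _ y'] t y by (intro mult_mono) auto
      qed
      have 3: "norm (V t 0 * of_real (S y 0 - k / g 0 * y)) \<le> K * B * (\<bar>\<sigma> y\<bar> * y)"
      proof -
        have "S y 0 - k / g 0 * y = \<sigma> y * y" using y by (simp add: \<sigma>_def field_simps)
        then show ?thesis using V_le[OF t(1) t(1)] y K B0 by (auto simp: norm_mult abs_mult intro!: mult_mono)
      qed
      show "norm (of_real (f y) * ((1 - osc (- (k * t)) y) * \<Phi> t y + (osc (- (k * t)) y * \<Phi> t y - V t 0 * of_real (S y 0)) + V t 0 * of_real (S y 0 - k / g 0 * y)))
        \<le> F * (\<bar>k\<bar> * T * y * (K * B * y) + K * B * y\<^sup>2 + K * B * (\<bar>\<sigma> y\<bar> * y))"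
        unfolding norm_mult[of "of_real (f y)"]
        by (intro mult_mono norm_triangle_mono 1 exp_le[OF t(1) t(1) _ y'] 3) (use F y' in auto)
      show "norm (of_real (f y - f 0) * (V t 0 * of_real (k / g 0 * y))) \<le> \<bar>f y - f 0\<bar> * (K * B * (\<bar>k / g 0\<bar> * y))"
        unfolding norm_mult norm_of_real using V_le[OF t(1) t(1)] y K B0
        by (intro mult_mono) (auto simp: abs_mult)
    qed
    also have "\<dots> = err y * y" by (simp add: err_def algebra_simps power2_eq_square)
    finally show ?thesis .
  qed
  \<comment> \<open>Integrating \<rho> y over \<open>{0..\<epsilon>}\<close> and dividing by
    \<open>\<bar>k\<bar>\<close> yields (\<epsilon>^2/2)(b/4)/T, which is at most the same quantity
    with t in place of \<open>T\<close>.\<close>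
  define \<rho> where "\<rho> = \<bar>k\<bar> * b / (4 * T)"
  have \<rho>: "\<rho> > 0" using k0 b T by (simp add: \<rho>_def)
  have "(err \<longlongrightarrow> F * (\<bar>k\<bar> * T * (K * B) * 0 + K * B * 0 + K * B * \<bar>0\<bar>) + \<bar>f 0 - f 0\<bar> * (K * B * \<bar>k / g 0\<bar>)) (at_right 0)"
  proof -
    have at: "at 0 within {0..1} = at_right (0::real)" by (rule at_within_Icc_at_right) simp
    have f0: "(f \<longlongrightarrow> f 0) (at_right 0)" using fc by (auto simp: continuous_on_def at dest!: bspec[of _ _ 0])
    have "((\<lambda>y. S y 0) has_real_derivative k / g 0) (at 0 within {0..1})"
      unfolding S_def by (auto intro!: derivative_eq_intros Z')
    then have "((\<lambda>y. S y 0 / y) \<longlongrightarrow> k / g 0) (at_right 0)"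
      by (simp add: has_field_derivative_iff at)
    then have "(\<sigma> \<longlongrightarrow> k / g 0 - k / g 0) (at_right 0)" unfolding \<sigma>_def by (rule tendsto_diff[OF _ tendsto_const])
    then have \<sigma>0: "(\<sigma> \<longlongrightarrow> 0) (at_right 0)" by simp
    show ?thesis unfolding err_def by (intro tendsto_intros f0 \<sigma>0)
  qed
  then have "\<forall>\<^sub>F y in at_right 0. err y < \<rho>" by (rule order_tendstoD(2)) (simp add: \<rho>)
  then obtain e1 where e1: "e1 > 0" "\<And>y. 0 < y \<Longrightarrow> y < e1 \<Longrightarrow> err y < \<rho>"
    by (auto simp: eventually_at_right_field)
  define \<epsilon> where "\<epsilon> = min 1 (e1 / 2)"
  have \<epsilon>: "0 < \<epsilon>" "\<epsilon> \<le> 1" "\<epsilon> < e1" using e1 by (auto simp: \<epsilon>_def)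
  define m where "m = (\<lambda>t. integral {0..\<epsilon>} (W t))"
  define m' where "m' = (\<lambda>t. \<i> / of_real k * integral {0..\<epsilon>} (\<lambda>y. of_real (f y) * \<Phi> t y))"
  have m': "(m has_vector_derivative m' t) (at t)" if "t > 0" for t
    unfolding m_def m'_def by (rule moment'[OF that \<epsilon>(1,2)])
  have m'_le: "norm (m' t + of_real (\<epsilon>\<^sup>2 / 2) * \<beta> / of_real t) \<le> \<epsilon>\<^sup>2 / 2 * (b / 2) / t" if t: "T1 \<le> t" "t \<le> T" for t
  proof -
    have t0: "t > 0" using t T1 by simp
    define A where "A = of_real (f 0) * V t 0 * of_real (k / g 0)"
    have id: "((\<lambda>y. y) has_integral \<epsilon>\<^sup>2 / 2) {0..\<epsilon>}" using ident_has_integral[of 0 \<epsilon>] \<epsilon> by simp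
    have fi: "(\<lambda>y. of_real (f y) * \<Phi> t y) integrable_on {0..\<epsilon>}"
      by (intro integrable_continuous_real continuous_intros continuous_on_subset[OF \<Phi>c[OF t0]] continuous_on_subset[OF fc])
        (use \<epsilon> in auto)
    have Ai: "((\<lambda>y. A * of_real y) has_integral A * of_real (\<epsilon>\<^sup>2 / 2)) {0..\<epsilon>}"
      by (intro has_integral_mult_right has_integral_of_real id)
    have "norm (integral {0..\<epsilon>} (\<lambda>y. of_real (f y) * \<Phi> t y - A * of_real y)) \<le> integral {0..\<epsilon>} (\<lambda>y. \<rho> * y)"
    proof (rule integral_norm_bound_integral)
      show "(\<lambda>y. of_real (f y) * \<Phi> t y - A * of_real y) integrable_on {0..\<epsilon>}"
        using fi Ai by (intro integrable_diff) auto
      show "(\<lambda>y. \<rho> * y) integrable_on {0..\<epsilon>}" using id by (intro integrable_on_mult_right) auto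
      fix y assume y: "y \<in> {0..\<epsilon>}"
      show "norm (of_real (f y) * \<Phi> t y - A * of_real y) \<le> \<rho> * y"
      proof (cases "y = 0")
        case False
        then have y: "0 < y" "y \<le> 1" "y < e1" using y \<epsilon> by auto
        have "norm (of_real (f y) * \<Phi> t y - A * of_real y) \<le> err y * y"
          using err[OF t0 t(2) y(1,2)] by (simp add: A_def mult.assoc)
        also have "\<dots> \<le> \<rho> * y" using e1(2)[of y] y by (intro mult_right_mono) auto
        finally show ?thesis .
      qed (use \<Phi>_bdry[OF t0] in simp)
    qed
    also have "integral {0..\<epsilon>} (\<lambda>y. \<rho> * y) = \<rho> * (\<epsilon>\<^sup>2 / 2)"
      by (intro integral_unique has_integral_mult_right id)
    also have "integral {0..\<epsilon>} (\<lambda>y. of_real (f y) * \<Phi> t y - A * of_real y)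
       = integral {0..\<epsilon>} (\<lambda>y. of_real (f y) * \<Phi> t y) - A * of_real (\<epsilon>\<^sup>2 / 2)"
      by (subst Henstock_Kurzweil_Integration.integral_diff[OF fi has_integral_integrable[OF Ai]])
        (simp only: integral_unique[OF Ai])
    finally have "norm (\<i> / of_real k) * norm (integral {0..\<epsilon>} (\<lambda>y. of_real (f y) * \<Phi> t y) - A * of_real (\<epsilon>\<^sup>2 / 2))
        \<le> norm (\<i> / of_real k :: complex) * (\<rho> * (\<epsilon>\<^sup>2 / 2))"
      by (rule mult_left_mono) simp
    then have 1: "norm (m' t - \<i> / of_real k * (A * of_real (\<epsilon>\<^sup>2 / 2))) \<le> \<epsilon>\<^sup>2 / 2 * (b / 4) / T"
      using k0 by (simp add: m'_def norm_mult[symmetric] right_diff_distrib) (simp add: norm_divide \<rho>_def field_simps)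
    have "\<i> / of_real k * (A * of_real (\<epsilon>\<^sup>2 / 2)) + of_real (\<epsilon>\<^sup>2 / 2) * \<beta> / of_real t
       = - of_real (\<epsilon>\<^sup>2 / 2 * (f 0 / g 0) / S 1 0 / t) * remainder t"
      using k0 t0 g0[of 0] S10 unfolding A_def V_asymptotics[OF t0] \<beta>_def
      by (simp add: field_simps power2_eq_square)
    then have "norm (\<i> / of_real k * (A * of_real (\<epsilon>\<^sup>2 / 2)) + of_real (\<epsilon>\<^sup>2 / 2) * \<beta> / of_real t)
        = \<bar>\<epsilon>\<^sup>2 / 2 * (f 0 / g 0) / S 1 0 / t\<bar> * norm (remainder t)"
      by (simp only: norm_mult norm_minus_cancel norm_of_real)
    also have "\<bar>\<epsilon>\<^sup>2 / 2 * (f 0 / g 0) / S 1 0 / t\<bar> = \<epsilon>\<^sup>2 / 2 * q / t"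
      using t0 by (simp add: abs_mult abs_divide q_def)
    also have "\<epsilon>\<^sup>2 / 2 * q / t * norm (remainder t) \<le> \<epsilon>\<^sup>2 / 2 * q / t * (b / (4 * q))"
      using T1(2)[OF t(1)] t0 q by (intro mult_left_mono) auto
    also have "\<dots> = \<epsilon>\<^sup>2 / 2 * (b / 4) / t" using q by simp
    finally have 2: "norm (\<i> / of_real k * (A * of_real (\<epsilon>\<^sup>2 / 2)) + of_real (\<epsilon>\<^sup>2 / 2) * \<beta> / of_real t) \<le> \<epsilon>\<^sup>2 / 2 * (b / 4) / t" .
    have 3: "\<epsilon>\<^sup>2 / 2 * (b / 4) / T \<le> \<epsilon>\<^sup>2 / 2 * (b / 4) / t"
      using t t0 b by (intro divide_left_mono mult_pos_pos) auto
    have "norm (m' t + of_real (\<epsilon>\<^sup>2 / 2) * \<beta> / of_real t) \<le> \<epsilon>\<^sup>2 / 2 * (b / 4) / T + \<epsilon>\<^sup>2 / 2 * (b / 4) / t"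
      using norm_triangle_mono[OF 1 2] by simp
    also have "\<dots> \<le> \<epsilon>\<^sup>2 / 2 * (b / 4) / t + \<epsilon>\<^sup>2 / 2 * (b / 4) / t" by (rule add_right_mono[OF 3])
    also have "\<dots> = \<epsilon>\<^sup>2 / 2 * (b / 2) / t" by (simp add: field_simps)
    finally show ?thesis .
  qed
  \<comment> \<open>The moment with its predicted logarithm removed; it moves at most half as fast
    as that logarithm, so the logarithm cannot be compensated.\<close>
  define D where "D = (\<lambda>t. m t + (\<epsilon>\<^sup>2 / 2 * ln t) *\<^sub>R \<beta>)"
  have D': "(D has_vector_derivative m' t + of_real (\<epsilon>\<^sup>2 / 2) * \<beta> / of_real t) (at t)" if "t > 0" for t
  proof -
    have "((\<lambda>t. \<epsilon>\<^sup>2 / 2 * ln t) has_real_derivative \<epsilon>\<^sup>2 / 2 / t) (at t)"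
      using that by (auto intro!: derivative_eq_intros)
    note d = has_vector_derivative_add[OF m'[OF that] has_vector_derivative_scaleR[OF this has_vector_derivative_const[of \<beta>]]]
    show ?thesis unfolding D_def
      by (rule has_vector_derivative_eq_rhs[OF d]) (simp add: scaleR_conv_of_real)
  qed
  have "norm (D T - D T1) \<le> \<epsilon>\<^sup>2 / 2 * (b / 2) * ln T - \<epsilon>\<^sup>2 / 2 * (b / 2) * ln T1"
  proof (rule differentiable_bound_general[OF T(1)])
    show "continuous_on {T1..T} D"
    proof (rule continuous_on_vector_derivative)
      fix t assume "t \<in> {T1..T}"
      then show "(D has_vector_derivative m' t + of_real (\<epsilon>\<^sup>2 / 2) * \<beta> / of_real t) (at t within {T1..T})"
        using T1 by (intro has_vector_derivative_at_within[OF D']) auto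
    qed
    show "continuous_on {T1..T} (\<lambda>t. \<epsilon>\<^sup>2 / 2 * (b / 2) * ln t)" using T1 by (intro continuous_intros) auto
    fix t assume t: "T1 < t" "t < T"
    show "(D has_vector_derivative m' t + of_real (\<epsilon>\<^sup>2 / 2) * \<beta> / of_real t) (at t)" using t T1 by (intro D') auto
    show "((\<lambda>t. \<epsilon>\<^sup>2 / 2 * (b / 2) * ln t) has_vector_derivative \<epsilon>\<^sup>2 / 2 * (b / 2) / t) (at t)"
      unfolding has_real_derivative_iff_has_vector_derivative[symmetric]
      using t T1 by (auto intro!: derivative_eq_intros)
    show "norm (m' t + of_real (\<epsilon>\<^sup>2 / 2) * \<beta> / of_real t) \<le> \<epsilon>\<^sup>2 / 2 * (b / 2) / t" using t by (intro m'_le) auto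
  qed
  then have up: "norm (D T - D T1) \<le> \<epsilon>\<^sup>2 / 2 * (b / 2) * L" by (simp add: L_def right_diff_distrib)
  \<comment> \<open>Boundary conservation keeps each moment within
    \<open>M * \<epsilon>\<^sup>2\<close> of the same number \<epsilon> w0, whatever the
    time.\<close>
  have mm: "norm (m T - m T1) \<le> 2 * M * \<epsilon>\<^sup>2"
  proof -
    have "norm (m t - of_real \<epsilon> * w0) \<le> M * \<epsilon>\<^sup>2" if "t > 0" for t
      using moment_trace[OF that \<epsilon>(1,2)] boundary_conservation[OF that] by (simp add: m_def)
    from this[OF T(2)] this[of T1] T1 show ?thesis
      using norm_triangle_ineq4[of "m T - of_real \<epsilon> * w0" "m T1 - of_real \<epsilon> * w0"] by simp
  qed
  have "(\<epsilon>\<^sup>2 / 2 * L) *\<^sub>R \<beta> = (D T - D T1) - (m T - m T1)"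
    by (simp add: D_def L_def right_diff_distrib scaleR_diff_left)
  then have "norm ((\<epsilon>\<^sup>2 / 2 * L) *\<^sub>R \<beta>) \<le> \<epsilon>\<^sup>2 / 2 * (b / 2) * L + 2 * M * \<epsilon>\<^sup>2"
    using norm_triangle_ineq4[of "D T - D T1" "m T - m T1"] up mm by simp
  moreover have "L > 0" using L M0 b by (simp add: add_nonneg_pos)
  ultimately have "\<epsilon>\<^sup>2 / 2 * L * b \<le> \<epsilon>\<^sup>2 / 2 * (b / 2) * L + 2 * M * \<epsilon>\<^sup>2" by (simp add: b_def)
  then have "\<epsilon>\<^sup>2 * (L * b) \<le> \<epsilon>\<^sup>2 * (8 * M)" by (simp add: field_simps)
  then have "L * b \<le> 8 * M" using \<epsilon> by simp
  moreover have "L * b = 8 * M + b" using b by (simp add: L field_simps)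
  ultimately show False using b by simp
qed

end

text \<open>The substitution \<open>y \<mapsto> 1 - y\<close> exchanges the two boundary points; it preserves the system
  if the signs of \<open>k\<close> and \<open>f\<close> are reversed.\<close>

lemma has_vector_derivative_reflect01:
  fixes F :: "real \<Rightarrow> 'a::real_normed_vector"
  assumes "(F has_vector_derivative D) (at (1 - y) within {0..1})"
  shows "((\<lambda>y. F (1 - y)) has_vector_derivative - D) (at y within {0..1})"
proof -
  have 1: "((\<lambda>y. 1 - y) has_vector_derivative - 1) (at y within {0..1::real})"
    by (auto intro!: derivative_eq_intros)
  have 2: "(\<lambda>y. 1 - y) ` {0..1} = {0..1::real}" by (auto simp: image_iff intro!: bexI[of _ "1 - _"])
  show ?thesis
    using vector_diff_chain_within[OF 1, of F D] assms by (simp add: o_def 2)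
qed

lemma (in shear_flow) shear_flow_reflect:
  "shear_flow (- k) (\<lambda>y. - f (1 - y)) (\<lambda>y. g (1 - y)) (\<lambda>t y. W t (1 - y)) (\<lambda>t y. - H t (1 - y))
     (\<lambda>t y. \<Phi> t (1 - y)) (\<lambda>t y. V t (1 - y)) M \<alpha>"
proof
  show "continuous_on {0..1} (\<lambda>y. - f (1 - y))"
    by (intro continuous_intros continuous_on_compose2[OF fc]) auto
  fix t y :: real
  show "((\<lambda>y. g (1 - y)) has_real_derivative - f (1 - y) / g (1 - y)) (at y within {0..1})" if "y \<in> {0..1}"
    using has_vector_derivative_reflect01[of g "f (1 - y) / g (1 - y)" y] g'[of "1 - y"] that
    by (simp add: has_real_derivative_iff_has_vector_derivative)
  assume t: "t > 0"
  show "\<Phi> t (1 - 0) = 0" "\<Phi> t (1 - 1) = 0" using \<Phi>_bdry[OF t] by auto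
  assume y: "y \<in> {0..1}"
  then have y': "1 - y \<in> {0..1}" by auto
  show "((\<lambda>y. W t (1 - y)) has_vector_derivative - H t (1 - y)) (at y within {0..1})"
    by (rule has_vector_derivative_reflect01[OF W'[OF t y']])
  show "norm (- H t (1 - y)) \<le> M" using H_bound[OF t y'] by simp
  show "((\<lambda>y. \<Phi> t (1 - y)) has_vector_derivative
      of_real (- k) * (V t (1 - y) / of_real (g (1 - y)) + \<i> * of_real t * \<Phi> t (1 - y))) (at y within {0..1})"
    using has_vector_derivative_reflect01[OF \<Phi>'[OF t y']] by simp
  show "((\<lambda>y. V t (1 - y)) has_vector_derivative
      of_real (- k) * ((W t (1 - y) + \<Phi> t (1 - y)) / of_real (g (1 - y)) + \<i> * of_real t * V t (1 - y))) (at y within {0..1})"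
    using has_vector_derivative_reflect01[OF V'[OF t y']] by simp
  fix x :: real assume x: "y \<in> {0..1}" "x \<in> {0..1}"
  show "norm (- H t (1 - x) - - H t (1 - y)) \<le> M * \<bar>x - y\<bar> powr \<alpha>"
    using H_Hoelder[OF t, of "1 - y" "1 - x"] x by (simp add: norm_minus_commute abs_minus_commute)
qed (use k0 g0 \<alpha> in auto)

lemma integral_reflect01:
  fixes F :: "real \<Rightarrow> 'a::euclidean_space"
  shows "integral {0..\<epsilon>} (\<lambda>y. F (1 - y)) = integral {1 - \<epsilon>..1} F"
proof -
  have "integral {- \<epsilon>.. - 0} (\<lambda>x. (\<lambda>y. F (1 - y)) (- x)) = integral {0..\<epsilon>} (\<lambda>y. F (1 - y))"
    by (rule Henstock_Kurzweil_Integration.integral_reflect_real)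
  moreover have "integral {- \<epsilon>..0} (\<lambda>x. F (x + 1)) = integral {- \<epsilon> + 1..0 + 1} F"
    using integral_shift_Icc_real[of "- \<epsilon>" 0 F 1] by (simp add: o_def add.commute)
  ultimately show ?thesis by (simp add: add.commute)
qed

section \<open>Classical representatives\<close>

lemma AE_leb01_negligible:
  assumes "AE x in leb01. P x"
  obtains N where "negligible N" "\<And>x. x \<in> {0..1} - N \<Longrightarrow> P x"
proof -
  have "AE x in lebesgue. x \<in> {0..1} \<longrightarrow> P x"
    using assms by (subst (asm) AE_restrict_space_iff) auto
  then show ?thesis using that by (auto simp: eventually_ae_filter_negligible)
qed

lemma integral_cong_AE_leb01:
  fixes u v :: "real \<Rightarrow> 'a::banach"
  assumes "AE x in leb01. u x = v x" and "{p..q} \<subseteq> {0..1}"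
  shows "integral {p..q} u = integral {p..q} v"
proof -
  obtain N where N: "negligible N" "\<And>x. x \<in> {0..1} - N \<Longrightarrow> u x = v x"
    using AE_leb01_negligible[OF assms(1)] by metis
  show ?thesis by (rule integral_spike[OF N(1)]) (use N(2) assms(2) in \<open>auto simp: subset_eq\<close>)
qed

lemma AE_eq_continuous_imp_eq:
  fixes u v :: "real \<Rightarrow> 'a::real_normed_vector"
  assumes "continuous_on {0..1} u" "continuous_on {0..1} v" "AE x in leb01. u x = v x" "y \<in> {0..1}"
  shows "u y = v y"
proof -
  define X where "X = {x \<in> {0..1}. u x = v x}"
  have "AE x in leb01. x \<in> X"
    using assms(3) AE_space by eventually_elim (auto simp: X_def space_restrict_space)
  then have cl: "closure X = {0..1}" by (intro AE_leb01_dense) (auto simp: X_def)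
  have "(\<lambda>x. u x - v x) y = 0"
  proof (rule continuous_constant_on_closure[where S=X])
    show "continuous_on (closure X) (\<lambda>x. u x - v x)" unfolding cl by (intro continuous_intros assms)
    show "y \<in> closure X" using assms(4) by (simp add: cl)
  qed (simp add: X_def)
  then show ?thesis by simp
qed

lemma weak_deriv_continuous_rep:
  fixes u v :: "real \<Rightarrow> 'a::euclidean_space"
  assumes "weak_deriv u v"
  obtains u1 where "continuous_on {0..1} u1" "AE x in leb01. u x = u1 x"
proof -
  obtain c where c: "AE y in leb01. u y = c + integral {0..y} v"
    using weak_deriv_imp_indefinite_integral[OF assms] by metis
  have "v integrable_on {0..1}" using assms by (auto simp: weak_deriv_def intro: integrable_on_lebesgue_on)
  then have "continuous_on {0..1} (\<lambda>y. c + integral {0..y} v)"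
    by (intro continuous_intros indefinite_integral_continuous_1)
  then show ?thesis using c that by metis
qed

lemma weak_deriv_C1_rep:
  fixes u v :: "real \<Rightarrow> 'a::euclidean_space"
  assumes wd: "weak_deriv u v" and v1: "continuous_on {0..1} v1" "AE x in leb01. v x = v1 x"
  obtains u1 where "AE x in leb01. u x = u1 x"
    "\<And>y. y \<in> {0..1} \<Longrightarrow> (u1 has_vector_derivative v1 y) (at y within {0..1})"
proof -
  obtain c where c: "AE y in leb01. u y = c + integral {0..y} v"
    using weak_deriv_imp_indefinite_integral[OF wd] by metis
  define u1 where "u1 = (\<lambda>y. c + integral {0..y} v1)"
  have "AE y in leb01. u y = u1 y"
    using c AE_space
  proof eventually_elim
    case (elim y)
    then have "integral {0..y} v = integral {0..y} v1"
      by (intro integral_cong_AE_leb01[OF v1(2)]) (auto simp: space_restrict_space)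
    then show ?case using elim by (simp add: u1_def)
  qed
  moreover have "(u1 has_vector_derivative v1 y) (at y within {0..1})" if "y \<in> {0..1}" for y
  proof -
    have "(u1 has_vector_derivative 0 + v1 y) (at y within {0..1})"
      unfolding u1_def
      by (intro has_vector_derivative_add has_vector_derivative_const integral_has_vector_derivative v1(1) that)
    then show ?thesis by simp
  qed
  ultimately show ?thesis using that by metis
qed

text \<open>A primitive of \<open>v1\<close> is one continuous representative, and continuous
  representatives agree at every point. So the given \<open>u1\<close> is itself C^1, which matters
  for the stream function with its prescribed boundary values.\<close>

lemma weak_deriv_continuous_C1:
  fixes u v :: "real \<Rightarrow> 'a::euclidean_space"
  assumes wd: "weak_deriv u v" and v1: "continuous_on {0..1} v1" "AE x in leb01. v x = v1 x"
    and u1: "continuous_on {0..1} u1" "AE x in leb01. u x = u1 x" and y: "y \<in> {0..1}"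
  shows "(u1 has_vector_derivative v1 y) (at y within {0..1})"
proof -
  obtain u2 where u2: "AE x in leb01. u x = u2 x"
    "\<And>y. y \<in> {0..1} \<Longrightarrow> (u2 has_vector_derivative v1 y) (at y within {0..1})"
    using weak_deriv_C1_rep[OF wd v1] by metis
  have ae: "AE x in leb01. u1 x = u2 x" using u1(2) u2(1) by eventually_elim simp
  have "continuous_on {0..1} u2" by (rule continuous_on_vector_derivative) (rule u2(2))
  then have "u1 x = u2 x" if "x \<in> {0..1}" for x
    using AE_eq_continuous_imp_eq[OF u1(1) _ ae that] by simp
  then show ?thesis by (rule has_vector_derivative_transform[OF y _ u2(2)[OF y]])
qed

text \<open>The chain rule and the derivative of the inverse function give g' = f/g at every point.
  Sobolev regularity only provides a continuous function equal to \<open>f\<close> almost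
  everywhere, while the values of \<open>f\<close> at the endpoints matter; the pointwise identity
  g' = f/g closes this gap.\<close>

lemma shear_profile_regular:
  fixes U U' U'' f g :: "real \<Rightarrow> real"
  assumes "a < b"
    and dU: "\<And>y. y \<in> {a..b} \<Longrightarrow> (U has_real_derivative U' y) (at y within {a..b})"
    and dU': "\<And>y. y \<in> {a..b} \<Longrightarrow> (U' has_real_derivative U'' y) (at y within {a..b})"
    and mono: "strict_mono_on {a..b} U \<or> strict_antimono_on {a..b} U"
    and img: "U ` {a..b} = {0..1}"
    and c: "c > 0" "\<And>y. y \<in> {a..b} \<Longrightarrow> (U' y)\<^sup>2 > c"
    and f: "f = (\<lambda>y. U'' (the_inv_into {a..b} U y))"
    and g: "g = (\<lambda>y. U' (the_inv_into {a..b} U y))"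
    and "W2inf f"
  shows "continuous_on {0..1} f"
    "\<And>y. y \<in> {0..1} \<Longrightarrow> (g has_real_derivative f y / g y) (at y within {0..1})"
    "\<And>y. y \<in> {0..1} \<Longrightarrow> g y \<noteq> 0"
proof -
  define I where "I = the_inv_into {a..b} U"
  have inj: "inj_on U {a..b}"
    using mono
  proof
    assume "strict_antimono_on {a..b} U"
    then have "U y < U x" if "x \<in> {a..b}" "y \<in> {a..b}" "x < y" for x y
      using that by (auto simp: monotone_on_def)
    then show ?thesis by (intro linorder_inj_onI) fastforce+
  qed (rule strict_mono_on_imp_inj_on)
  have IU: "I (U x) = x" if "x \<in> {a..b}" for x
    unfolding I_def by (rule the_inv_into_f_f[OF inj that])
  have I_in: "I y \<in> {a..b}" and UI: "U (I y) = y" if "y \<in> {0..1}" for y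
    using that f_the_inv_into_f[OF inj, of y] the_inv_into_into[OF inj, of y "{a..b}"] img by (auto simp: I_def)
  have I_img: "I ` {0..1} = {a..b}"
    using IU I_in by (auto simp flip: img simp: image_image)
  have U'nz: "U' x \<noteq> 0" if "x \<in> {a..b}" for x using c(2)[OF that] c(1) by auto
  have Uc: "continuous_on {a..b} U" using dU by (rule DERIV_continuous_on)
  have "continuous_on (U ` {a..b}) I" by (rule continuous_on_inv[OF Uc]) (use IU in auto)
  then have Ic: "continuous_on {0..1} I" by (simp add: img)
  have dI: "(I has_real_derivative 1 / U' (I y)) (at y within {0..1})" if y: "y \<in> {0..1}" for y
  proof -
    have "(I has_derivative (*) (1 / U' (I y))) (at (U (I y)) within U ` {a..b})"
    proof (rule has_derivative_inverse_within)
      show "(U has_derivative (*) (U' (I y))) (at (I y) within {a..b})"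
        using dU[OF I_in[OF y]] by (simp add: has_field_derivative_def)
      show "continuous (at (U (I y)) within U ` {a..b}) I"
        using Ic y by (simp add: UI img continuous_on_eq_continuous_within)
      show "linear ((*) (1 / U' (I y)))" by (rule linear_times)
      show "(*) (1 / U' (I y)) \<circ> (*) (U' (I y)) = id" using U'nz[OF I_in[OF y]] by (auto simp: fun_eq_iff)
    qed (use I_in[OF y] IU in auto)
    then show ?thesis by (simp add: has_field_derivative_def UI[OF y] img)
  qed
  show g0: "g y \<noteq> 0" if "y \<in> {0..1}" for y
    using U'nz[OF I_in[OF that]] by (simp add: g I_def)
  show g': "(g has_real_derivative f y / g y) (at y within {0..1})" if y: "y \<in> {0..1}" for y
  proof -
    have "(U' \<circ> I has_real_derivative U'' (I y) * (1 / U' (I y))) (at y within {0..1})"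
      by (rule DERIV_image_chain[OF _ dI[OF y]]) (use dU'[OF I_in[OF y]] in \<open>simp add: I_img\<close>)
    then show ?thesis by (simp add: f g I_def o_def)
  qed
  have gc: "continuous_on {0..1} g" using g' by (rule DERIV_continuous_on)
  obtain f' where "weak_deriv f f'" using \<open>W2inf f\<close> by (auto simp: W2inf_def)
  then obtain f1 where f1: "continuous_on {0..1} f1" "AE x in leb01. f x = f1 x"
    using weak_deriv_continuous_rep by metis
  have f1g: "continuous_on {0..1} (\<lambda>y. f1 y / g y)" by (intro continuous_intros f1 gc) (use g0 in auto)
  have ae: "AE x in leb01. f x / g x = f1 x / g x" using f1(2) by eventually_elim simp
  \<comment> \<open>\<open>g\<close> is the integral of f/g, hence of the continuous f1/g, and so
    has derivative f1/g everywhere. As f/g is also its derivative, the two agree at every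
    point.\<close>
  have eq: "f y = f1 y" if y: "y \<in> {0..1}" for y
  proof -
    have geq: "g x = g 0 + integral {0..x} (\<lambda>y. f1 y / g y)" if x: "x \<in> {0..1}" for x
    proof -
      have "((\<lambda>y. f y / g y) has_integral g x - g 0) {0..x}"
      proof (rule fundamental_theorem_of_calculus)
        fix s assume "s \<in> {0..x}"
        then have "(g has_real_derivative f s / g s) (at s within {0..x})"
          using x by (intro DERIV_subset[OF g']) auto
        then show "(g has_vector_derivative f s / g s) (at s within {0..x})"
          by (simp add: has_real_derivative_iff_has_vector_derivative)
      qed (use x in auto)
      then have "integral {0..x} (\<lambda>y. f y / g y) = g x - g 0" by (rule integral_unique)
      moreover have "integral {0..x} (\<lambda>y. f y / g y) = integral {0..x} (\<lambda>y. f1 y / g y)"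
        by (rule integral_cong_AE_leb01[OF ae]) (use x in auto)
      ultimately show ?thesis by simp
    qed
    have "((\<lambda>x. g 0 + integral {0..x} (\<lambda>y. f1 y / g y)) has_vector_derivative 0 + f1 y / g y) (at y within {0..1})"
      by (intro has_vector_derivative_add has_vector_derivative_const integral_has_vector_derivative f1g y)
    from has_vector_derivative_transform[OF y geq this]
    have "(g has_vector_derivative f1 y / g y) (at y within {0..1})" by simp
    moreover have "(g has_vector_derivative f y / g y) (at y within {0..1})"
      using g'[OF y] by (simp add: has_real_derivative_iff_has_vector_derivative)
    ultimately have "f1 y / g y = f y / g y"
      using vector_derivative_unique_within_closed_interval[of 0 1 y g "f1 y / g y" "f y / g y"] y
      by (simp add: cbox_interval)
    then show ?thesis using g0[OF y] by simp
  qed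
  show "continuous_on {0..1} f"
    using f1(1) by (rule continuous_on_eq) (simp add: eq)
qed

text \<open>Having a weak derivative, the auxiliary function has a continuous representative
  \<open>V\<close>. Solving the two relations for the derivatives of \<open>\<Phi>\<close> and
  \<open>V\<close> then gives continuous right-hand sides, so both are C^1.\<close>

lemma stream_function_classical:
  assumes k: "k \<noteq> 0" and gc: "continuous_on {0..1} g" and g0: "\<And>y. y \<in> {0..1} \<Longrightarrow> g y \<noteq> 0"
    and sf: "stream_function k g t w \<Phi>" and w1: "continuous_on {0..1} w1" "AE y in leb01. w y = w1 y"
  obtains V where
    "\<And>y. y \<in> {0..1} \<Longrightarrow> (\<Phi> has_vector_derivative
      of_real k * (V y / of_real (g y) + \<i> * of_real t * \<Phi> y)) (at y within {0..1})"
    "\<And>y. y \<in> {0..1} \<Longrightarrow> (V has_vector_derivative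
      of_real k * ((w1 y + \<Phi> y) / of_real (g y) + \<i> * of_real t * V y)) (at y within {0..1})"
proof -
  obtain \<Phi>' V0 V0' where \<Phi>c: "continuous_on {0..1} \<Phi>" and wd1: "weak_deriv \<Phi> \<Phi>'"
    and V0: "V0 = (\<lambda>y. of_real (g y) * (\<Phi>' y / of_real k - \<i> * of_real t * \<Phi> y))"
    and wd2: "weak_deriv V0 V0'"
    and eq: "AE y in leb01. - \<Phi> y + of_real (g y) * (V0' y / of_real k - \<i> * of_real t * V0 y) = w y"
    using sf unfolding stream_function_def by (elim conjE exE) (rule that, assumption+)
  obtain V where V: "continuous_on {0..1} V" "AE x in leb01. V0 x = V x"
    using weak_deriv_continuous_rep[OF wd2] by metis
  have sp: "AE y in leb01. y \<in> {0..1}" using AE_space by eventually_elim (simp add: space_restrict_space)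
  show ?thesis
  proof (rule that[of V])
    fix y :: real assume y: "y \<in> {0..1}"
    show "(\<Phi> has_vector_derivative of_real k * (V y / of_real (g y) + \<i> * of_real t * \<Phi> y)) (at y within {0..1})"
    proof (rule weak_deriv_continuous_C1[OF wd1 _ _ \<Phi>c _ y])
      show "continuous_on {0..1} (\<lambda>y. of_real k * (V y / of_real (g y) + \<i> * of_real t * \<Phi> y))"
        by (intro continuous_intros V \<Phi>c gc) (use g0 in auto)
      show "AE y in leb01. \<Phi>' y = of_real k * (V y / of_real (g y) + \<i> * of_real t * \<Phi> y)"
        using V(2) sp
      proof eventually_elim
        case (elim y)
        then show ?case using g0[of y] k unfolding V0 by (simp add: field_simps)
      qed
    qed simp
    show "(V has_vector_derivative of_real k * ((w1 y + \<Phi> y) / of_real (g y) + \<i> * of_real t * V y)) (at y within {0..1})"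
    proof (rule weak_deriv_continuous_C1[OF wd2 _ _ V y])
      show "continuous_on {0..1} (\<lambda>y. of_real k * ((w1 y + \<Phi> y) / of_real (g y) + \<i> * of_real t * V y))"
        by (intro continuous_intros V \<Phi>c gc w1) (use g0 in auto)
      show "AE y in leb01. V0' y = of_real k * ((w1 y + \<Phi> y) / of_real (g y) + \<i> * of_real t * V y)"
        using V(2) sp eq w1(2)
      proof eventually_elim
        case (elim y)
        have "w1 y + \<Phi> y = of_real (g y) * (V0' y / of_real k - \<i> * of_real t * V y)"
          using elim by (simp add: algebra_simps)
        then show ?case using g0[of y] k elim by (simp add: field_simps)
      qed
    qed
  qed
qed

section \<open>Regularity of the Euler solution\<close>

lemma ennsqrt_leD:
  assumes "ennsqrt x \<le> ennreal e" "e \<ge> 0"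
  shows "x \<le> ennreal (e\<^sup>2)"
proof (cases x)
  case (real r)
  then have "sqrt r \<le> e" using assms by (simp add: ennsqrt_def)
  then have "(sqrt r)\<^sup>2 \<le> e\<^sup>2" using real by (intro power_mono) auto
  then show ?thesis using real by (simp add: ennreal_leI)
next
  case top
  then show ?thesis using assms by (simp add: ennsqrt_def top_unique)
qed

lemma L2_norm_finite_integrable:
  assumes "L2_norm u < \<infinity>"
  shows "integrable leb01 u"
proof -
  obtain e where "L2_norm u = ennreal e" "e \<ge> 0" using assms by (cases "L2_norm u") auto
  then have "L2_sq u \<le> ennreal (e\<^sup>2)" by (intro ennsqrt_leD) (auto simp: L2_norm_def)
  then show ?thesis by (rule L2_sq_boundD(3))
qed

lemma integral_norm_le_L2_norm:
  assumes "L2_norm u \<le> ennreal e" "e \<ge> 0" "0 \<le> p" "q \<le> 1"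
  shows "norm (integral {p..q} u) \<le> e"
proof -
  have L: "L2_sq u \<le> ennreal (e\<^sup>2)" using assms by (intro ennsqrt_leD) (auto simp: L2_norm_def)
  note u = L2_sq_boundD[OF L]
  have ui: "u integrable_on {0..1}" and nui: "(\<lambda>y. norm (u y)) integrable_on {0..1}"
    using u(3) by (auto intro!: integrable_on_lebesgue_on)
  have "norm (integral {p..q} u) \<le> integral {p..q} (\<lambda>y. norm (u y))"
    using assms by (intro integral_norm_bound_integral integrable_on_subIcc[OF ui] integrable_on_subIcc[OF nui]) auto
  also have "\<dots> \<le> integral {0..1} (\<lambda>y. norm (u y))"
    using assms by (intro integral_subset_le integrable_on_subIcc[OF nui] nui) auto
  also have "\<dots> \<le> sqrt ((1 - 0) * e\<^sup>2)"
    by (rule integral_norm_le_L2[OF u(1) _ _ u(2)]) auto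
  finally show ?thesis using assms by simp
qed

text \<open>Integration over \<open>{p..q}\<close> is a bounded linear functional on L^2, so it
  commutes with the L^2 limit of the difference quotients.\<close>

lemma euler_moment_derivative:
  assumes es: "euler_solution k f g \<omega>0 W \<Phi>" and fc: "continuous_on {0..1} f" and k: "k \<noteq> 0"
    and pq: "0 \<le> p" "q \<le> 1"
  shows "((\<lambda>t. integral {p..q} (W t)) has_vector_derivative
           \<i> / of_real k * integral {p..q} (\<lambda>y. of_real (f y) * \<Phi> t y)) (at t)"
proof -
  define D where "D = (\<lambda>h y. (W (t + h) y - W t y) / of_real h - \<i> * of_real (f y) / of_real k * \<Phi> t y)"
  define d where "d = \<i> / of_real k * integral {p..q} (\<lambda>y. of_real (f y) * \<Phi> t y)"
  have fin: "\<And>t. L2_norm (W t) < \<infinity>" and sf: "stream_function k g t (W t) (\<Phi> t)"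
    and lim: "((\<lambda>h. L2_norm (D h)) \<longlongrightarrow> 0) (at 0)"
    using es by (auto simp: euler_solution_def D_def)
  have \<Phi>c: "continuous_on {0..1} (\<Phi> t)" using sf by (simp add: stream_function_def)
  have Wi: "W s integrable_on {p..q}" for s
  proof (rule integrable_on_subIcc[where a=0 and b=1])
    show "W s integrable_on {0..1}" using L2_norm_finite_integrable[OF fin, of s] by (rule integrable_on_lebesgue_on) simp
  qed (use pq in auto)
  have f\<Phi>c: "continuous_on {p..q} (\<lambda>y. of_real (f y) * \<Phi> t y)"
    by (intro continuous_intros continuous_on_subset[OF \<Phi>c] continuous_on_subset[OF fc]) (use pq in auto)
  have ident: "integral {p..q} (W (t + h)) - integral {p..q} (W t) - h *\<^sub>R d = of_real h * integral {p..q} (D h)"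
    if "h \<noteq> 0" for h
  proof -
    have "((\<lambda>y. inverse (of_real h) * (W (t + h) y - W t y) - \<i> / of_real k * (of_real (f y) * \<Phi> t y))
        has_integral inverse (of_real h) * (integral {p..q} (W (t + h)) - integral {p..q} (W t)) - d) {p..q}"
      unfolding d_def
      by (intro has_integral_diff has_integral_mult_right integrable_integral Wi integrable_continuous_real f\<Phi>c)
    moreover have "(\<lambda>y. inverse (of_real h) * (W (t + h) y - W t y) - \<i> / of_real k * (of_real (f y) * \<Phi> t y)) = D h"
      by (simp add: D_def fun_eq_iff divide_inverse mult_ac)
    ultimately have "integral {p..q} (D h) = inverse (of_real h) * (integral {p..q} (W (t + h)) - integral {p..q} (W t)) - d"
      by (simp add: integral_unique)
    then show ?thesis using that by (simp add: scaleR_conv_of_real field_simps)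
  qed
  have "((\<lambda>h. norm (integral {p..q} (W (t + h)) - integral {p..q} (W t) - h *\<^sub>R d) / norm h) \<longlongrightarrow> 0) (at 0)"
  proof (rule tendstoI)
    fix e :: real assume e: "e > 0"
    have "\<forall>\<^sub>F h in at 0. L2_norm (D h) < ennreal (e / 2)"
      by (rule order_tendstoD(2)[OF lim]) (use e in simp)
    moreover have "\<forall>\<^sub>F h in at 0. h \<noteq> (0::real)" by (simp add: eventually_at_filter)
    ultimately show "\<forall>\<^sub>F h in at 0. dist (norm (integral {p..q} (W (t + h)) - integral {p..q} (W t) - h *\<^sub>R d) / norm h) 0 < e"
    proof eventually_elim
      case (elim h)
      have "norm (integral {p..q} (D h)) \<le> e / 2"
        by (rule integral_norm_le_L2_norm) (use elim e pq in auto)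
      moreover have "norm (integral {p..q} (W (t + h)) - integral {p..q} (W t) - h *\<^sub>R d) / norm h = norm (integral {p..q} (D h))"
        unfolding ident[OF elim(2)] using elim(2) by (simp add: norm_mult)
      ultimately show ?case using e by simp
    qed
  qed
  then show ?thesis
    unfolding has_vector_derivative_def has_derivative_at d_def[symmetric]
    by (simp add: bounded_linear_scaleR_left)
qed

text \<open>\<open>m\<close> is the moment of the given L^2 solution and makes sense at t = 0 too,
  whereas the representatives in the locale satisfy the equations for t > 0. Continuity of
  \<open>m\<close> at 0, a consequence of \<open>der\<close>, supplies the initial limits.\<close>

lemma (in shear_flow) boundary_product_zeroI:
  fixes m :: "real \<Rightarrow> real \<Rightarrow> complex"
  assumes m_eq: "\<And>t \<epsilon>. t > 0 \<Longrightarrow> 0 < \<epsilon> \<Longrightarrow> \<epsilon> \<le> 1 \<Longrightarrow> m t \<epsilon> = integral {0..\<epsilon>} (W t)"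
    and der: "\<And>t \<epsilon>. 0 < \<epsilon> \<Longrightarrow> \<epsilon> \<le> 1 \<Longrightarrow> ((\<lambda>t. m t \<epsilon>) has_vector_derivative
        \<i> / of_real k * integral {0..\<epsilon>} (\<lambda>y. of_real (f y) * \<Phi> t y)) (at t)"
    and trace: "((\<lambda>\<epsilon>. m 0 \<epsilon> / of_real \<epsilon>) \<longlongrightarrow> w0) (at_right 0)"
  shows "f 0 = 0 \<or> w0 = 0"
proof -
  interpret endpoint_flow k f g W H \<Phi> V M \<alpha> "m 0" w0
  proof
    fix t \<epsilon> :: real assume \<epsilon>: "0 < \<epsilon>" "\<epsilon> \<le> 1"
    have "isCont (\<lambda>t. m t \<epsilon>) 0" by (rule has_vector_derivative_continuous[OF der[OF \<epsilon>]])
    then have "((\<lambda>t. m t \<epsilon>) \<longlongrightarrow> m 0 \<epsilon>) (at_right 0)"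
      unfolding isCont_def by (rule filterlim_mono) (auto simp: at_le)
    moreover have "\<forall>\<^sub>F t in at_right 0. m t \<epsilon> = integral {0..\<epsilon>} (W t)"
      by (auto simp: eventually_at_filter m_eq \<epsilon>)
    ultimately show "((\<lambda>t. integral {0..\<epsilon>} (W t)) \<longlongrightarrow> m 0 \<epsilon>) (at_right 0)" by (rule Lim_transform_eventually)
    assume t: "t > 0"
    show "((\<lambda>t. integral {0..\<epsilon>} (W t)) has_vector_derivative
        \<i> / of_real k * integral {0..\<epsilon>} (\<lambda>y. of_real (f y) * \<Phi> t y)) (at t)"
      by (rule has_vector_derivative_transform_within_open[OF der[OF \<epsilon>], where S="{0<..}"])
        (use t \<epsilon> m_eq in auto)
  qed (rule trace)
  show ?thesis by (rule boundary_product_zero)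
qed

lemma right_difference_quotient:
  fixes G :: "real \<Rightarrow> complex"
  assumes "(G has_vector_derivative D) (at 0 within {0..1})"
  shows "((\<lambda>\<epsilon>. (G \<epsilon> - G 0) / of_real \<epsilon>) \<longlongrightarrow> D) (at_right 0)"
proof -
  have at: "at 0 within {0..1} = at_right (0::real)" by (rule at_within_Icc_at_right) simp
  have "((\<lambda>y. (1 / norm (y - 0)) *\<^sub>R (G y - (G 0 + (y - 0) *\<^sub>R D))) \<longlongrightarrow> 0) (at_right 0)"
    using assms unfolding has_vector_derivative_def has_derivative_within at by simp
  moreover have "\<forall>\<^sub>F y in at_right 0. (1 / norm (y - 0)) *\<^sub>R (G y - (G 0 + (y - 0) *\<^sub>R D)) = (G y - G 0) / of_real y - D"
    unfolding eventually_at_filter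
    by (rule always_eventually) (auto simp: scaleR_conv_of_real field_simps)
  ultimately have "((\<lambda>\<epsilon>. (G \<epsilon> - G 0) / of_real \<epsilon> - D) \<longlongrightarrow> 0) (at_right 0)"
    by (rule Lim_transform_eventually)
  then show ?thesis by (rule LIM_zero_cancel)
qed

text \<open>The common core of both parts, free of Sobolev norms: each passes to it by producing
  representatives with one \<open>M\<close> and one \<open>\<alpha>\<close> for all t > 0.\<close>

lemma no_uniform_Hoelder_bound:
  fixes \<omega>0 :: "real \<Rightarrow> complex"
  assumes k: "k \<noteq> 0" and fc: "continuous_on {0..1} f"
    and g': "\<And>y. y \<in> {0..1} \<Longrightarrow> (g has_real_derivative f y / g y) (at y within {0..1})"
    and g0: "\<And>y. y \<in> {0..1} \<Longrightarrow> g y \<noteq> 0"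
    and es: "euler_solution k f g \<omega>0 W \<Phi>"
    and cont: "continuous (at 0 within {0..1}) \<omega>0" "continuous (at 1 within {0..1}) \<omega>0"
    and reg: "\<And>t. t > 0 \<Longrightarrow> \<exists>Wy H. weak_deriv (W t) Wy \<and> (AE x in leb01. Wy x = H x) \<and>
      (\<forall>x\<in>{0..1}. norm (H x) \<le> M) \<and> (\<forall>x\<in>{0..1}. \<forall>y\<in>{0..1}. norm (H x - H y) \<le> M * \<bar>x - y\<bar> powr \<alpha>)"
    and \<alpha>: "\<alpha> > 0"
  shows "(f 0 = 0 \<or> \<omega>0 0 = 0) \<and> (f 1 = 0 \<or> \<omega>0 1 = 0)"
proof -
  have gc: "continuous_on {0..1} g" using g' by (rule DERIV_continuous_on)
  \<comment> \<open>The representatives of \<open>W t\<close>, its derivative and \<open>V\<close>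
    are tied together by the equations, so they are chosen as a triple, for all t at once.\<close>
  define P where "P = (\<lambda>t (w, H, V). (AE x in leb01. W t x = w x) \<and>
      (\<forall>y\<in>{0..1}. (w has_vector_derivative H y) (at y within {0..1})) \<and>
      (\<forall>x\<in>{0..1}. norm (H x) \<le> M) \<and> (\<forall>x\<in>{0..1}. \<forall>y\<in>{0..1}. norm (H x - H y) \<le> M * \<bar>x - y\<bar> powr \<alpha>) \<and>
      (\<forall>y\<in>{0..1}. (\<Phi> t has_vector_derivative
        of_real k * (V y / of_real (g y) + \<i> * of_real t * \<Phi> t y)) (at y within {0..1})) \<and>
      (\<forall>y\<in>{0..1}. (V has_vector_derivative
        of_real k * ((w y + \<Phi> t y) / of_real (g y) + \<i> * of_real t * V y)) (at y within {0..1})))"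
  have "\<exists>x. t > 0 \<longrightarrow> P t x" for t
  proof (cases "t > 0")
    case True
    obtain Wy H where H: "weak_deriv (W t) Wy" "AE x in leb01. Wy x = H x" "\<forall>x\<in>{0..1}. norm (H x) \<le> M"
      "\<forall>x\<in>{0..1}. \<forall>y\<in>{0..1}. norm (H x - H y) \<le> M * \<bar>x - y\<bar> powr \<alpha>"
      using reg[OF True] by blast
    have "continuous_on {0..1} H"
      unfolding continuous_on_def
    proof
      fix x :: real assume x: "x \<in> {0..1}"
      have "((\<lambda>y. M * \<bar>y - x\<bar> powr \<alpha>) \<longlongrightarrow> M * \<bar>x - x\<bar> powr \<alpha>) (at x within {0..1})"
        by (intro tendsto_intros tendsto_powr') (use \<alpha> in auto)
      then have l: "((\<lambda>y. M * \<bar>y - x\<bar> powr \<alpha>) \<longlongrightarrow> 0) (at x within {0..1})" by simp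
      have "((\<lambda>y. H y - H x) \<longlongrightarrow> 0) (at x within {0..1})"
        by (rule Lim_null_comparison[OF _ l]) (use H(4) x in \<open>auto simp: eventually_at_filter intro!: always_eventually\<close>)
      then show "(H \<longlongrightarrow> H x) (at x within {0..1})" by (rule LIM_zero_cancel)
    qed
    then obtain w where w: "AE x in leb01. W t x = w x"
      "\<And>y. y \<in> {0..1} \<Longrightarrow> (w has_vector_derivative H y) (at y within {0..1})"
      using weak_deriv_C1_rep[OF H(1) _ H(2)] by metis
    have wc: "continuous_on {0..1} w" by (rule continuous_on_vector_derivative) (rule w(2))
    have sf: "stream_function k g t (W t) (\<Phi> t)" using es by (simp add: euler_solution_def)
    have "\<exists>x. P t x"
    proof (rule stream_function_classical[OF k gc _ sf wc w(1)])
      fix V assume "\<And>y. y \<in> {0..1} \<Longrightarrow> (\<Phi> t has_vector_derivative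
          of_real k * (V y / of_real (g y) + \<i> * of_real t * \<Phi> t y)) (at y within {0..1})"
        "\<And>y. y \<in> {0..1} \<Longrightarrow> (V has_vector_derivative
          of_real k * ((w y + \<Phi> t y) / of_real (g y) + \<i> * of_real t * V y)) (at y within {0..1})"
      then have "P t (w, H, V)" unfolding P_def using w H(3,4) by simp
      then show ?thesis by blast
    qed (rule g0)
    then show ?thesis by blast
  qed simp
  then obtain X where X: "\<And>t. t > 0 \<Longrightarrow> P t (X t)" by metis
  define Wf where "Wf = (\<lambda>t. fst (X t))"
  define H where "H = (\<lambda>t. fst (snd (X t)))"
  define V where "V = (\<lambda>t. snd (snd (X t)))"
  have P: "P t (Wf t, H t, V t)" if "t > 0" for t using X[OF that] by (simp add: Wf_def H_def V_def)
  have Wf: "AE x in leb01. W t x = Wf t x" if "t > 0" for t using P[OF that] by (simp add: P_def)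
  interpret flow: shear_flow k f g Wf H \<Phi> V M \<alpha>
  proof
    fix t :: real assume t: "t > 0"
    show "\<Phi> t 0 = 0" "\<Phi> t 1 = 0" using es by (auto simp: euler_solution_def stream_function_def)
    fix y :: real assume y: "y \<in> {0..1}"
    show "(Wf t has_vector_derivative H t y) (at y within {0..1})" "norm (H t y) \<le> M"
      "(\<Phi> t has_vector_derivative of_real k * (V t y / of_real (g y) + \<i> * of_real t * \<Phi> t y)) (at y within {0..1})"
      "(V t has_vector_derivative of_real k * ((Wf t y + \<Phi> t y) / of_real (g y) + \<i> * of_real t * V t y)) (at y within {0..1})"
      using P[OF t] y by (simp_all add: P_def)
    fix x :: real assume "y \<in> {0..1}" "x \<in> {0..1}"
    then show "norm (H t y - H t x) \<le> M * \<bar>y - x\<bar> powr \<alpha>" using P[OF t] by (simp add: P_def)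
  qed (use k fc g' g0 \<alpha> in auto)
  have ae0: "AE y in leb01. W 0 y = \<omega>0 y" and W0: "integrable leb01 (W 0)"
    using es L2_norm_finite_integrable by (auto simp: euler_solution_def)
  have W0i: "W 0 integrable_on {0..1}" using W0 by (auto intro: integrable_on_lebesgue_on)
  obtain N where N: "negligible N" "\<And>x. x \<in> {0..1} - N \<Longrightarrow> W 0 x = \<omega>0 x"
    using AE_leb01_negligible[OF ae0] by metis
  have \<omega>i: "\<omega>0 integrable_on {0..1}" by (rule integrable_spike[OF W0i N(1)]) (use N(2) in auto)
  \<comment> \<open>Continuity of \<open>\<omega>0\<close> at an endpoint makes its primitive
    differentiable there; the initial trace is this one-sided derivative.\<close>
  define G where "G = (\<lambda>u. integral {0..u} \<omega>0)"
  have G': "(G has_vector_derivative \<omega>0 x) (at x within {0..1})" if "x \<in> {0..1}" "continuous (at x within {0..1}) \<omega>0" for x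
    using integral_has_vector_derivative_continuous_at[OF \<omega>i, of x "{}"] that by (simp add: G_def)
  have GW: "integral {p..q} (W 0) = integral {p..q} \<omega>0" if "0 \<le> p" "q \<le> 1" for p q
    by (rule integral_cong_AE_leb01[OF ae0]) (use that in auto)
  have left: "f 0 = 0 \<or> \<omega>0 0 = 0"
  proof (rule flow.boundary_product_zeroI[where m="\<lambda>t \<epsilon>. integral {0..\<epsilon>} (W t)"])
    fix t \<epsilon> :: real assume \<epsilon>: "0 < \<epsilon>" "\<epsilon> \<le> 1"
    show "((\<lambda>t. integral {0..\<epsilon>} (W t)) has_vector_derivative
        \<i> / of_real k * integral {0..\<epsilon>} (\<lambda>y. of_real (f y) * \<Phi> t y)) (at t)"
      by (rule euler_moment_derivative[OF es fc k]) (use \<epsilon> in auto)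
    assume t: "t > 0"
    show "integral {0..\<epsilon>} (W t) = integral {0..\<epsilon>} (Wf t)"
      by (rule integral_cong_AE_leb01[OF Wf[OF t]]) (use \<epsilon> in auto)
  next
    have "((\<lambda>\<epsilon>. (G \<epsilon> - G 0) / of_real \<epsilon>) \<longlongrightarrow> \<omega>0 0) (at_right 0)"
      by (rule right_difference_quotient[OF G']) (use cont in auto)
    moreover have "\<forall>\<^sub>F \<epsilon> in at_right 0. (G \<epsilon> - G 0) / of_real \<epsilon> = integral {0..\<epsilon>} (W 0) / of_real \<epsilon>"
      using eventually_at_right_real[OF zero_less_one] by eventually_elim (simp add: G_def GW)
    ultimately show "((\<lambda>\<epsilon>. integral {0..\<epsilon>} (W 0) / of_real \<epsilon>) \<longlongrightarrow> \<omega>0 0) (at_right 0)"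
      by (rule Lim_transform_eventually)
  qed
  interpret refl: shear_flow "- k" "\<lambda>y. - f (1 - y)" "\<lambda>y. g (1 - y)" "\<lambda>t y. Wf t (1 - y)" "\<lambda>t y. - H t (1 - y)"
     "\<lambda>t y. \<Phi> t (1 - y)" "\<lambda>t y. V t (1 - y)" M \<alpha>
    by (rule flow.shear_flow_reflect)
  \<comment> \<open>Moments of the reflected solution over \<open>{0..\<epsilon>}\<close> are
    moments of \<open>W\<close> over \<open>{1 - \<epsilon>..1}\<close>; the sign changes of k and f
    cancel in their evolution.\<close>
  have "- f (1 - 0) = 0 \<or> \<omega>0 1 = 0"
  proof (rule refl.boundary_product_zeroI[where m="\<lambda>t \<epsilon>. integral {1 - \<epsilon>..1} (W t)"])
    fix t \<epsilon> :: real assume \<epsilon>: "0 < \<epsilon>" "\<epsilon> \<le> 1"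
    have "integral {0..\<epsilon>} (\<lambda>y. of_real (- f (1 - y)) * \<Phi> t (1 - y)) = integral {1 - \<epsilon>..1} (\<lambda>y. of_real (- f y) * \<Phi> t y)"
      by (rule integral_reflect01)
    also have "\<dots> = - integral {1 - \<epsilon>..1} (\<lambda>y. of_real (f y) * \<Phi> t y)"
      by (simp add: Henstock_Kurzweil_Integration.integral_neg)
    finally show "((\<lambda>t. integral {1 - \<epsilon>..1} (W t)) has_vector_derivative
        \<i> / of_real (- k) * integral {0..\<epsilon>} (\<lambda>y. of_real (- f (1 - y)) * \<Phi> t (1 - y))) (at t)"
      using euler_moment_derivative[OF es fc k, of "1 - \<epsilon>" 1 t] \<epsilon> by simp
    assume t: "t > 0"
    have "integral {1 - \<epsilon>..1} (W t) = integral {1 - \<epsilon>..1} (Wf t)"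
      by (rule integral_cong_AE_leb01[OF Wf[OF t]]) (use \<epsilon> in auto)
    then show "integral {1 - \<epsilon>..1} (W t) = integral {0..\<epsilon>} (\<lambda>y. Wf t (1 - y))"
      by (simp only: integral_reflect01)
  next
    have "((\<lambda>y. G (1 - y)) has_vector_derivative - \<omega>0 1) (at 0 within {0..1})"
      by (rule has_vector_derivative_reflect01) (use G'[of 1] cont in simp)
    from tendsto_minus[OF right_difference_quotient[OF this]]
    have "((\<lambda>\<epsilon>. - ((G (1 - \<epsilon>) - G 1) / of_real \<epsilon>)) \<longlongrightarrow> \<omega>0 1) (at_right 0)" by simp
    moreover have "\<forall>\<^sub>F \<epsilon> in at_right 0. - ((G (1 - \<epsilon>) - G 1) / of_real \<epsilon>) = integral {1 - \<epsilon>..1} (W 0) / of_real \<epsilon>"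
      using eventually_at_right_real[OF zero_less_one]
    proof eventually_elim
      case (elim \<epsilon>)
      then have "G 1 - G (1 - \<epsilon>) = integral {1 - \<epsilon>..1} (W 0)"
        using integral_diff_Icc[OF \<omega>i, of "1 - \<epsilon>" 1] GW[of "1 - \<epsilon>" 1] by (simp add: G_def)
      then show ?case by (metis minus_diff_eq minus_divide_left)
    qed
    ultimately show "((\<lambda>\<epsilon>. integral {1 - \<epsilon>..1} (W 0) / of_real \<epsilon>) \<longlongrightarrow> \<omega>0 1) (at_right 0)"
      by (rule Lim_transform_eventually)
  qed
  then show ?thesis using left by simp
qed

section \<open>From finite Sobolev norms to representatives\<close>

lemma L2_sq_le_Hs_sq: "L2_sq u \<le> Hs_sq \<sigma> m u"
proof (induction m arbitrary: u)
  case (Suc m)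
  show ?case by (auto intro!: INF_greatest intro: order_trans[OF Suc])
qed simp

text \<open>The added 1 makes the inequality strict. The recursion of \<open>Hs_sq\<close> is an
  infimum, and only a strict bound yields an actual weak derivative below it.\<close>

lemma Hs_norm_leD:
  assumes "Hs_norm s u \<le> ennreal e" "e \<ge> 0" and "frac s = \<sigma>" "nat \<lfloor>s\<rfloor> = m"
  shows "Hs_sq \<sigma> m u < ennreal (e\<^sup>2 + 1)"
proof -
  have "Hs_sq \<sigma> m u \<le> ennreal (e\<^sup>2)" using assms by (intro ennsqrt_leD) (auto simp: Hs_norm_def)
  also have "\<dots> < ennreal (e\<^sup>2 + 1)" by (intro ennreal_lessI) (auto intro: add_nonneg_pos)
  finally show ?thesis .
qed

lemma Hs_sq_Suc_lessD:
  assumes "Hs_sq \<sigma> (Suc m) u < B"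
  obtains v where "weak_deriv u v" "Hs_sq \<sigma> m u \<le> B" "Hs_sq \<sigma> m v < B"
proof -
  obtain v where v: "weak_deriv u v" "Hs_sq \<sigma> m u + Hs_sq \<sigma> m v < B"
    using assms by (auto simp: INF_less_iff)
  have "Hs_sq \<sigma> m u \<le> Hs_sq \<sigma> m u + Hs_sq \<sigma> m v" "Hs_sq \<sigma> m v \<le> Hs_sq \<sigma> m u + Hs_sq \<sigma> m v" by auto
  then show ?thesis using that v order.strict_trans1 less_imp_le by metis
qed

text \<open>Whatever \<open>\<sigma>\<close> and \<open>m\<close> are, \<open>Hs_sq\<close>
  dominates \<open>L2_sq\<close>, so one weak derivative in L^2 is available for
  \<open>H1_regular\<close>. The factor 2 comes from its supremum bound
  \<open>sqrt B + sqrt B\<close>.\<close>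

lemma Hs_sq_Suc_regular:
  assumes "Hs_sq \<sigma> (Suc m) h < ennreal B" "B \<ge> 0"
  shows "\<exists>H. (AE x in leb01. h x = H x) \<and> (\<forall>x\<in>{0..1}. norm (H x) \<le> 2 * sqrt B) \<and>
    (\<forall>x\<in>{0..1}. \<forall>y\<in>{0..1}. norm (H x - H y) \<le> 2 * sqrt B * \<bar>x - y\<bar> powr (1/2))"
proof -
  obtain v where v: "weak_deriv h v" "Hs_sq \<sigma> m h \<le> ennreal B" "Hs_sq \<sigma> m v < ennreal B"
    using Hs_sq_Suc_lessD[OF assms(1)] by metis
  have L: "L2_sq h \<le> ennreal B" "L2_sq v \<le> ennreal B"
    using v order_trans[OF L2_sq_le_Hs_sq] less_imp_le by blast+
  show ?thesis
  proof (rule H1_regular[OF L(1) assms(2) v(1) L(2) assms(2)])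
    fix H assume H: "AE x in leb01. h x = H x" "\<And>x. x \<in> {0..1} \<Longrightarrow> norm (H x) \<le> sqrt B + sqrt B"
      "\<And>x y. x \<in> {0..1} \<Longrightarrow> y \<in> {0..1} \<Longrightarrow> norm (H x - H y) \<le> sqrt B * \<bar>x - y\<bar> powr (1/2)"
    have "norm (H x - H y) \<le> 2 * sqrt B * \<bar>x - y\<bar> powr (1/2)" if "x \<in> {0..1}" "y \<in> {0..1}" for x y
      by (rule order_trans[OF H(3)[OF that]]) (use assms(2) in \<open>simp add: mult_right_mono\<close>)
    then show ?thesis using H by (intro exI[of _ H]) auto
  qed
qed

theorem corollary1p1:
  fixes L a b c k :: real
    and U U' U'' f g :: "real \<Rightarrow> real"
    and \<omega>0 :: "real \<Rightarrow> complex"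
    and W \<Phi> :: "real \<Rightarrow> real \<Rightarrow> complex"
  assumes "L > 0"
    and "\<exists>n::int. n \<noteq> 0 \<and> k = 2 * pi / L * of_int n"
    and "a < b"
    and "\<And>y. y \<in> {a..b} \<Longrightarrow> (U has_real_derivative U' y) (at y within {a..b})"
    and "\<And>y. y \<in> {a..b} \<Longrightarrow> (U' has_real_derivative U'' y) (at y within {a..b})"
    and "strict_mono_on {a..b} U \<or> strict_antimono_on {a..b} U"
    and "U ` {a..b} = {0..1}"
    and "c > 0" and "\<And>y. y \<in> {a..b} \<Longrightarrow> (U' y)\<^sup>2 > c"
    and "f = (\<lambda>y. U'' (the_inv_into {a..b} U y))"
    and "g = (\<lambda>y. U' (the_inv_into {a..b} U y))"
    and "W2inf f" and "W2inf g"
    and "euler_solution k f g \<omega>0 W \<Phi>"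
    and "continuous (at 0 within {0..1}) \<omega>0" and "continuous (at 1 within {0..1}) \<omega>0"
    and "of_real (f 0) * \<omega>0 0 \<noteq> 0 \<or> of_real (f 1) * \<omega>0 1 \<noteq> 0"
  shows "(\<forall>s>1. \<forall>Wy. (\<forall>t. weak_deriv (W t) (Wy t)) \<and>
              (\<exists>C<\<infinity>. \<forall>t. Hs_norm s (Wy t) < C) \<longrightarrow>
            (\<exists>c'>0. \<exists>T0>1. \<forall>t. \<bar>t\<bar> \<ge> T0 \<longrightarrow> Linf_norm (Wy t) \<ge> ennreal (c' * ln \<bar>t\<bar>)))
       \<and> (\<forall>s. 3/2 < s \<and> s \<le> 2 \<longrightarrow> (SUP t\<in>{0<..}. Hs_norm s (W t)) = \<infinity>)"
proof -
  have k: "k \<noteq> 0" using assms(1,2) by auto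
  note regular = shear_profile_regular[OF assms(3-12)]
  have contra: False
    if \<alpha>: "\<alpha> > 0" and reg: "\<And>t. t > 0 \<Longrightarrow> \<exists>Wy H. weak_deriv (W t) Wy \<and> (AE x in leb01. Wy x = H x) \<and>
      (\<forall>x\<in>{0..1}. norm (H x) \<le> M) \<and> (\<forall>x\<in>{0..1}. \<forall>y\<in>{0..1}. norm (H x - H y) \<le> M * \<bar>x - y\<bar> powr \<alpha>)" for M \<alpha>
    using no_uniform_Hoelder_bound[OF k regular assms(14,15,16) reg \<alpha>] assms(17) by auto
  show ?thesis
  proof (intro conjI allI impI)
    fix s :: real and Wy assume s: "1 < s"
      and Wy: "(\<forall>t. weak_deriv (W t) (Wy t)) \<and> (\<exists>C<\<infinity>. \<forall>t. Hs_norm s (Wy t) < C)"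
    then obtain C where C: "C < \<infinity>" "\<And>t. Hs_norm s (Wy t) < C" by auto
    obtain e where e: "C = ennreal e" "e \<ge> 0" using C(1) by (cases C) auto
    \<comment> \<open>As s > 1, at least one full weak derivative of \<open>Wy t\<close> is bounded
      in L^2, independently of the fractional part of s.\<close>
    have "nat \<lfloor>s\<rfloor> \<noteq> 0" using s by linarith
    then obtain m where m: "nat \<lfloor>s\<rfloor> = Suc m" by (metis not0_implies_Suc)
    have "Hs_sq (frac s) (Suc m) (Wy t) < ennreal (e\<^sup>2 + 1)" for t
      by (rule Hs_norm_leD[OF _ e(2) refl m]) (use C(2)[of t] e in auto)
    then have "\<exists>H. (AE x in leb01. Wy t x = H x) \<and> (\<forall>x\<in>{0..1}. norm (H x) \<le> 2 * sqrt (e\<^sup>2 + 1)) \<and>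
        (\<forall>x\<in>{0..1}. \<forall>y\<in>{0..1}. norm (H x - H y) \<le> 2 * sqrt (e\<^sup>2 + 1) * \<bar>x - y\<bar> powr (1/2))" for t
      by (rule Hs_sq_Suc_regular) simp
    moreover have "weak_deriv (W t) (Wy t)" for t using Wy by blast
    ultimately have False by (intro contra[of "1/2" "2 * sqrt (e\<^sup>2 + 1)"]) (simp, blast)
    then show "\<exists>c'>0. \<exists>T0>1. \<forall>t. \<bar>t\<bar> \<ge> T0 \<longrightarrow> Linf_norm (Wy t) \<ge> ennreal (c' * ln \<bar>t\<bar>)" ..
  next
    fix s :: real assume s: "3/2 < s \<and> s \<le> 2"
    show "(SUP t\<in>{0<..}. Hs_norm s (W t)) = \<infinity>"
    proof (rule ccontr)
      assume "(SUP t\<in>{0<..}. Hs_norm s (W t)) \<noteq> \<infinity>"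
      then obtain e where e: "(SUP t\<in>{0<..}. Hs_norm s (W t)) = ennreal e" "e \<ge> 0"
        by (cases "SUP t\<in>{0<..}. Hs_norm s (W t)") auto
      have W: "Hs_norm s (W t) \<le> ennreal e" if "t > 0" for t
        unfolding e(1)[symmetric] using that by (intro SUP_upper) auto
      define B where "B = e\<^sup>2 + 1"
      have B: "B \<ge> 0" by (simp add: B_def)
      show False
      \<comment> \<open>At s = 2 the floor jumps to 2 and the fractional part is 0, so there is no
        Gagliardo term and the second weak derivative takes its place.\<close>
      proof (cases "s = 2")
        case True
        show False
        proof (rule contra[of "1/2" "2 * sqrt B"])
          fix t :: real assume "t > 0"
          then have "Hs_sq 0 (Suc (Suc 0)) (W t) < ennreal B"
            unfolding B_def by (intro Hs_norm_leD[OF W e(2)]) (auto simp: True)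
          then obtain v where "weak_deriv (W t) v" "Hs_sq 0 (Suc 0) v < ennreal B"
            by (rule Hs_sq_Suc_lessD)
          then show "\<exists>Wy H. weak_deriv (W t) Wy \<and> (AE x in leb01. Wy x = H x) \<and>
            (\<forall>x\<in>{0..1}. norm (H x) \<le> 2 * sqrt B) \<and> (\<forall>x\<in>{0..1}. \<forall>y\<in>{0..1}. norm (H x - H y) \<le> 2 * sqrt B * \<bar>x - y\<bar> powr (1/2))"
            using Hs_sq_Suc_regular[OF _ B] by blast
        qed simp
      next
        case False
        then have fl: "\<lfloor>s\<rfloor> = 1" using s by linarith
        define \<sigma> where "\<sigma> = s - 1"
        \<comment> \<open>The threshold 3/2 originates here: the Hoelder exponent \<sigma> - 1/2 of
          the derivative has to be positive.\<close>
        have \<sigma>: "\<sigma> > 1/2" using s by (simp add: \<sigma>_def)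
        define K where "K = 2 * sqrt (2 * B) / (1 - 2 powr - (\<sigma> - 1/2))"
        have "(2::real) powr - (\<sigma> - 1/2) < 2 powr 0" using \<sigma> by (intro powr_less_mono) auto
        then have K: "K \<ge> 0" using B by (simp add: K_def)
        show False
        proof (rule contra[of "\<sigma> - 1/2" "sqrt B + K"])
          fix t :: real assume "t > 0"
          then have "Hs_sq \<sigma> (Suc 0) (W t) < ennreal B"
            unfolding B_def by (intro Hs_norm_leD[OF W e(2)]) (auto simp: fl \<sigma>_def frac_def)
          then obtain v where v: "weak_deriv (W t) v" "Hs_sq \<sigma> 0 v < ennreal B"
            by (rule Hs_sq_Suc_lessD)
          then have le: "L2_sq v + gagliardo_sq \<sigma> v \<le> ennreal B" using \<sigma> by simp
          have L: "L2_sq v \<le> ennreal B" "gagliardo_sq \<sigma> v \<le> ennreal B"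
            by (rule order_trans[OF _ le], simp)+
          show "\<exists>Wy H. weak_deriv (W t) Wy \<and> (AE x in leb01. Wy x = H x) \<and>
            (\<forall>x\<in>{0..1}. norm (H x) \<le> sqrt B + K) \<and> (\<forall>x\<in>{0..1}. \<forall>y\<in>{0..1}. norm (H x - H y) \<le> (sqrt B + K) * \<bar>x - y\<bar> powr (\<sigma> - 1/2))"
          proof (rule gagliardo_regular[OF L(1) B L(2) B \<sigma>, folded K_def])
            fix H assume H: "AE x in leb01. v x = H x" "\<And>x. x \<in> {0..1} \<Longrightarrow> norm (H x) \<le> sqrt B + K"
              "\<And>x y. x \<in> {0..1} \<Longrightarrow> y \<in> {0..1} \<Longrightarrow> norm (H x - H y) \<le> K * \<bar>x - y\<bar> powr (\<sigma> - 1/2)"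
            have "norm (H x - H y) \<le> (sqrt B + K) * \<bar>x - y\<bar> powr (\<sigma> - 1/2)" if "x \<in> {0..1}" "y \<in> {0..1}" for x y
              by (rule order_trans[OF H(3)[OF that]]) (use B in \<open>simp add: mult_right_mono\<close>)
            then show ?thesis using v(1) H by (intro exI[of _ v] exI[of _ H]) auto
          qed
        qed (use \<sigma> in simp)
      qed
    qed
  qed
qed

end
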